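(* For every integer $n>1$, $$\mathcal{Q}(G_{n,n-1})=\operatorname{ch}\left(\left(\sum_{r=0}^{n-1}a_r\,\chi^{(n-1+r,\,n-1-r)}\right)\downarrow^{\mathfrak{S}_{2n-2}}_{\mathfrak{S}_n}\right),$$ where $a_r$ is the number of perfect matchings of $2r$ points on a line with no short chords.
   Context: $K_n$ is the complete graph on vertex set $\{1,\dots,n\}$. $G_{n,n-1}$ is the set of Gallai $(n-1)$-partitions of $K_n$: unordered partitions of the edge set into $n-1$ nonempty blocks such that every cycle contains at least two edges in the same block. For $p\in G_{n,n-1}$, $\operatorname{Des}(p):=\{i\in\{1,\dots,n-1\}: \text{the edge }(i,i+1)\text{ forms a singleton block in }p\}$, and $\mathcal{Q}(G_{n,n-1}):=\sum_{p\in G_{n,n-1}}\mathcal{F}_{\operatorname{Des}(p)}$, where for $J\subseteq\{1,\dots,n-1\}$, $\mathcal{F}_J(\mathbf{x}):=\sum x_{i_1}\cdots x_{i_n}$ over $i_1\le\dots\le i_n$ with $i_j<i_{j+1}$ whenever $j\in J$. A perfect matching of $2r$ points on a line, labeled $1,\dots,2r$ in order, has a short chord if it matches $i$ with $i+1$ for some $1\le i<2r$; $a_r$ counts the perfect matchings with none (so $a_0=1$, $a_1=0$). $\chi^\lambda$ is the irreducible character of the symmetric group indexed by the partition $\lambda$, $\downarrow$ denotes restriction, and $\operatorname{ch}$ is the Frobenius characteristic map, the linear map from class functions on $\mathfrak{S}_n$ to symmetric functions with $\operatorname{ch}(\chi^\lambda)=s_\lambda$. *)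

theory Defs
  imports
    Complex_Main
    "HOL-Library.Multiset"
    "HOL-Library.FuncSet"
    "HOL-Library.Disjoint_Sets"
    "HOL-Library.Function_Algebras"
    "HOL-Combinatorics.Permutations"
begin

section \<open>Complex-valued functions as a vector space\<close>

definition cscale :: "complex \<Rightarrow> ('a \<Rightarrow> complex) \<Rightarrow> 'a \<Rightarrow> complex"
  where "cscale c f = (\<lambda>x. c * f x)"

interpretation cfun: vector_space "cscale :: complex \<Rightarrow> ('a \<Rightarrow> complex) \<Rightarrow> 'a \<Rightarrow> complex"
  by unfold_locales (auto simp: cscale_def fun_eq_iff algebra_simps)

text \<open>Only meaningful if \<open>V\<close> is a finite-dimensional subspace that is mapped into itself by the
  linear map \<open>f\<close>; the value then does not depend on the chosen basis.\<close>

definition trace_on ::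
    "('a \<Rightarrow> complex) set \<Rightarrow> (('a \<Rightarrow> complex) \<Rightarrow> ('a \<Rightarrow> complex)) \<Rightarrow> complex"
  where "trace_on V f =
    (let B = (SOME B. cfun.independent B \<and> cfun.span B = V)
     in \<Sum>b\<in>B. cfun.representation B (f b) b)"


section \<open>Gallai partitions of complete graphs\<close>

definition complete_edges :: "nat \<Rightarrow> nat set set"
  where "complete_edges n = {e. e \<subseteq> {1..n} \<and> card e = 2}"

text \<open>A cycle is given by the list of its vertices in cyclic order.\<close>

definition is_cycle :: "nat \<Rightarrow> nat list \<Rightarrow> bool"
  where "is_cycle n vs \<longleftrightarrow> 3 \<le> length vs \<and> distinct vs \<and> set vs \<subseteq> {1..n}"

definition cycle_edges :: "nat list \<Rightarrow> nat set set"
  where "cycle_edges vs = {{vs ! i, vs ! (Suc i mod length vs)} | i. i < length vs}"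

definition gallai_partitions :: "nat \<Rightarrow> nat \<Rightarrow> nat set set set set"
  where "gallai_partitions n k =
    {p. partition_on (complete_edges n) p \<and> card p = k \<and>
        (\<forall>vs. is_cycle n vs \<longrightarrow>
          (\<exists>B\<in>p. \<exists>e\<in>cycle_edges vs. \<exists>e'\<in>cycle_edges vs. e \<noteq> e' \<and> e \<in> B \<and> e' \<in> B))}"

definition Des :: "nat \<Rightarrow> nat set set set \<Rightarrow> nat set"
  where "Des n p = {i\<in>{1..n-1}. {{i, i + 1}} \<in> p}"


section \<open>Quasisymmetric and Schur functions\<close>

text \<open>A formal power series in the countably many variables \<open>x\<^sub>0, x\<^sub>1, \<dots>\<close> is the function
  mapping each monomial to its coefficient; the monomial \<open>x\<^bsub>i\<^sub>1\<^esub> \<cdots> x\<^bsub>i\<^sub>n\<^esub>\<close> is the multiset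
  of its indices.\<close>

type_synonym power_series = "nat multiset \<Rightarrow> complex"

text \<open>The list \<open>is\<close> holds \<open>i\<^sub>1, \<dots>, i\<^sub>n\<close>, so that \<open>i\<^sub>j\<close> is \<open>is ! (j - 1)\<close>.\<close>

definition fundamental_qsym :: "nat \<Rightarrow> nat set \<Rightarrow> power_series"
  where "fundamental_qsym n J = (\<lambda>m. of_nat (card
    {is. length is = n \<and> sorted is \<and> (\<forall>j\<in>J. is ! (j - 1) < is ! j) \<and> mset is = m}))"

definition gallai_qsym :: "nat \<Rightarrow> nat \<Rightarrow> power_series"
  where "gallai_qsym n k = (\<Sum>p\<in>gallai_partitions n k. fundamental_qsym n (Des n p))"

text \<open>A partition is the sequence of its parts, indexed from 0 and padded with zeros.\<close>

definition partitions_of :: "nat \<Rightarrow> (nat \<Rightarrow> nat) set"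
  where "partitions_of n =
    {l. antimono l \<and> finite {i. l i \<noteq> 0} \<and> (\<Sum>i | l i \<noteq> 0. l i) = n}"

definition two_rows :: "nat \<Rightarrow> nat \<Rightarrow> nat \<Rightarrow> nat"
  where "two_rows a b = (\<lambda>i. if i = 0 then a else if i = 1 then b else 0)"

definition diagram :: "(nat \<Rightarrow> nat) \<Rightarrow> (nat \<times> nat) set"
  where "diagram l = {(i, j). j < l i}"

definition semistandard_tableaux :: "(nat \<Rightarrow> nat) \<Rightarrow> (nat \<times> nat \<Rightarrow> nat) set"
  where "semistandard_tableaux l =
    {T \<in> extensional (diagram l).
       (\<forall>i j j'. (i, j) \<in> diagram l \<and> (i, j') \<in> diagram l \<and> j < j' \<longrightarrow> T (i, j) \<le> T (i, j')) \<and>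
       (\<forall>i i' j. (i, j) \<in> diagram l \<and> (i', j) \<in> diagram l \<and> i < i' \<longrightarrow> T (i, j) < T (i', j))}"

definition schur :: "(nat \<Rightarrow> nat) \<Rightarrow> power_series"
  where "schur l = (\<lambda>m. of_nat (card
    {T \<in> semistandard_tableaux l. image_mset T (mset_set (diagram l)) = m}))"


section \<open>Irreducible characters of the symmetric group\<close>

text \<open>A tableau of shape \<open>l\<close> is recorded by the map sending each entry in \<open>{1..n}\<close> to the cell
  (row, column) that contains it. Its tabloid remembers only the row of each entry.
  The tableau \<open>\<pi>T\<close>, obtained by applying the permutation \<open>\<pi>\<close> to the entries, is
  \<open>T \<circ> inv \<pi>\<close>.\<close>

definition tableaux :: "nat \<Rightarrow> (nat \<Rightarrow> nat) \<Rightarrow> (nat \<Rightarrow> nat \<times> nat) set"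
  where "tableaux n l = {T \<in> extensional {1..n}. bij_betw T {1..n} (diagram l)}"

definition tabloid :: "nat \<Rightarrow> (nat \<Rightarrow> nat \<times> nat) \<Rightarrow> nat \<Rightarrow> nat"
  where "tabloid n T = restrict (fst \<circ> T) {1..n}"

definition column_stabilizer :: "nat \<Rightarrow> (nat \<Rightarrow> nat \<times> nat) \<Rightarrow> (nat \<Rightarrow> nat) set"
  where "column_stabilizer n T =
    {\<pi>. \<pi> permutes {1..n} \<and> (\<forall>x\<in>{1..n}. snd (T (\<pi> x)) = snd (T x))}"

definition polytabloid :: "nat \<Rightarrow> (nat \<Rightarrow> nat \<times> nat) \<Rightarrow> (nat \<Rightarrow> nat) \<Rightarrow> complex"
  where "polytabloid n T =
    (\<lambda>t. \<Sum>\<pi>\<in>column_stabilizer n T. of_int (sign \<pi>) * of_bool (t = tabloid n (T \<circ> inv \<pi>)))"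

definition specht_module :: "nat \<Rightarrow> (nat \<Rightarrow> nat) \<Rightarrow> ((nat \<Rightarrow> nat) \<Rightarrow> complex) set"
  where "specht_module n l = cfun.span (polytabloid n ` tableaux n l)"

text \<open>The linear extension of \<open>t \<mapsto> \<sigma>t = t \<circ> inv \<sigma>\<close>: the coefficient of \<open>t\<close> in \<open>\<sigma>v\<close> is the
  coefficient of \<open>inv \<sigma> t = t \<circ> \<sigma>\<close> in \<open>v\<close>.\<close>

definition perm_action ::
    "(nat \<Rightarrow> nat) \<Rightarrow> ((nat \<Rightarrow> nat) \<Rightarrow> complex) \<Rightarrow> (nat \<Rightarrow> nat) \<Rightarrow> complex"
  where "perm_action \<sigma> v = (\<lambda>t. v (t \<circ> \<sigma>))"

text \<open>The symmetric group on \<open>n\<close> letters is \<open>{\<sigma>. \<sigma> permutes {1..n}}\<close>, so for \<open>n \<le> m\<close> it is a subset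
  of the symmetric group on \<open>m\<close> letters. Functions on it are extended by zero.\<close>

definition restrict_to_sym :: "nat \<Rightarrow> ((nat \<Rightarrow> nat) \<Rightarrow> complex) \<Rightarrow> (nat \<Rightarrow> nat) \<Rightarrow> complex"
  where "restrict_to_sym n f = (\<lambda>\<sigma>. if \<sigma> permutes {1..n} then f \<sigma> else 0)"

definition class_functions :: "nat \<Rightarrow> ((nat \<Rightarrow> nat) \<Rightarrow> complex) set"
  where "class_functions n =
    {f. (\<forall>\<sigma>. \<not> \<sigma> permutes {1..n} \<longrightarrow> f \<sigma> = 0) \<and>
        (\<forall>\<sigma> \<tau>. \<sigma> permutes {1..n} \<and> \<tau> permutes {1..n} \<longrightarrow> f (\<tau> \<circ> \<sigma> \<circ> inv \<tau>) = f \<sigma>)}"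

definition irr_char :: "nat \<Rightarrow> (nat \<Rightarrow> nat) \<Rightarrow> (nat \<Rightarrow> nat) \<Rightarrow> complex"
  where "irr_char n l =
    restrict_to_sym n (\<lambda>\<sigma>. trace_on (specht_module n l) (perm_action \<sigma>))"

text \<open>The irreducible characters form a basis of the class functions, so a map with these
  properties exists, and its values on class functions are uniquely determined. Its values
  elsewhere are irrelevant.\<close>

definition frobenius_ch :: "nat \<Rightarrow> ((nat \<Rightarrow> nat) \<Rightarrow> complex) \<Rightarrow> power_series"
  where "frobenius_ch n = (SOME \<phi>.
    (\<forall>f\<in>class_functions n. \<forall>g\<in>class_functions n. \<phi> (f + g) = \<phi> f + \<phi> g) \<and>
    (\<forall>c. \<forall>f\<in>class_functions n. \<phi> (cscale c f) = cscale c (\<phi> f)) \<and>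
    (\<forall>l\<in>partitions_of n. \<phi> (irr_char n l) = schur l))"


section \<open>Perfect matchings without short chords\<close>

definition perfect_matchings :: "nat \<Rightarrow> nat set set set"
  where "perfect_matchings r = {M. partition_on {1..2*r} M \<and> (\<forall>e\<in>M. card e = 2)}"

definition no_short_chord_count :: "nat \<Rightarrow> nat"
  where "no_short_chord_count r =
    card {M \<in> perfect_matchings r. \<forall>i. 1 \<le> i \<and> i < 2 * r \<longrightarrow> {i, i + 1} \<notin> M}"

end

theory Submission
  imports Defs "HOL-Computational_Algebra.Polynomial"
begin

text \<open>Extract the coefficient of a monomial \<open>m\<close> of degree \<open>n\<close> on both sides. On the left, it counts the
  Gallai partitions in which no edge \<open>{i, i + 1}\<close> between equal letters of the sorted word of \<open>m\<close>
  is a singleton block. A deletion-contraction rule, shared by Gallai partitions and perfect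
  matchings, turns this into the number of perfect matchings of \<open>2n - 2\<close> points that avoid these
  pairs. A second deletion-contraction rule, now at the boundary between two runs of equal letters,
  evaluates that number as \<open>\<Sum>\<^sub>r a\<^sub>r [X\<^bsup>n-1-r\<^esup>] (1 - X) P (1 + X)\<^bsup>n-2\<^esup>\<close>, where \<open>P\<close> is the product of the
  \<open>1 + X + \<dots> + X\<^sup>c\<close> over the multiplicities \<open>c\<close> in \<open>m\<close>.

  On the right, \<open>\<chi>\<^bsup>(k-b,b)\<^esup>(\<sigma>) = [X\<^sup>b] (1 - X) F\<close>, where \<open>F\<close> enumerates the subsets of \<open>{1..k}\<close>
  fixed by \<open>\<sigma>\<close> by their size; extending \<open>\<sigma>\<close> by \<open>n - 2\<close> fixed points multiplies \<open>F\<close> by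
  \<open>(1 + X)\<^bsup>n-2\<^esup>\<close>. In the same way, the coefficient of \<open>m\<close> in \<open>s\<^bsub>(n-b,b)\<^esub>\<close> is \<open>[X\<^sup>b] (1 - X) P\<close>. Both
  \<open>(1 - X) P\<close> and \<open>(1 - X) F\<close> are antisymmetric of degree \<open>n + 1\<close>, hence determined by their
  coefficients of index at most \<open>n / 2\<close>, on which the Frobenius map is known.\<close>

section \<open>Gallai partitions and perfect matchings\<close>

text \<open>Partitions and matchings can be compared because contracting an edge costs one vertex
  while using a pair costs two points, so the relation between n vertices and 2n - 2 points
  survives. In both cases the forbidden pairs that meet the chosen one drop out. The Frobenius map
  is only given by a choice operator: it is linear on class functions and has prescribed values on
  irreducible characters. That such a map exists must be proved first, which takes the linear
  independence of all irreducible characters; it comes from column antisymmetrizers, which are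
  triangular in the dominance order. After that, only two-rowed characters occur. Both sides are
  values of one linear functional, \<open>chord_sum\<close>, on polynomials that are antisymmetric
  about (n + 1)/2. Expanding these in the differences X^i - X^(n+1-i) puts the same scalar
  \<open>chord_weight n i\<close> in front of the Schur function and of the character of shape (n -
  i, i), so these scalars never have to be evaluated.\<close>

lemma partition_on_block_eq:
  assumes "partition_on A p" "B \<in> p" "C \<in> p" "x \<in> B" "x \<in> C"
  shows "B = C"
  using assms by (auto simp: partition_on_def disjoint_def)

lemma partition_on_finite:
  assumes "partition_on A p" "finite A"
  shows "finite p"
  using assms finite_elements by blast

definition edges :: "'a set \<Rightarrow> 'a set set"
  where "edges V = {e. e \<subseteq> V \<and> card e = 2}"

lemma complete_edges_eq: "complete_edges n = edges {1..n}"
  by (simp add: complete_edges_def edges_def)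

lemma edges_iff: "e \<in> edges V \<longleftrightarrow> (\<exists>x y. x \<noteq> y \<and> x \<in> V \<and> y \<in> V \<and> e = {x, y})"
  by (auto simp: edges_def card_2_iff)

lemma pair_in_edges_iff: "{x, y} \<in> edges V \<longleftrightarrow> x \<noteq> y \<and> x \<in> V \<and> y \<in> V"
  by (auto simp: edges_def card_insert_if)

lemma edges_mono: "U \<subseteq> V \<Longrightarrow> edges U \<subseteq> edges V"
  by (auto simp: edges_def)

lemma finite_edges: "finite V \<Longrightarrow> finite (edges V)"
  by (rule finite_subset[of _ "Pow V"]) (auto simp: edges_def)

section \<open>Rainbow triangles and rainbow cycles\<close>

definition mono_angle :: "'a set set set \<Rightarrow> 'a \<Rightarrow> 'a \<Rightarrow> 'a \<Rightarrow> bool"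
  where "mono_angle p x y z \<longleftrightarrow> (\<exists>B\<in>p. {x, y} \<in> B \<and> {x, z} \<in> B)"

lemma mono_angle_commute: "mono_angle p x y z \<longleftrightarrow> mono_angle p x z y"
  by (auto simp: mono_angle_def)

text \<open>The Gallai condition for triangles only: two edges of a triangle always meet in a
  vertex, the first point of \<open>mono_angle\<close>. Longer cycles follow by
  \<open>rainbow_free_cycle\<close>.\<close>

definition rainbow_free :: "'a set \<Rightarrow> 'a set set set \<Rightarrow> bool"
  where "rainbow_free V p \<longleftrightarrow> (\<forall>x\<in>V. \<forall>y\<in>V. \<forall>z\<in>V. x \<noteq> y \<and> x \<noteq> z \<and> y \<noteq> z \<longrightarrow>
    mono_angle p x y z \<or> mono_angle p y x z \<or> mono_angle p z x y)"

lemma rainbow_freeD: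
  assumes "rainbow_free V p" "x \<in> V" "y \<in> V" "z \<in> V" "x \<noteq> y" "x \<noteq> z" "y \<noteq> z"
  obtains B where "B \<in> p" "{x, y} \<in> B \<and> {x, z} \<in> B \<or> {x, y} \<in> B \<and> {y, z} \<in> B \<or>
    {x, z} \<in> B \<and> {y, z} \<in> B"
proof -
  have "mono_angle p x y z \<or> mono_angle p y x z \<or> mono_angle p z x y"
    using assms unfolding rainbow_free_def by simp
  moreover have "{y, x} = {x, y}" "{z, x} = {x, z}" "{z, y} = {y, z}" by auto
  ultimately show ?thesis using that unfolding mono_angle_def by force
qed

definition path_edges :: "nat list \<Rightarrow> nat set set"
  where "path_edges vs = {{vs ! i, vs ! Suc i} |i. Suc i < length vs}"

lemma path_edges_Cons_Cons: "path_edges (x # y # zs) = insert {x, y} (path_edges (y # zs))"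
proof (intro equalityI subsetI)
  fix e assume "e \<in> path_edges (x # y # zs)"
  then obtain i where i: "Suc i < length (x # y # zs)"
    "e = {(x # y # zs) ! i, (x # y # zs) ! Suc i}" unfolding path_edges_def by blast
  then show "e \<in> insert {x, y} (path_edges (y # zs))"
    by (cases i) (auto simp: path_edges_def)
next
  fix e assume "e \<in> insert {x, y} (path_edges (y # zs))"
  then consider "e = {x, y}" | i where "Suc i < length (y # zs)"
    "e = {(y # zs) ! i, (y # zs) ! Suc i}" unfolding path_edges_def by blast
  then show "e \<in> path_edges (x # y # zs)"
  proof cases
    case 1 then show ?thesis unfolding path_edges_def by (auto intro!: exI[of _ 0])
  next
    case 2 then show ?thesis unfolding path_edges_def by (auto intro!: exI[of _ "Suc i"])
  qed
qed

lemma path_edges_subset: "e \<in> path_edges vs \<Longrightarrow> e \<subseteq> set vs"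
  by (auto simp: path_edges_def)

lemma cycle_edges_eq:
  assumes "vs \<noteq> []"
  shows "cycle_edges vs = insert {last vs, hd vs} (path_edges vs)"
proof (intro equalityI subsetI)
  fix e assume "e \<in> cycle_edges vs"
  then obtain i where i: "i < length vs" "e = {vs ! i, vs ! (Suc i mod length vs)}"
    unfolding cycle_edges_def by blast
  show "e \<in> insert {last vs, hd vs} (path_edges vs)"
  proof (cases "Suc i = length vs")
    case True
    then have "i = length vs - 1" by simp
    then show ?thesis using i True assms by (simp add: last_conv_nth hd_conv_nth)
  next
    case False
    then show ?thesis using i by (auto simp: path_edges_def)
  qed
next
  fix e assume e: "e \<in> insert {last vs, hd vs} (path_edges vs)"
  show "e \<in> cycle_edges vs"
  proof (cases "e = {last vs, hd vs}")
    case True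
    then show ?thesis unfolding cycle_edges_def using assms
      by (auto simp: last_conv_nth hd_conv_nth intro!: exI[of _ "length vs - 1"])
  next
    case False
    then obtain i where "Suc i < length vs" "e = {vs ! i, vs ! Suc i}"
      using e unfolding path_edges_def by blast
    then show ?thesis unfolding cycle_edges_def by (auto intro!: exI[of _ i])
  qed
qed

lemma cycle_edges_Cons3:
  "cycle_edges (a # b # c # zs) =
     insert {a, b} (insert {b, c} (insert {last (c # zs), a} (path_edges (c # zs))))"
  by (subst cycle_edges_eq) (auto simp: path_edges_Cons_Cons)

lemma cycle_edges_Cons2:
  "cycle_edges (a # c # zs) = insert {a, c} (insert {last (c # zs), a} (path_edges (c # zs)))"
  by (subst cycle_edges_eq) (auto simp: path_edges_Cons_Cons)

text \<open>A chord cuts a rainbow cycle into two shorter cycles one of which is rainbow.\<close>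

lemma rainbow_free_cycle:
  assumes p: "partition_on (edges V) p" and rf: "rainbow_free V p"
    and "3 \<le> length vs" "distinct vs" "set vs \<subseteq> V"
  shows "\<exists>B\<in>p. \<exists>e\<in>cycle_edges vs. \<exists>e'\<in>cycle_edges vs. e \<noteq> e' \<and> e \<in> B \<and> e' \<in> B"
  using assms(3-5)
proof (induction "length vs" arbitrary: vs rule: less_induct)
  case less
  obtain a b c zs where vs: "vs = a # b # c # zs"
    using less.prems(1) by (auto simp: numeral_3_eq_3 Suc_le_length_iff)
  have dist: "a \<noteq> b" "a \<noteq> c" "b \<noteq> c" and inV: "a \<in> V" "b \<in> V" "c \<in> V"
    using less.prems vs by auto
  define R where "R = insert {last (c # zs), a} (path_edges (c # zs))"
  have R_sub: "e \<subseteq> insert a (insert c (set zs))" if "e \<in> R" for e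
    using that path_edges_subset[of e "c # zs"] last_in_set[of "c # zs"]
    by (auto simp: R_def)
  have b_notin: "b \<notin> e" if "e \<in> R" for e
    using R_sub[OF that] less.prems(2) vs by auto
  have ce: "cycle_edges vs = insert {a, b} (insert {b, c} R)"
    unfolding vs R_def by (rule cycle_edges_Cons3)
  have ab: "{a, b} \<in> cycle_edges vs" and bc: "{b, c} \<in> cycle_edges vs" and
    ne: "{a, b} \<noteq> {b, c}" and RC: "R \<subseteq> cycle_edges vs"
    using dist by (auto simp: ce doubleton_eq_iff)
  have witness: ?case if "B \<in> p" "e \<in> cycle_edges vs" "e' \<in> cycle_edges vs" "e \<noteq> e'"
    "e \<in> B" "e' \<in> B" for B e e'
    using that by blast
  obtain B where B: "B \<in> p" "{a, b} \<in> B \<and> {a, c} \<in> B \<or> {a, b} \<in> B \<and> {b, c} \<in> B \<or>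
    {a, c} \<in> B \<and> {b, c} \<in> B"
    by (rule rainbow_freeD[OF rf inV dist])
  show ?case
  proof (cases "{a, b} \<in> B \<and> {b, c} \<in> B")
    case True
    then show ?thesis using witness[OF B(1) ab bc ne] by simp
  next
    case False
    then have "{a, c} \<in> B" "{a, b} \<in> B \<or> {b, c} \<in> B" using B(2) by argo+
    then obtain f where B: "B \<in> p" "{a, c} \<in> B" "f \<in> B" "f = {a, b} \<or> f = {b, c}"
      using B(1) by (elim disjE) simp_all
    have f: "f \<in> cycle_edges vs" "b \<in> f" using B(4) ab bc by auto
    show ?thesis
    proof (cases "zs = []")
      case True
      then have "{a, c} \<in> R" by (auto simp: R_def insert_commute)
      moreover have "{a, c} \<noteq> f" using f b_notin \<open>{a, c} \<in> R\<close> by auto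
      ultimately show ?thesis using B f RC by (intro witness[of B "{a, c}" f]) auto
    next
      case False
      have "\<exists>B\<in>p. \<exists>e\<in>cycle_edges (a # c # zs). \<exists>e'\<in>cycle_edges (a # c # zs).
        e \<noteq> e' \<and> e \<in> B \<and> e' \<in> B"
        using less.prems False vs by (intro less.hyps) (auto simp: Suc_le_eq)
      moreover have "cycle_edges (a # c # zs) = insert {a, c} R"
        unfolding R_def by (rule cycle_edges_Cons2)
      ultimately obtain B' e e' where e: "B' \<in> p" "e \<in> insert {a, c} R" "e' \<in> insert {a, c} R"
        "e \<noteq> e'" "e \<in> B'" "e' \<in> B'" by auto
      \<comment> \<open>The shorter cycle may repeat a block through the chord
        \<open>{a, c}\<close>, which is not an edge of \<open>vs\<close>. That block is then
        \<open>B\<close>, and the edge \<open>f\<close> of \<open>vs\<close>, which also lies in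
        \<open>B\<close>, replaces the chord.\<close>
      have key: ?thesis if g: "g \<in> R" "g \<in> B'" "{a, c} \<in> B'" for g
      proof -
        have "B' = B" using partition_on_block_eq[OF p e(1) B(1)] g B by blast
        moreover have "f \<noteq> g" using f b_notin g by auto
        ultimately show ?thesis using g B f RC by (intro witness[of B f g]) auto
      qed
      show ?thesis
      proof (cases "e \<in> R \<and> e' \<in> R")
        case True
        then show ?thesis using e RC by (intro witness[of B' e e']) auto
      next
        case False
        then show ?thesis using e key by (metis insertE)
      qed
    qed
  qed
qed

text \<open>The number of blocks is extremal: by \<open>card_rainbow_free_le\<close>, a rainbow-free
  partition on a finite vertex set cannot have more.\<close>

definition gallai_on :: "'a set \<Rightarrow> 'a set set set set"
  where "gallai_on V = {p. partition_on (edges V) p \<and> card p = card V - 1 \<and> rainbow_free V p}"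

lemma two_of_three:
  assumes "e \<in> {P, Q, R}" "e' \<in> {P, Q, R}" "e \<noteq> e'" "e \<in> B" "e' \<in> B"
  shows "P \<in> B \<and> Q \<in> B \<or> P \<in> B \<and> R \<in> B \<or> Q \<in> B \<and> R \<in> B"
  using assms by blast

text \<open>A triangle is a cycle of length three, which gives one direction;
  \<open>rainbow_free_cycle\<close> gives the other.\<close>

lemma gallai_partitions_eq: "gallai_partitions n (n - 1) = gallai_on {1..n}"
proof -
  have *: "(\<forall>vs. is_cycle n vs \<longrightarrow>
          (\<exists>B\<in>p. \<exists>e\<in>cycle_edges vs. \<exists>e'\<in>cycle_edges vs. e \<noteq> e' \<and> e \<in> B \<and> e' \<in> B))
        \<longleftrightarrow> rainbow_free {1..n} p" (is "?L \<longleftrightarrow> ?R") if p: "partition_on (edges {1..n}) p" for p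
  proof
    assume ?R
    then show ?L using rainbow_free_cycle[OF p] by (auto simp: is_cycle_def)
  next
    assume L: ?L
    show ?R unfolding rainbow_free_def
    proof (intro ballI impI)
      fix x y z assume xyz: "x \<in> {1..n}" "y \<in> {1..n}" "z \<in> {1..n}" "x \<noteq> y \<and> x \<noteq> z \<and> y \<noteq> z"
      then have "is_cycle n [x, y, z]" by (auto simp: is_cycle_def)
      then obtain B e e' where B: "B \<in> p" "e \<in> cycle_edges [x, y, z]" "e' \<in> cycle_edges [x, y, z]"
        "e \<noteq> e'" "e \<in> B" "e' \<in> B" using L by blast
      have "cycle_edges [x, y, z] = {{x, y}, {y, z}, {z, x}}"
        by (simp add: cycle_edges_Cons3 path_edges_def)
      then have "{x, y} \<in> B \<and> {y, z} \<in> B \<or> {x, y} \<in> B \<and> {z, x} \<in> B \<or> {y, z} \<in> B \<and> {z, x} \<in> B"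
        using two_of_three[of e "{x, y}" "{y, z}" "{z, x}" e' B] B by simp
      moreover have "{y, x} = {x, y}" "{z, x} = {x, z}" "{z, y} = {y, z}" by auto
      ultimately show "mono_angle p x y z \<or> mono_angle p y x z \<or> mono_angle p z x y"
        unfolding mono_angle_def using B(1) by (elim disjE) force+
    qed
  qed
  show ?thesis
    unfolding gallai_partitions_def gallai_on_def complete_edges_eq
    by (rule Collect_cong, rule conj_cong[OF refl], rule conj_cong)
       (simp only: card_atLeastAtMost diff_Suc_1, rule *)
qed

lemma finite_gallai_on:
  assumes "finite V"
  shows "finite (gallai_on V)"
proof (rule finite_subset)
  show "gallai_on V \<subseteq> Pow (Pow (edges V))"
  proof (intro subsetI PowI)
    fix p B e assume "p \<in> gallai_on V" "B \<in> p" "e \<in> B"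
    then have "\<Union>p = edges V" by (simp add: gallai_on_def partition_on_def)
    then show "e \<in> edges V" using \<open>B \<in> p\<close> \<open>e \<in> B\<close> by blast
  qed
  show "finite (Pow (Pow (edges V)))" by (simp add: finite_edges assms)
qed

section \<open>The number of blocks of a rainbow-free partition\<close>

lemma rainbow_free_subset:
  assumes "rainbow_free V p" "U \<subseteq> V"
  shows "rainbow_free U ((\<inter>) (edges U) ` p - {{}})"
proof -
  have "mono_angle ((\<inter>) (edges U) ` p - {{}}) x y z"
    if xyz: "mono_angle p x y z" "x \<in> U" "y \<in> U" "z \<in> U" "x \<noteq> y" "x \<noteq> z" for x y z
  proof -
    obtain B where B: "B \<in> p" "{x, y} \<in> B" "{x, z} \<in> B" using xyz(1) by (auto simp: mono_angle_def)
    have "{x, y} \<in> edges U \<inter> B" "{x, z} \<in> edges U \<inter> B" using B xyz by (simp_all add: pair_in_edges_iff)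
    then show ?thesis using B(1) unfolding mono_angle_def by (intro bexI[of _ "edges U \<inter> B"]) auto
  qed
  note keep = this
  show ?thesis unfolding rainbow_free_def
  proof (intro ballI impI)
    fix x y z assume U: "x \<in> U" "y \<in> U" "z \<in> U" and ne: "x \<noteq> y \<and> x \<noteq> z \<and> y \<noteq> z"
    then have "mono_angle p x y z \<or> mono_angle p y x z \<or> mono_angle p z x y"
      using assms unfolding rainbow_free_def by (simp add: subset_iff)
    then show "mono_angle ((\<inter>) (edges U) ` p - {{}}) x y z \<or>
      mono_angle ((\<inter>) (edges U) ` p - {{}}) y x z \<or> mono_angle ((\<inter>) (edges U) ` p - {{}}) z x y"
      using keep U ne by metis
  qed
qed

text \<open>Blocks are disjoint, so two blocks with the same nonempty trace on
  \<open>edges U\<close> coincide. Only the blocks without an edge inside \<open>U\<close> are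
  lost.\<close>

lemma card_le_card_restriction:
  assumes p: "partition_on (edges V) p" and "finite V" "U \<subseteq> V"
  shows "card {B\<in>p. B \<inter> edges U \<noteq> {}} \<le> card ((\<inter>) (edges U) ` p - {{}})"
proof (rule card_inj_on_le)
  show "inj_on ((\<inter>) (edges U)) {B \<in> p. B \<inter> edges U \<noteq> {}}"
  proof (rule inj_onI)
    fix B C assume *: "B \<in> {B \<in> p. B \<inter> edges U \<noteq> {}}" "C \<in> {B \<in> p. B \<inter> edges U \<noteq> {}}"
      "edges U \<inter> B = edges U \<inter> C"
    then obtain x where "x \<in> B" "x \<in> C" by blast
    then show "B = C" using partition_on_block_eq[OF p] * by blast
  qed
  show "finite ((\<inter>) (edges U) ` p - {{}})"
    using partition_on_finite[OF p] assms(2) finite_edges by blast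
qed (auto simp: Int_commute)

text \<open>Removing a vertex \<open>v\<close> loses at most one block. If two distinct blocks lay
  in the star of \<open>v\<close>, with edges \<open>{v, x}\<close> and \<open>{v, y}\<close>, then
  \<open>{x, y}\<close> would be in neither and the triangle would be rainbow.\<close>

lemma card_rainbow_free_le:
  assumes "finite V" "partition_on (edges V) p" "rainbow_free V p"
  shows "card p \<le> card V - 1"
  using assms
proof (induction V arbitrary: p rule: finite_induct)
  case empty
  moreover have "edges ({} :: 'a set) = {}" by (auto simp: edges_iff)
  ultimately show ?case by (simp add: partition_on_empty)
next
  case (insert v V)
  let ?r = "(\<inter>) (edges V) ` p - {{}}"
  have fin: "finite p" using partition_on_finite insert.prems(1) insert.hyps finite_edges
    by (metis finite_insert)
  have r: "partition_on (edges V) ?r"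
    using partition_on_restrict[OF insert.prems(1), of "edges V"] edges_mono[of V "insert v V"]
    by (simp add: Int_absorb2 subset_insertI)
  have IH: "card ?r \<le> card V - 1"
    by (rule insert.IH[OF r rainbow_free_subset[OF insert.prems(2)]]) auto
  define S where "S = {B\<in>p. B \<inter> edges V = {}}"
  have star: "\<exists>x. B \<noteq> {} \<and> x \<in> V \<and> {v, x} \<in> B" if B: "B \<in> S" for B
  proof -
    have "B \<noteq> {}" "B \<subseteq> edges (insert v V)" using B insert.prems(1) unfolding S_def partition_on_def by auto
    then obtain e where e: "e \<in> B" "e \<in> edges (insert v V)" "e \<notin> edges V" using B by (auto simp: S_def)
    then obtain x y where xy: "x \<noteq> y" "x \<in> insert v V" "y \<in> insert v V" "e = {x, y}"
      by (auto simp: edges_iff)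
    then have "x = v \<or> y = v" using e(3) by (auto simp: pair_in_edges_iff)
    then show ?thesis using xy e \<open>B \<noteq> {}\<close> by (metis insertE insert_commute)
  qed
  have "B = C" if BC: "B \<in> S" "C \<in> S" for B C
  proof (rule ccontr)
    assume ne: "B \<noteq> C"
    obtain x where x: "x \<in> V" "{v, x} \<in> B" using star BC by blast
    obtain y where y: "y \<in> V" "{v, y} \<in> C" using star BC by blast
    have p': "B \<in> p" "C \<in> p" using BC by (auto simp: S_def)
    have xy: "x \<noteq> y" using partition_on_block_eq[OF insert.prems(1) p'] x y ne by blast
    have "v \<noteq> x" "v \<noteq> y" using x y insert.hyps by auto
    have mem: "v \<in> insert v V" "x \<in> insert v V" "y \<in> insert v V" using x y by simp_all
    obtain D where D: "D \<in> p" "{v, x} \<in> D \<and> {v, y} \<in> D \<or> {v, x} \<in> D \<and> {x, y} \<in> D \<or>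
       {v, y} \<in> D \<and> {x, y} \<in> D"
      by (rule rainbow_freeD[OF insert.prems(2) mem \<open>v \<noteq> x\<close> \<open>v \<noteq> y\<close> xy])
    have "{x, y} \<in> edges V" using x y xy by (simp add: pair_in_edges_iff)
    then have "{x, y} \<notin> B" "{x, y} \<notin> C" using BC by (auto simp: S_def)
    then show False
      using D partition_on_block_eq[OF insert.prems(1) _ D(1)] p' x y ne by blast
  qed
  moreover have "finite S" using fin by (simp add: S_def)
  ultimately have "card S \<le> 1" by (simp add: card_le_Suc0_iff_eq)
  have "p = {B\<in>p. B \<inter> edges V \<noteq> {}} \<union> S" by (auto simp: S_def)
  then have "card p \<le> card {B\<in>p. B \<inter> edges V \<noteq> {}} + card S"
    by (metis card_Un_le)
  also have "\<dots> \<le> card ?r + 1"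
    using card_le_card_restriction[OF insert.prems(1), of V] insert.hyps \<open>card S \<le> 1\<close>
    by (intro add_mono) auto
  finally have le: "card p \<le> card ?r + 1" .
  show ?case
  proof (cases "V = {}")
    case True
    then have "edges (insert v V) = {}" by (auto simp: edges_iff)
    then show ?thesis using insert.prems(1) by (simp add: partition_on_empty)
  next
    case False
    then have "card V \<ge> 1" using insert.hyps by (simp add: Suc_le_eq card_gt_0_iff)
    then show ?thesis using le IH insert.hyps by simp
  qed
qed

text \<open>Deleting a vertex lowers the maximal number of blocks, so some block lies in its star.
  There are more vertices than blocks, so some block lies in the stars of two vertices.\<close>

lemma gallai_on_singleton_block:
  assumes "finite V" "2 \<le> card V" "p \<in> gallai_on V"
  shows "\<exists>e\<in>edges V. {e} \<in> p"
proof -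
  have p: "partition_on (edges V) p" "card p = card V - 1" "rainbow_free V p"
    using assms(3) by (auto simp: gallai_on_def)
  have fin: "finite p" using partition_on_finite[OF p(1)] finite_edges assms(1) by blast
  have "\<exists>B\<in>p. B \<inter> edges (V - {v}) = {}" if v: "v \<in> V" for v
  proof (rule ccontr)
    let ?r = "(\<inter>) (edges (V - {v})) ` p - {{}}"
    assume "\<not> (\<exists>B\<in>p. B \<inter> edges (V - {v}) = {})"
    then have "{B\<in>p. B \<inter> edges (V - {v}) \<noteq> {}} = p" by auto
    then have "card p \<le> card ?r"
      using card_le_card_restriction[OF p(1) assms(1), of "V - {v}"] by simp
    also have "partition_on (edges (V - {v})) ?r"
      using partition_on_restrict[OF p(1), of "edges (V - {v})"] edges_mono[of "V - {v}" V]
      by (simp add: Int_absorb2)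
    then have "card ?r \<le> card (V - {v}) - 1"
      using assms(1) by (intro card_rainbow_free_le rainbow_free_subset[OF p(3)]) auto
    finally show False using v assms p(2) by (simp add: card_Diff_singleton)
  qed
  then obtain f where f: "\<And>v. v \<in> V \<Longrightarrow> f v \<in> p \<and> f v \<inter> edges (V - {v}) = {}" by metis
  have "\<not> inj_on f V"
  proof
    assume "inj_on f V"
    then have "card V \<le> card p" using f fin by (intro card_inj_on_le) auto
    then show False using p(2) assms(2) by simp
  qed
  then obtain v w where vw: "v \<in> V" "w \<in> V" "v \<noteq> w" "f v = f w" by (auto simp: inj_on_def)
  have sub: "f v \<subseteq> edges V" "f v \<noteq> {}" using f[OF vw(1)] p(1) unfolding partition_on_def by auto
  have "e = {v, w}" if e: "e \<in> f v" for e
  proof -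
    obtain x y where xy: "x \<noteq> y" "x \<in> V" "y \<in> V" "e = {x, y}"
      using subsetD[OF sub(1) e] unfolding edges_iff by blast
    have "e \<notin> edges (V - {v})" "e \<notin> edges (V - {w})" using f[OF vw(1)] f[OF vw(2)] vw(4) e by auto
    then show ?thesis using xy vw(3) by (auto simp: pair_in_edges_iff)
  qed
  then have "f v = {{v, w}}" using sub by auto
  then show ?thesis using f[OF vw(1)] vw by (metis pair_in_edges_iff)
qed

lemma card_eq_card_filter:
  assumes "finite S"
  shows "card {p\<in>S. P p} = card {p\<in>S. P p \<and> \<not> Q p} + card {p\<in>S. P p \<and> Q p}"
proof -
  have "{p\<in>S. P p} = {p\<in>S. P p \<and> \<not> Q p} \<union> {p\<in>S. P p \<and> Q p}" by blast
  then show ?thesis using assms by (simp add: card_Un_disjoint[symmetric] disjoint_iff)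
qed

section \<open>Contraction of an edge that is a block\<close>

definition contract :: "'a \<Rightarrow> 'a \<Rightarrow> 'a \<Rightarrow> 'a"
  where "contract a b = id(a := b)"

definition pullback_block :: "'a set \<Rightarrow> 'a \<Rightarrow> 'a \<Rightarrow> 'a set set \<Rightarrow> 'a set set"
  where "pullback_block V a b B = {f \<in> edges V. f \<noteq> {a, b} \<and> contract a b ` f \<in> B}"

definition expand_partition :: "'a set \<Rightarrow> 'a \<Rightarrow> 'a \<Rightarrow> 'a set set set \<Rightarrow> 'a set set set"
  where "expand_partition V a b q = insert {{a, b}} (pullback_block V a b ` q)"

text \<open>Contraction takes the form of a restriction: if \<open>{{a, b}}\<close> is a block, then
  \<open>{a, w}\<close> and \<open>{b, w}\<close> share a block for every other vertex
  \<open>w\<close>, so deleting \<open>a\<close> loses no information.\<close>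

definition contract_partition :: "'a set \<Rightarrow> 'a \<Rightarrow> 'a \<Rightarrow> 'a set set set \<Rightarrow> 'a set set set"
  where "contract_partition V a b p = (\<lambda>B. B \<inter> edges (V - {a})) ` (p - {{{a, b}}})"

locale contraction =
  fixes V :: "'a set" and a b :: 'a
  assumes fin: "finite V" and aV: "a \<in> V" and bV: "b \<in> V" and ab: "a \<noteq> b"
begin

lemma contract_simps: "contract a b a = b" "x \<noteq> a \<Longrightarrow> contract a b x = x"
  by (auto simp: contract_def)

lemma contract_in: "x \<in> V \<Longrightarrow> contract a b x \<in> V - {a}"
  using bV ab by (auto simp: contract_def)

lemma contract_edge:
  assumes "f \<in> edges V" "f \<noteq> {a, b}"
  shows "contract a b ` f \<in> edges (V - {a})"
proof -
  obtain x y where xy: "x \<noteq> y" "x \<in> V" "y \<in> V" "f = {x, y}" using assms by (auto simp: edges_iff)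
  then have "contract a b x \<noteq> contract a b y" using assms(2) by (auto simp: contract_def split: if_splits)
  then show ?thesis using contract_in[OF xy(2)] contract_in[OF xy(3)] xy(4)
    by (simp add: pair_in_edges_iff)
qed

lemma contract_edge_id:
  assumes "f \<in> edges (V - {a})"
  shows "contract a b ` f = f" "f \<noteq> {a, b}" "f \<in> edges V"
proof -
  have "a \<notin> f" using assms by (auto simp: edges_def)
  then show "contract a b ` f = f" "f \<noteq> {a, b}" by (force simp: contract_def)+
  show "f \<in> edges V" using assms edges_mono[of "V - {a}" V] by auto
qed

lemma pullback_block_Int:
  "B \<subseteq> edges (V - {a}) \<Longrightarrow> pullback_block V a b B \<inter> edges (V - {a}) = B"
  using contract_edge_id by (auto simp: pullback_block_def)

lemma pair_in_pullback_iff: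
  assumes "x \<in> V" "y \<in> V" "x \<noteq> y" "{x, y} \<noteq> {a, b}"
  shows "{x, y} \<in> pullback_block V a b B \<longleftrightarrow> {contract a b x, contract a b y} \<in> B"
  using assms by (simp add: pullback_block_def pair_in_edges_iff)

lemma ab_notin_pullback: "{a, b} \<notin> pullback_block V a b B"
  by (simp add: pullback_block_def)

lemma pullback_block_ne: "pullback_block V a b B \<noteq> {{a, b}}"
  using ab_notin_pullback by (metis singletonI)

lemma mono_angle_expand:
  assumes "mono_angle q (contract a b x) (contract a b y) (contract a b z)"
    "x \<in> V" "y \<in> V" "z \<in> V" "x \<noteq> y" "x \<noteq> z" "{x, y} \<noteq> {a, b}" "{x, z} \<noteq> {a, b}"
  shows "mono_angle (expand_partition V a b q) x y z"
proof -
  obtain B where B: "B \<in> q" "{contract a b x, contract a b y} \<in> B" "{contract a b x, contract a b z} \<in> B"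
    using assms(1) by (auto simp: mono_angle_def)
  then have "{x, y} \<in> pullback_block V a b B" "{x, z} \<in> pullback_block V a b B"
    using assms by (simp_all add: pair_in_pullback_iff)
  then show ?thesis using B(1) by (auto simp: mono_angle_def expand_partition_def)
qed

text \<open>Both \<open>{w, a}\<close> and \<open>{w, b}\<close> contract to \<open>{w, b}\<close>,
  so they lie in the pullback of the same block.\<close>

lemma mono_angle_expand_ab:
  assumes q: "partition_on (edges (V - {a})) q" and w: "w \<in> V" "w \<noteq> a" "w \<noteq> b"
  shows "mono_angle (expand_partition V a b q) w a b"
proof -
  have "{w, b} \<in> edges (V - {a})" using w bV ab by (simp add: pair_in_edges_iff)
  then obtain B where B: "B \<in> q" "{w, b} \<in> B" using q by (auto simp: partition_on_def)
  then have "mono_angle q (contract a b w) (contract a b a) (contract a b b)"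
    using w ab by (auto simp: mono_angle_def contract_simps)
  then show ?thesis
    by (rule mono_angle_expand) (use w aV bV in \<open>auto simp: doubleton_eq_iff\<close>)
qed

text \<open>A triangle with the edge \<open>{a, b}\<close> is settled by
  \<open>mono_angle_expand_ab\<close>; any other triangle contracts to a triangle of
  \<open>V - {a}\<close>, and the block repeated there pulls back. The new block
  \<open>{{a, b}}\<close> balances the additional vertex.\<close>

lemma expand_partition_in:
  assumes "q \<in> gallai_on (V - {a})"
  shows "expand_partition V a b q \<in> gallai_on V"
proof -
  let ?E = "pullback_block V a b"
  have q: "partition_on (edges (V - {a})) q" "card q = card (V - {a}) - 1" "rainbow_free (V - {a}) q"
    using assms by (auto simp: gallai_on_def)
  have Uq: "\<Union>q = edges (V - {a})" using q(1) by (simp add: partition_on_def)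
  then have sub: "B \<subseteq> edges (V - {a})" if "B \<in> q" for B using that by blast
  have fq: "finite q" using partition_on_finite[OF q(1)] finite_edges fin by blast
  have abE: "{a, b} \<in> edges V" using aV bV ab by (simp add: pair_in_edges_iff)
  have inj: "inj_on ?E q"
    by (rule inj_on_inverseI[of _ "\<lambda>B. B \<inter> edges (V - {a})"]) (simp add: pullback_block_Int sub)
  have "partition_on (edges V) (expand_partition V a b q)"
  proof (rule partition_onI)
    show "\<Union>(expand_partition V a b q) = edges V"
    proof (intro equalityI subsetI)
      fix f assume "f \<in> \<Union>(expand_partition V a b q)"
      then show "f \<in> edges V" using abE by (auto simp: expand_partition_def pullback_block_def)
    next
      fix f assume f: "f \<in> edges V"
      show "f \<in> \<Union>(expand_partition V a b q)"
      proof (cases "f = {a, b}")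
        case True then show ?thesis by (simp add: expand_partition_def)
      next
        case False
        then obtain B where "B \<in> q" "contract a b ` f \<in> B" using contract_edge[OF f] Uq by blast
        then show ?thesis using f False by (auto simp: expand_partition_def pullback_block_def)
      qed
    qed
    have d: "disjnt (?E B) (?E C)" if BC: "B \<in> q" "C \<in> q" "B \<noteq> C" for B C
      using partition_on_block_eq[OF q(1)] BC unfolding disjnt_iff pullback_block_def by blast
    have d': "disjnt {{a, b}} (?E B)" for B by (simp add: disjnt_def ab_notin_pullback)
    show "disjnt P Q" if PQ: "P \<in> expand_partition V a b q" "Q \<in> expand_partition V a b q" "P \<noteq> Q" for P Q
    proof -
      consider "P = {{a, b}}" "Q = {{a, b}}" | B where "P = {{a, b}}" "Q = ?E B" | B where "Q = {{a, b}}" "P = ?E B"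
        | B C where "P = ?E B" "Q = ?E C" "B \<in> q" "C \<in> q"
        using PQ(1,2) unfolding expand_partition_def by blast
      then show ?thesis
      proof cases
        case 1 then show ?thesis using PQ by simp
      next
        case 2 then show ?thesis using d' by simp
      next
        case 3 then show ?thesis using d' disjnt_sym by blast
      next
        case 4
        then have "B \<noteq> C" using PQ(3) by blast
        then show ?thesis using d 4 by simp
      qed
    qed
    have "?E B \<noteq> {}" if "B \<in> q" for B
    proof -
      have "B \<noteq> {}" using q(1) that by (auto simp: partition_on_def)
      then show ?thesis using pullback_block_Int[OF sub[OF that]] by auto
    qed
    then show "{} \<notin> expand_partition V a b q" by (auto simp: expand_partition_def)
  qed
  moreover have "card (expand_partition V a b q) = card V - 1"
  proof -
    have "{{a, b}} \<notin> ?E ` q" using pullback_block_ne by (metis imageE)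
    then have "card (expand_partition V a b q) = Suc (card q)"
      using fq by (simp add: expand_partition_def card_image[OF inj])
    moreover have "2 \<le> card V" using card_mono[OF fin, of "{a, b}"] aV bV ab by simp
    ultimately show ?thesis using q(2) fin aV by (simp add: card_Diff_singleton)
  qed
  moreover have "rainbow_free V (expand_partition V a b q)"
    unfolding rainbow_free_def
  proof (intro ballI impI)
    let ?p = "expand_partition V a b q"
    fix x y z assume V: "x \<in> V" "y \<in> V" "z \<in> V" and ne: "x \<noteq> y \<and> x \<noteq> z \<and> y \<noteq> z"
    have sp: "mono_angle ?p w u v" if "w \<in> V" "w \<noteq> u" "w \<noteq> v" "{u, v} = {a, b}" for u v w
      using mono_angle_expand_ab[OF q(1), of w] mono_angle_commute[of ?p w] that
      by (metis doubleton_eq_iff)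
    show "mono_angle ?p x y z \<or> mono_angle ?p y x z \<or> mono_angle ?p z x y"
    proof (cases "{x, y} = {a, b} \<or> {x, z} = {a, b} \<or> {y, z} = {a, b}")
      case True
      then show ?thesis using sp[of x y z] sp[of y x z] sp[of z x y] V ne by metis
    next
      case False
      moreover have "{y, x} = {x, y}" "{z, x} = {x, z}" "{z, y} = {y, z}" by auto
      ultimately have F: "{x, y} \<noteq> {a, b}" "{x, z} \<noteq> {a, b}" "{y, z} \<noteq> {a, b}" "{y, x} \<noteq> {a, b}"
        "{z, x} \<noteq> {a, b}" "{z, y} \<noteq> {a, b}" by simp_all
      let ?c = "contract a b"
      have "?c u \<noteq> ?c v" if "u \<noteq> v" "{u, v} \<noteq> {a, b}" for u v
        using that by (auto simp: contract_def)
      then have "?c x \<noteq> ?c y" "?c x \<noteq> ?c z" "?c y \<noteq> ?c z"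
        using F(1-3) ne by simp_all
      then have "mono_angle q (?c x) (?c y) (?c z) \<or> mono_angle q (?c y) (?c x) (?c z) \<or>
          mono_angle q (?c z) (?c x) (?c y)"
        using q(3) contract_in V unfolding rainbow_free_def by simp
      then show ?thesis
        using mono_angle_expand[of q] V ne F by metis
    qed
  qed
  ultimately show ?thesis by (simp add: gallai_on_def)
qed

text \<open>In a triangle \<open>a\<close>, \<open>b\<close>, \<open>w\<close> whose edge \<open>{a, b}\<close> is a block, the other two edges
  share a block.\<close>

lemma block_contract:
  assumes p: "p \<in> gallai_on V" "{{a, b}} \<in> p" and f: "f \<in> edges V" "f \<noteq> {a, b}" and B: "B \<in> p"
  shows "contract a b ` f \<in> B \<longleftrightarrow> f \<in> B"
proof (cases "a \<in> f")
  case False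
  then have "f \<in> edges (V - {a})" using f by (auto simp: edges_def)
  then show ?thesis by (simp add: contract_edge_id)
next
  case True
  have pt: "partition_on (edges V) p" and rf: "rainbow_free V p" using p by (auto simp: gallai_on_def)
  obtain x y where "x \<noteq> y" "x \<in> V" "y \<in> V" "f = {x, y}" using f by (auto simp: edges_iff)
  then obtain w where w: "w \<in> V" "w \<noteq> a" "f = {a, w}" using True by (metis insertE insert_commute singletonD)
  have wb: "w \<noteq> b" using f(2) w(3) by auto
  have cf: "contract a b ` f = {b, w}" using w by (auto simp: contract_def)
  obtain C where C: "C \<in> p" "{a, b} \<in> C \<and> {a, w} \<in> C \<or> {a, b} \<in> C \<and> {b, w} \<in> C \<or> {a, w} \<in> C \<and> {b, w} \<in> C"
    using rainbow_freeD[OF rf aV bV w(1) ab, OF w(2)[symmetric] wb[symmetric]] .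
  have "{a, w} \<notin> {{a, b}}" "{b, w} \<notin> {{a, b}}" using w wb ab by (auto simp: doubleton_eq_iff)
  moreover have "C = {{a, b}}" if "{a, b} \<in> C"
    using partition_on_block_eq[OF pt C(1) p(2) that] by simp
  ultimately have C2: "{a, w} \<in> C" "{b, w} \<in> C" using C(2) by auto
  have "{b, w} \<in> B \<longleftrightarrow> {a, w} \<in> B"
    using partition_on_block_eq[OF pt B C(1)] C2 by blast
  then show ?thesis by (simp only: cf) (simp only: w(3))
qed

lemma pullback_block_contract:
  assumes p: "p \<in> gallai_on V" "{{a, b}} \<in> p" and B: "B \<in> p" "B \<noteq> {{a, b}}"
  shows "pullback_block V a b (B \<inter> edges (V - {a})) = B"
proof -
  have pt: "partition_on (edges V) p" using p by (auto simp: gallai_on_def)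
  have sub: "B \<subseteq> edges V" using pt B by (auto simp: partition_on_def)
  have "{a, b} \<notin> B" using partition_on_block_eq[OF pt B(1) p(2), of "{a, b}"] B(2) by auto
  then have "f \<in> pullback_block V a b (B \<inter> edges (V - {a})) \<longleftrightarrow> f \<in> B" for f
    using block_contract[OF p _ _ B(1), of f] contract_edge[of f] sub
    unfolding pullback_block_def by auto
  then show ?thesis by blast
qed

lemma expand_contract_partition:
  assumes "p \<in> gallai_on V" "{{a, b}} \<in> p"
  shows "expand_partition V a b (contract_partition V a b p) = p"
proof -
  have "(\<lambda>B. pullback_block V a b (B \<inter> edges (V - {a}))) ` (p - {{{a, b}}}) = p - {{{a, b}}}"
    using pullback_block_contract[OF assms] by auto
  then show ?thesis using assms(2)
    unfolding expand_partition_def contract_partition_def image_image by auto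
qed

lemma contract_expand_partition:
  assumes "partition_on (edges (V - {a})) q"
  shows "contract_partition V a b (expand_partition V a b q) = q"
proof -
  have sub: "B \<subseteq> edges (V - {a})" if "B \<in> q" for B using that assms by (auto simp: partition_on_def)
  have "expand_partition V a b q - {{{a, b}}} = pullback_block V a b ` q"
    using pullback_block_ne unfolding expand_partition_def by blast
  then have "contract_partition V a b (expand_partition V a b q) =
      (\<lambda>B. pullback_block V a b B \<inter> edges (V - {a})) ` q"
    by (simp add: contract_partition_def image_image)
  also have "\<dots> = (\<lambda>B. B) ` q" by (rule image_cong) (simp_all add: pullback_block_Int sub)
  finally show ?thesis by simp
qed

lemma contract_partition_in:
  assumes p: "p \<in> gallai_on V" "{{a, b}} \<in> p"
  shows "contract_partition V a b p \<in> gallai_on (V - {a})"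
proof -
  let ?U = "V - {a}" let ?q = "contract_partition V a b p"
  have pt: "partition_on (edges V) p" and cp: "card p = card V - 1" and rf: "rainbow_free V p"
    using p by (auto simp: gallai_on_def)
  have fp: "finite p" using partition_on_finite[OF pt] finite_edges fin by blast
  note pb = pullback_block_contract[OF p]
  have inj: "inj_on (\<lambda>B. B \<inter> edges ?U) (p - {{{a, b}}})"
    by (rule inj_on_inverseI[of _ "pullback_block V a b"]) (simp add: pb)
  have covers: "\<exists>B\<in>p - {{{a, b}}}. f \<in> B" if f: "f \<in> edges ?U" for f
  proof -
    have "f \<in> edges V" "f \<noteq> {a, b}" using contract_edge_id f by blast+
    then show ?thesis using pt unfolding partition_on_def by blast
  qed
  have "partition_on (edges ?U) ?q"
  proof (rule partition_onI)
    show "\<Union>?q = edges ?U" using covers unfolding contract_partition_def by blast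
    show "disjnt P Q" if "P \<in> ?q" "Q \<in> ?q" "P \<noteq> Q" for P Q
      using that partition_on_block_eq[OF pt] unfolding contract_partition_def disjnt_iff by blast
    have "B \<inter> edges ?U \<noteq> {}" if B: "B \<in> p - {{{a, b}}}" for B
    proof
      assume "B \<inter> edges ?U = {}"
      then have "B = {}" using pb[of B] B by (auto simp: pullback_block_def)
      then show False using pt B by (auto simp: partition_on_def)
    qed
    then show "{} \<notin> ?q" unfolding contract_partition_def by blast
  qed
  moreover have "card ?q = card ?U - 1"
    using card_image[OF inj] fp p(2) cp fin aV by (simp add: contract_partition_def card_Diff_singleton)
  moreover have "rainbow_free ?U ?q"
    unfolding rainbow_free_def
  proof (intro ballI impI)
    fix x y z assume U: "x \<in> ?U" "y \<in> ?U" "z \<in> ?U" and ne: "x \<noteq> y \<and> x \<noteq> z \<and> y \<noteq> z"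
    have keep: "mono_angle ?q u v w" if m: "mono_angle p u v w" "u \<in> ?U" "v \<in> ?U" "w \<in> ?U" "u \<noteq> v" "u \<noteq> w" for u v w
    proof -
      obtain B where B: "B \<in> p" "{u, v} \<in> B" "{u, w} \<in> B" using m(1) by (auto simp: mono_angle_def)
      have "{u, v} \<in> edges ?U" "{u, w} \<in> edges ?U" using m by (simp_all add: pair_in_edges_iff)
      moreover from this(1) have "B \<noteq> {{a, b}}" using B(2) contract_edge_id(2)[of "{u, v}"] by auto
      ultimately have "B \<inter> edges ?U \<in> ?q" "{u, v} \<in> B \<inter> edges ?U" "{u, w} \<in> B \<inter> edges ?U"
        using B by (simp_all add: contract_partition_def)
      then show ?thesis unfolding mono_angle_def by (intro bexI[of _ "B \<inter> edges ?U"] conjI)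
    qed
    have "mono_angle p x y z \<or> mono_angle p y x z \<or> mono_angle p z x y"
      using rf U ne unfolding rainbow_free_def by simp
    then show "mono_angle ?q x y z \<or> mono_angle ?q y x z \<or> mono_angle ?q z x y"
      using keep U ne by metis
  qed
  ultimately show ?thesis by (simp add: gallai_on_def)
qed

text \<open>An edge \<open>f\<close> that meets \<open>{a, b}\<close> has a twin:
  \<open>{a, w}\<close> and \<open>{b, w}\<close> contract to the same edge, so \<open>f\<close> is
  never alone in its block. An edge disjoint from \<open>{a, b}\<close> is its own only
  preimage.\<close>

lemma singleton_in_expand_iff:
  assumes q: "q \<in> gallai_on (V - {a})" and f: "f \<in> edges V" "f \<noteq> {a, b}"
  shows "{f} \<in> expand_partition V a b q \<longleftrightarrow> f \<inter> {a, b} = {} \<and> {f} \<in> q"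
proof -
  have sub: "B \<subseteq> edges (V - {a})" if "B \<in> q" for B
    using that q by (auto simp: gallai_on_def partition_on_def)
  have iff: "{f} \<in> expand_partition V a b q \<longleftrightarrow> (\<exists>B\<in>q. {f} = pullback_block V a b B)"
    using f by (auto simp: expand_partition_def)
  show ?thesis
  proof (cases "f \<inter> {a, b} = {}")
    case True
    then have fU: "f \<in> edges (V - {a})" using f by (auto simp: edges_def)
    have "g = f" if g: "g \<in> edges V" "contract a b ` g = f" for g
    proof -
      have "a \<notin> g" using g True by (force simp: contract_def)
      then have "g \<in> edges (V - {a})" using g by (auto simp: edges_def)
      then show ?thesis using contract_edge_id(1) g by simp
    qed
    then have "pullback_block V a b {f} = {f}"
      using contract_edge_id[OF fU] unfolding pullback_block_def by auto
    moreover have "B = {f}" if "B \<in> q" "{f} = pullback_block V a b B" for B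
      using pullback_block_Int[OF sub[OF that(1)]] that(2)[symmetric] fU by simp
    ultimately show ?thesis using iff True by metis
  next
    case False
    have "\<not> {f} = pullback_block V a b B" for B
    proof
      assume eq: "{f} = pullback_block V a b B"
      obtain x y where xy: "x \<noteq> y" "x \<in> V" "y \<in> V" "f = {x, y}" using f by (auto simp: edges_iff)
      have "f = {y, x}" using xy(4) by auto
      moreover have "x \<in> {a, b} \<or> y \<in> {a, b}" using False xy(4) by auto
      ultimately have "\<exists>u w. u \<in> {a, b} \<and> w \<in> V \<and> u \<noteq> w \<and> f = {u, w}" using xy by metis
      then obtain u w where u: "u \<in> {a, b}" "w \<in> V" "u \<noteq> w" "f = {u, w}" by blast
      have w: "w \<noteq> a" "w \<noteq> b" using f(2) u by auto
      have "contract a b ` f = {b, w}" using u w by (auto simp: contract_def)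
      moreover have "f \<in> pullback_block V a b B" using eq by blast
      ultimately have "{b, w} \<in> B" by (simp add: pullback_block_def)
      then have "{a, w} \<in> pullback_block V a b B" "{b, w} \<in> pullback_block V a b B"
        using u w ab aV bV by (simp_all add: pair_in_pullback_iff contract_simps doubleton_eq_iff)
      then have "{a, w} = {b, w}" using eq by (metis singletonD)
      then show False using ab w by (simp add: doubleton_eq_iff)
    qed
    then have "{f} \<notin> expand_partition V a b q" using iff by simp
    then show ?thesis using False by (simp only: simp_thms)
  qed
qed

end

definition gallai_count :: "'a set \<Rightarrow> 'a set set \<Rightarrow> nat"
  where "gallai_count V F = card {p \<in> gallai_on V. \<forall>e\<in>F. {e} \<notin> p}"

text \<open>Split by whether \<open>{e}\<close> is a block. If it is, contract \<open>e\<close>; by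
  \<open>singleton_in_expand_iff\<close>, the forbidden edges that meet \<open>e\<close> then impose
  no condition.\<close>

lemma gallai_count_insert:
  assumes "finite V" "insert e F \<subseteq> edges V" "e \<notin> F" "a \<in> e"
  shows "gallai_count V F = gallai_count V (insert e F) + gallai_count (V - {a}) {f\<in>F. f \<inter> e = {}}"
proof -
  obtain b where b: "e = {a, b}" "b \<noteq> a" "a \<in> V" "b \<in> V"
    using assms(2,4) by (auto simp: edges_iff)
  interpret contraction V a b using assms(1) b by unfold_locales auto
  let ?A = "{q \<in> gallai_on (V - {a}). \<forall>f\<in>{f\<in>F. f \<inter> e = {}}. {f} \<notin> q}"
  let ?B = "{p \<in> gallai_on V. (\<forall>f\<in>F. {f} \<notin> p) \<and> {e} \<in> p}"
  have F: "f \<in> edges V" "f \<noteq> {a, b}" if "f \<in> F" for f using that assms b by auto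
  have "bij_betw (expand_partition V a b) ?A ?B"
  proof (rule bij_betw_byWitness[where f' = "contract_partition V a b"])
    show "\<forall>q\<in>?A. contract_partition V a b (expand_partition V a b q) = q"
      using contract_expand_partition by (auto simp: gallai_on_def)
    show "\<forall>p\<in>?B. expand_partition V a b (contract_partition V a b p) = p"
      using expand_contract_partition b by blast
    show "expand_partition V a b ` ?A \<subseteq> ?B"
    proof
      fix p assume "p \<in> expand_partition V a b ` ?A"
      then obtain q where q: "p = expand_partition V a b q" "q \<in> gallai_on (V - {a})"
        "\<forall>f\<in>{f\<in>F. f \<inter> e = {}}. {f} \<notin> q" by blast
      have "{f} \<notin> p" if "f \<in> F" for f
        using singleton_in_expand_iff[OF q(2) F[OF that]] q(1,3) that b(1) by blast
      moreover have "{e} \<in> p" using q(1) b by (simp add: expand_partition_def)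
      ultimately show "p \<in> ?B" using expand_partition_in[OF q(2)] q(1) by simp
    qed
    show "contract_partition V a b ` ?B \<subseteq> ?A"
    proof
      fix q assume "q \<in> contract_partition V a b ` ?B"
      then obtain p where p: "q = contract_partition V a b p" "p \<in> gallai_on V" "{{a, b}} \<in> p"
        "\<forall>f\<in>F. {f} \<notin> p" using b by blast
      have q: "q \<in> gallai_on (V - {a})" using contract_partition_in p by blast
      have eq: "expand_partition V a b q = p" using expand_contract_partition p by blast
      have "{f} \<notin> q" if "f \<in> F" "f \<inter> e = {}" for f
        using singleton_in_expand_iff[OF q F[OF that(1)]] eq p(4) that b by simp
      then show "q \<in> ?A" using q by simp
    qed
  qed
  then have "card ?A = card ?B" by (rule bij_betw_same_card)
  moreover have "{p \<in> gallai_on V. (\<forall>f\<in>F. {f} \<notin> p) \<and> {e} \<notin> p} = {p \<in> gallai_on V. \<forall>f\<in>insert e F. {f} \<notin> p}"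
    by auto
  ultimately show ?thesis
    using card_eq_card_filter[OF finite_gallai_on[OF assms(1)], of "\<lambda>p. \<forall>f\<in>F. {f} \<notin> p" "\<lambda>p. {e} \<in> p"]
    by (simp only: gallai_count_def)
qed

section \<open>Perfect matchings with forbidden pairs\<close>

definition matchings :: "'a set \<Rightarrow> 'a set set set"
  where "matchings X = {M. partition_on X M \<and> (\<forall>e\<in>M. card e = 2)}"

definition matching_count :: "'a set \<Rightarrow> 'a set set \<Rightarrow> nat"
  where "matching_count X F = card {M \<in> matchings X. M \<inter> F = {}}"

lemma finite_matchings: "finite X \<Longrightarrow> finite (matchings X)"
proof (rule finite_subset)
  show "matchings X \<subseteq> Pow (Pow X)"
    by (auto simp: matchings_def partition_on_def)
qed simp

lemma matchings_empty: "matchings {} = {{}}"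
  by (auto simp: matchings_def partition_on_empty)

text \<open>A matching that contains \<open>e\<close> is \<open>e\<close> together with a matching
  of the other points, and no forbidden pair that meets \<open>e\<close> can occur in it. This is
  the rule of \<open>gallai_count_insert\<close>, with two points removed instead of one
  vertex.\<close>

lemma matching_count_insert:
  assumes "finite X" "insert e F \<subseteq> edges X" "e \<notin> F"
  shows "matching_count X F = matching_count X (insert e F) + matching_count (X - e) {f\<in>F. f \<inter> e = {}}"
proof -
  let ?A = "{M \<in> matchings (X - e). M \<inter> {f\<in>F. f \<inter> e = {}} = {}}"
  let ?B = "{M \<in> matchings X. M \<inter> F = {} \<and> e \<in> M}"
  have e: "e \<subseteq> X" "card e = 2" "e \<noteq> {}" using assms(2) by (auto simp: edges_def)
  have sub: "f \<inter> e = {}" "f \<noteq> {}" if "M \<in> matchings (X - e)" "f \<in> M" for M f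
    using that by (auto simp: matchings_def partition_on_def)
  have "bij_betw (insert e) ?A ?B"
  proof (rule bij_betw_byWitness[where f' = "\<lambda>M. M - {e}"])
    show "\<forall>M\<in>?A. insert e M - {e} = M" using sub e by blast
    show "\<forall>M\<in>?B. insert e (M - {e}) = M" by blast
    show "insert e ` ?A \<subseteq> ?B"
    proof (intro subsetI, elim imageE, simp only: mem_Collect_eq, intro conjI)
      fix M N assume N: "N = insert e M" and M: "M \<in> matchings (X - e) \<and> M \<inter> {f\<in>F. f \<inter> e = {}} = {}"
      have "disjnt e (\<Union>M)" using sub M by (auto simp: disjnt_def)
      then have "partition_on X N" unfolding N using e M
        by (subst partition_on_insert) (simp_all add: matchings_def)
      then show "insert e M \<in> matchings X" using M N e by (auto simp: matchings_def)
      show "insert e M \<inter> F = {}" using M sub assms(3) by blast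
      show "e \<in> insert e M" by simp
    qed
    show "(\<lambda>M. M - {e}) ` ?B \<subseteq> ?A"
    proof (intro subsetI, elim imageE, simp only: mem_Collect_eq, intro conjI)
      fix M N assume M: "M \<in> matchings X \<and> M \<inter> F = {} \<and> e \<in> M" and N: "N = M - {e}"
      have pM: "partition_on X M" using M by (simp add: matchings_def)
      have "disjnt e (\<Union>(M - {e}))" using M partition_on_block_eq[OF pM, of e]
        unfolding disjnt_iff by blast
      then have "partition_on (X - e) (M - {e})"
        using partition_on_insert[of e "M - {e}" X] pM M by (simp add: insert_absorb)
      then show "M - {e} \<in> matchings (X - e)" using M by (auto simp: matchings_def)
      show "(M - {e}) \<inter> {f\<in>F. f \<inter> e = {}} = {}" using M by blast
    qed
  qed
  then have "card ?A = card ?B" by (rule bij_betw_same_card)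
  moreover have "{M \<in> matchings X. M \<inter> F = {} \<and> e \<notin> M} = {M \<in> matchings X. M \<inter> insert e F = {}}"
    by auto
  ultimately show ?thesis
    using card_eq_card_filter[OF finite_matchings[OF assms(1)], of "\<lambda>M. M \<inter> F = {}" "\<lambda>M. e \<in> M"]
    by (simp only: matching_count_def)
qed

lemma matching_image:
  assumes "inj_on f X" "M \<in> matchings X"
  shows "(`) f ` M \<in> matchings (f ` X)"
proof -
  have M: "partition_on X M" "\<forall>e\<in>M. card e = 2" using assms by (auto simp: matchings_def)
  have "{} \<notin> (`) f ` M" using M(1) by (auto simp: partition_on_def)
  then have "partition_on (f ` X) ((`) f ` M)"
    using partition_on_inj_image[OF M(1) assms(1)] by simp
  moreover have "card (f ` e) = 2" if "e \<in> M" for e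
  proof -
    have "e \<subseteq> X" using that M(1) by (auto simp: partition_on_def)
    then show ?thesis using card_image[OF inj_on_subset[OF assms(1)]] M(2) that by auto
  qed
  ultimately show ?thesis by (auto simp: matchings_def)
qed

lemma matching_count_image:
  assumes f: "inj_on f X" and F: "F \<subseteq> Pow X"
  shows "matching_count (f ` X) ((`) f ` F) = matching_count X F"
proof -
  let ?g = "the_inv_into X f"
  have g: "inj_on ?g (f ` X)" "?g ` f ` X = X"
    using inj_on_the_inv_into[OF f] f by (auto simp: the_inv_into_f_f image_image)
  have gf: "?g ` f ` e = e" if "e \<subseteq> X" for e
    using that f by (force simp: image_image the_inv_into_f_f)
  have fg: "f ` ?g ` e = e" if "e \<subseteq> f ` X" for e
    using that f by (force simp: image_image f_the_inv_into_f subset_iff)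
  have sub: "e \<subseteq> X" if "e \<in> M" "M \<in> matchings X" for e M and X :: "'c set"
    using that by (auto simp: matchings_def partition_on_def)
  let ?A = "{M \<in> matchings X. M \<inter> F = {}}" and ?B = "{M \<in> matchings (f ` X). M \<inter> (`) f ` F = {}}"
  have gfM: "(`) ?g ` (`) f ` M = M" if "\<And>e. e \<in> M \<Longrightarrow> e \<subseteq> X" for M
    using that gf by (force simp: image_image)
  have fgM: "(`) f ` (`) ?g ` M = M" if "\<And>e. e \<in> M \<Longrightarrow> e \<subseteq> f ` X" for M
    using that fg by (force simp: image_image)
  have "bij_betw ((`) ((`) f)) ?A ?B"
  proof (rule bij_betw_byWitness[where f' = "(`) ((`) ?g)"])
    show "\<forall>M\<in>?A. (`) ?g ` (`) f ` M = M" by (intro ballI gfM sub) auto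
    show "\<forall>M\<in>?B. (`) f ` (`) ?g ` M = M" by (intro ballI fgM sub) auto
    show "(`) ((`) f) ` ?A \<subseteq> ?B"
    proof
      fix N assume "N \<in> (`) ((`) f) ` ?A"
      then obtain M where M: "N = (`) f ` M" "M \<in> matchings X" "M \<inter> F = {}" by blast
      have "inj_on ((`) f) (Pow X)" using f by (simp add: inj_on_image_Pow)
      moreover have "M \<subseteq> Pow X" using sub M(2) by blast
      ultimately have "N \<inter> (`) f ` F = (`) f ` (M \<inter> F)"
        using F by (simp add: M(1) inj_on_image_Int)
      then show "N \<in> ?B" using matching_image[OF f M(2)] M by simp
    qed
    show "(`) ((`) ?g) ` ?B \<subseteq> ?A"
    proof
      fix N assume "N \<in> (`) ((`) ?g) ` ?B"
      then obtain M where M: "N = (`) ?g ` M" "M \<in> matchings (f ` X)" "M \<inter> (`) f ` F = {}" by blast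
      have N: "N \<in> matchings X" using matching_image[OF g(1) M(2)] M(1) g(2) by simp
      have "(`) f ` N = M" unfolding M(1) by (rule fgM) (use sub M(2) in blast)
      then have "N \<inter> F = {}" using M(3) by blast
      then show "N \<in> ?A" using N by simp
    qed
  qed
  then have "card ?A = card ?B" by (rule bij_betw_same_card)
  then show ?thesis by (simp only: matching_count_def)
qed

lemma matching_count_empty_eq:
  assumes "finite X" "finite Y" "card X = card Y"
  shows "matching_count X {} = matching_count Y {}"
proof -
  obtain f where "bij_betw f X Y" using assms finite_same_card_bij by blast
  then show ?thesis using matching_count_image[of f X "{}"] by (simp add: bij_betw_def)
qed

text \<open>Without pairs inside \<open>V\<close>, every point of \<open>V\<close> is matched with a
  point of \<open>Y\<close>, and different points have different partners.\<close>

lemma matching_count_crossing: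
  assumes "finite V" "finite Y" "card Y < card V"
  shows "matching_count (V \<union> Y) (edges V) = 0"
proof -
  have False if M: "M \<in> matchings (V \<union> Y)" "M \<inter> edges V = {}" for M
  proof -
    have part: "partition_on (V \<union> Y) M" using M by (simp add: matchings_def)
    have "\<exists>e y. e \<in> M \<and> v \<in> e \<and> y \<in> e \<and> y \<in> Y" if "v \<in> V" for v
    proof -
      have "v \<in> \<Union>M" using part that by (simp add: partition_on_def)
      then obtain e where e: "e \<in> M" "v \<in> e" by blast
      have "e \<subseteq> \<Union>M" using e(1) by blast
      then have "e \<subseteq> V \<union> Y" using part by (simp add: partition_on_def)
      moreover have "card e = 2" using M(1) e(1) by (simp add: matchings_def)
      moreover have "e \<notin> edges V" using M(2) e(1) by blast
      ultimately obtain y where "y \<in> e" "y \<in> Y" unfolding edges_def by auto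
      then show ?thesis using e by blast
    qed
    then obtain E y where Ey: "\<And>v. v \<in> V \<Longrightarrow> E v \<in> M \<and> v \<in> E v \<and> y v \<in> E v \<and> y v \<in> Y" by metis
    have "inj_on y V"
    proof (rule inj_onI, rule ccontr)
      fix v w assume vw: "v \<in> V" "w \<in> V" "y v = y w" "v \<noteq> w"
      have Ev: "E v = E w"
        using partition_on_block_eq[OF part, of "E v" "E w" "y v"] Ey[of v] Ey[of w] vw by simp
      have "card (E v) = 2" using M Ey vw by (auto simp: matchings_def)
      moreover have "{v, w} \<subseteq> E v" using Ey[of v] Ey[of w] vw Ev by simp
      ultimately have "E v = {v, w}" using vw(4)
        by (metis card_2_iff card_subset_eq card.infinite zero_neq_numeral)
      then have "E v \<in> edges V" using vw by (simp add: pair_in_edges_iff)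
      then show False using Ey vw M(2) by blast
    qed
    then have "card V \<le> card Y" using Ey assms(2) by (intro card_inj_on_le) auto
    then show False using assms(3) by simp
  qed
  then have "{M \<in> matchings (V \<union> Y). M \<inter> edges V = {}} = {}" by blast
  then show ?thesis unfolding matching_count_def by (metis card.empty)
qed

text \<open>Both sides obey the same deletion-contraction rule, so their difference does not change
  when edges are forbidden. When all edges inside a vertex set \<open>V \<subseteq> X\<close> are forbidden, both
  sides vanish.\<close>

lemma gallai_count_eq_matching_count:
  fixes V X :: "nat set"
  assumes "finite V" "finite X" "card X + 2 = 2 * card V" "F \<subseteq> edges (V \<inter> X)"
  shows "gallai_count V F = matching_count X F"
  using assms
proof (induction "card V" arbitrary: V X F rule: less_induct)
  case less
  \<comment> \<open>The point set \<open>X'\<close> is kept free because the step is applied both to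
    \<open>X\<close> and to a set that contains all of \<open>V\<close>.\<close>
  have step: "int (gallai_count V G) - int (matching_count X' G) =
        int (gallai_count V {}) - int (matching_count X' {})"
    if X': "finite X'" "card X' + 2 = 2 * card V" and G: "finite G" "G \<subseteq> edges (V \<inter> X')" for X' G
    using G
  proof (induction G rule: finite_induct)
    case (insert e G)
    obtain a b where e: "e = {a, b}" "a \<noteq> b" "a \<in> V \<inter> X'" "b \<in> V \<inter> X'"
      using insert.prems by (auto simp: edges_iff)
    have sub: "edges (V \<inter> X') \<subseteq> edges V" "edges (V \<inter> X') \<subseteq> edges X'"
      by (simp_all add: edges_mono)
    have c2: "card (X' - e) = card X' - 2" using e X'(1) by (simp add: card_Diff_subset)
    have "2 \<le> card X'" using card_mono[OF X'(1), of e] e by simp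
    have "gallai_count (V - {a}) {f\<in>G. f \<inter> e = {}} = matching_count (X' - e) {f\<in>G. f \<inter> e = {}}"
    proof (rule less.hyps)
      show "card (V - {a}) < card V" using e(3) less.prems(1) by (metis Int_iff card_Diff1_less)
      show "card (X' - e) + 2 = 2 * card (V - {a})"
        using c2 \<open>2 \<le> card X'\<close> e X' less.prems(1) by (simp add: card_Diff_singleton)
      show "{f \<in> G. f \<inter> e = {}} \<subseteq> edges ((V - {a}) \<inter> (X' - e))"
        using insert.prems e(1) by (auto simp: edges_def)
    qed (use less.prems X' in auto)
    moreover have "gallai_count V G = gallai_count V (insert e G) + gallai_count (V - {a}) {f\<in>G. f \<inter> e = {}}"
      using insert.prems insert.hyps sub e less.prems(1) by (intro gallai_count_insert) auto
    moreover have "matching_count X' G = matching_count X' (insert e G) + matching_count (X' - e) {f\<in>G. f \<inter> e = {}}"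
      using insert.prems insert.hyps sub X' by (intro matching_count_insert) auto
    moreover have "G \<subseteq> edges (V \<inter> X')" using insert.prems by simp
    ultimately show ?case using insert.IH by simp
  qed simp
  have finE: "finite (edges (V \<inter> X))" "finite (edges V)" using less.prems by (simp_all add: finite_edges)
  have F: "int (gallai_count V F) - int (matching_count X F) =
      int (gallai_count V {}) - int (matching_count X {})"
    using step[OF less.prems(2,3) finite_subset[OF less.prems(4) finE(1)] less.prems(4)] .
  show ?case
  proof (cases "card V = 1")
    case True
    then have X: "X = {}" using less.prems by simp
    obtain v where v: "V = {v}" using True by (auto simp: card_1_singleton_iff)
    have "F = {}" using less.prems(4) X by (auto simp: edges_iff)
    moreover have "edges {v} = {}" by (auto simp: edges_iff)
    then have "gallai_on {v} = {{}}"
      by (auto simp: gallai_on_def partition_on_empty rainbow_free_def)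
    ultimately show ?thesis by (simp add: gallai_count_def matching_count_def X v matchings_empty)
  next
    case False
    then have V2: "2 \<le> card V" using less.prems(3) by linarith
    \<comment> \<open>\<open>X\<close> need not contain \<open>V\<close>, so perhaps not all edges
      of \<open>V\<close> can be forbidden in it. The set \<open>V \<union> Y\<close> contains
      \<open>V\<close> and has as many points as \<open>X\<close>, and without forbidden pairs only
      this number matters. Moreover \<open>Y\<close> is smaller than \<open>V\<close>, so the
      crossing count vanishes.\<close>
    obtain Y where Y: "finite Y" "card Y = card V - 2" "Y \<subseteq> UNIV - V"
      using infinite_arbitrarily_large[of "UNIV - V" "card V - 2"] less.prems(1)
      by (metis Diff_infinite_finite infinite_UNIV_nat)
    have VY1: "V \<inter> Y = {}" using Y(3) by auto
    then have VY: "V \<inter> Y = {}" "card (V \<union> Y) = card X"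
      using Y(2) less.prems(3) V2 by (simp_all add: card_Un_disjoint[OF less.prems(1) Y(1)])
    have "gallai_count V (edges V) = 0"
    proof -
      have "{p \<in> gallai_on V. \<forall>e\<in>edges V. {e} \<notin> p} = {}"
        using gallai_on_singleton_block[OF less.prems(1) V2] by blast
      then show ?thesis unfolding gallai_count_def by (metis card.empty)
    qed
    moreover have "matching_count (V \<union> Y) (edges V) = 0"
      using less.prems(1) Y V2 by (intro matching_count_crossing) auto
    moreover have "int (gallai_count V (edges V)) - int (matching_count (V \<union> Y) (edges V)) =
        int (gallai_count V {}) - int (matching_count (V \<union> Y) {})"
      by (rule step) (use less.prems Y VY finE in \<open>auto simp: Int_absorb1 Int_Un_distrib\<close>)
    moreover have "matching_count (V \<union> Y) {} = matching_count X {}"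
      using less.prems Y VY by (intro matching_count_empty_eq) auto
    ultimately show ?thesis using F by simp
  qed
qed

section \<open>Matchings without chords inside a block of adjacent points\<close>

definition geometric_poly :: "nat \<Rightarrow> complex poly"
  where "geometric_poly k = (\<Sum>i\<le>k. monom 1 i)"

text \<open>The functional through which both sides of the theorem are computed. The factor 1 - X
  takes differences of consecutive coefficients, as does the Jacobi-Trudi formula h_{n-b} h_b -
  h_{n-b+1} h_{b-1} for a two-rowed Schur function.\<close>

definition chord_sum :: "nat \<Rightarrow> complex poly \<Rightarrow> complex"
  where "chord_sum N p = (\<Sum>r\<le>N. of_nat (no_short_chord_count r) * coeff ([:1, -1:] * p) (N - r))"

lemma geometric_poly_mult: "[:1, -1:] * geometric_poly k = 1 - monom 1 (Suc k)"
proof (induction k)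
  case 0
  then show ?case by (simp add: geometric_poly_def monom_0 monom_Suc one_pCons)
next
  case (Suc k)
  have "[:1, -1:] * geometric_poly (Suc k) = [:1, -1:] * geometric_poly k + [:1, -1:] * monom 1 (Suc k)"
    by (simp add: geometric_poly_def distrib_left)
  also have "[:1, -1:] * monom (1::complex) (Suc k) = monom 1 (Suc k) - monom 1 (Suc (Suc k))"
    by (simp add: monom_Suc[of _ "Suc k"])
  finally show ?case using Suc.IH by simp
qed

lemma geometric_poly_0: "geometric_poly 0 = 1"
  by (simp add: geometric_poly_def)

lemma geometric_poly_1: "geometric_poly (Suc 0) = [:1, 1:]"
  by (simp add: geometric_poly_def monom_0 monom_Suc one_pCons)

text \<open>One step of the Clebsch-Gordan rule for q-integers, with X as q. Multiplication by the
  square of 1 - X turns the products of geometric sums into products of binomials 1 - X^k, and the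
  identity becomes one between powers of X.\<close>

lemma geometric_poly_Suc_mult:
  "geometric_poly (Suc a) * geometric_poly (Suc c) =
     geometric_poly (a + c + 2) + monom 1 1 * (geometric_poly a * geometric_poly c)"
proof -
  let ?u = "[:1, -1:] :: complex poly" and ?X = "monom (1::complex) 1"
  have m: "monom (1::complex) k = ?X ^ k" for k by (simp add: monom_power)
  have u: "?u = 1 - ?X" by (simp add: monom_0 monom_Suc one_pCons)
  have g: "?u * geometric_poly k = 1 - ?X ^ Suc k" for k
    unfolding geometric_poly_mult by (subst m) (rule refl)
  have "?u * ?u * (geometric_poly (Suc a) * geometric_poly (Suc c)) =
      (?u * geometric_poly (Suc a)) * (?u * geometric_poly (Suc c))"
    by (simp only: mult.assoc mult.left_commute)
  also have "\<dots> = ?u * (?u * geometric_poly (a + c + 2)) +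
      ?X * ((?u * geometric_poly a) * (?u * geometric_poly c))"
    unfolding g unfolding u by (simp add: algebra_simps power_add power2_eq_square)
  also have "\<dots> = ?u * ?u * (geometric_poly (a + c + 2) + ?X * (geometric_poly a * geometric_poly c))"
    by (simp only: mult.assoc mult.left_commute distrib_left)
  moreover have "?u * ?u \<noteq> 0" by simp
  ultimately show ?thesis by (simp only: mult_left_cancel not_False_eq_True)
qed

lemma chord_sum_add: "chord_sum N (p + q) = chord_sum N p + chord_sum N q"
  by (simp only: chord_sum_def distrib_left coeff_add sum.distrib)

text \<open>The factor X shifts all coefficients by one, and the additional term
  \<open>r = Suc N\<close> meets the constant coefficient, which is zero.\<close>

lemma chord_sum_shift: "chord_sum (Suc N) (monom 1 1 * p) = chord_sum N p"
proof -
  have c: "coeff ([:1, -1:] * (monom 1 1 * p)) (Suc k) = coeff ([:1, -1:] * p) k"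
    "coeff ([:1, -1:] * (monom 1 1 * p)) 0 = 0" for k
    by (simp_all add: monom_Suc monom_0)
  have "chord_sum (Suc N) (monom 1 1 * p) =
      (\<Sum>r\<le>N. of_nat (no_short_chord_count r) * coeff ([:1, -1:] * (monom 1 1 * p)) (Suc N - r))"
    by (simp only: chord_sum_def sum.atMost_Suc diff_self_eq_0 c) simp
  also have "\<dots> = chord_sum N p"
    unfolding chord_sum_def by (rule sum.cong) (simp_all only: atMost_iff Suc_diff_le c)
  finally show ?thesis .
qed

text \<open>Up to degree \<open>2 * N\<close>, the product of 1 - X with this geometric sum is just
  1, so only the term \<open>r = N\<close> survives. This is the base case of
  \<open>matching_count_blocks\<close>: a single run of \<open>2 * N\<close> points.\<close>

lemma chord_sum_geometric: "chord_sum N (geometric_poly (2 * N)) = of_nat (no_short_chord_count N)"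
proof -
  have "coeff ([:1, -1:] * geometric_poly (2 * N)) (N - r) = of_bool (r = N)" if "r \<le> N" for r
    using that unfolding geometric_poly_mult by (auto simp: coeff_1)
  then have "chord_sum N (geometric_poly (2 * N)) =
      (\<Sum>r\<le>N. of_nat (no_short_chord_count r) * of_bool (r = N))"
    unfolding chord_sum_def by (intro sum.cong) auto
  also have "\<dots> = (\<Sum>r\<in>{N}. of_nat (no_short_chord_count r))"
    by (rule sum.mono_neutral_cong_right) auto
  finally show ?thesis by simp
qed

lemma no_short_chord_count_eq:
  "no_short_chord_count r = matching_count {1..2 * r} {{i, i + 1} |i. 1 \<le> i \<and> i < 2 * r}"
proof -
  have "(\<forall>i. 1 \<le> i \<and> i < 2 * r \<longrightarrow> {i, i + 1} \<notin> M) \<longleftrightarrow>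
      M \<inter> {{i, i + 1} |i. 1 \<le> i \<and> i < 2 * r} = {}" for M by blast
  then show ?thesis
    by (simp only: no_short_chord_count_def matching_count_def perfect_matchings_def matchings_def)
qed

lemma matching_count_path:
  assumes "distinct xs" "length xs = 2 * N"
  shows "matching_count (set xs) (path_edges xs) = no_short_chord_count N"
proof -
  define f where "f i = xs ! (i - 1)" for i
  have inj: "inj_on f {1..2 * N}"
  proof (rule inj_onI)
    fix x y assume "x \<in> {1..2 * N}" "y \<in> {1..2 * N}" "f x = f y"
    then have "x - 1 = y - 1" using assms by (auto simp: f_def nth_eq_iff_index_eq)
    then show "x = y" using \<open>x \<in> _\<close> \<open>y \<in> _\<close> by auto
  qed
  have img: "f ` {1..2 * N} = set xs"
  proof (intro equalityI subsetI)
    fix x assume "x \<in> set xs"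
    then obtain i where "i < length xs" "x = xs ! i" by (auto simp: in_set_conv_nth)
    then have "x = f (Suc i)" "Suc i \<in> {1..2 * N}" using assms by (auto simp: f_def)
    then show "x \<in> f ` {1..2 * N}" by blast
  qed (use assms in \<open>auto simp: f_def\<close>)
  have "(`) f ` {{i, i + 1} |i. 1 \<le> i \<and> i < 2 * N} = path_edges xs"
  proof (intro equalityI subsetI)
    fix e assume "e \<in> (`) f ` {{i, i + 1} |i. 1 \<le> i \<and> i < 2 * N}"
    then obtain i where i: "1 \<le> i" "i < 2 * N" "e = {f i, f (i + 1)}" by auto
    then have "Suc (i - 1) < length xs" "e = {xs ! (i - 1), xs ! Suc (i - 1)}"
      using assms by (auto simp: f_def)
    then show "e \<in> path_edges xs" unfolding path_edges_def by blast
  next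
    fix e assume "e \<in> path_edges xs"
    then obtain i where i: "Suc i < length xs" "e = {xs ! i, xs ! Suc i}"
      unfolding path_edges_def by blast
    then have "e = f ` {Suc i, Suc i + 1}" "1 \<le> Suc i" "Suc i < 2 * N" using assms by (auto simp: f_def)
    then show "e \<in> (`) f ` {{i, i + 1} |i. 1 \<le> i \<and> i < 2 * N}" by blast
  qed
  moreover have "{{i, i + 1} |i. 1 \<le> i \<and> i < 2 * N} \<subseteq> Pow {1..2 * N}" by auto
  note matching_count_image[OF inj this]
  ultimately show ?thesis by (simp only: img no_short_chord_count_eq)
qed

lemma path_edges_short: "path_edges [] = {}" "path_edges [a] = {}"
  by (simp_all add: path_edges_def)

lemma path_edges_append:
  "path_edges (xs @ a # b # ys) = insert {a, b} (path_edges (xs @ [a]) \<union> path_edges (b # ys))"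
proof (induction xs)
  case Nil
  then show ?case by (simp add: path_edges_Cons_Cons path_edges_short)
next
  case (Cons x xs)
  then show ?case by (cases xs) (auto simp: path_edges_Cons_Cons path_edges_short)
qed

lemma path_edges_snoc:
  "path_edges (xs @ [a]) = (if xs = [] then {} else insert {last xs, a} (path_edges xs))"
proof (cases xs rule: rev_cases)
  case (snoc ys b)
  then show ?thesis using path_edges_append[of ys b a "[]"] by (simp add: path_edges_short)
qed (simp add: path_edges_short)

lemma path_edges_Cons:
  "path_edges (b # ys) = (if ys = [] then {} else insert {b, hd ys} (path_edges ys))"
  by (cases ys) (simp_all add: path_edges_short path_edges_Cons_Cons)

lemma path_edges_subset_edges:
  assumes "distinct xs"
  shows "path_edges xs \<subseteq> edges (set xs)"
proof
  fix e assume "e \<in> path_edges xs"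
  then obtain i where "Suc i < length xs" "e = {xs ! i, xs ! Suc i}" unfolding path_edges_def by blast
  then show "e \<in> edges (set xs)" using assms by (simp add: pair_in_edges_iff nth_eq_iff_index_eq)
qed

lemma path_edges_delete_last:
  assumes "distinct (xs @ [a])" "b \<notin> set xs"
  shows "{f \<in> path_edges (xs @ [a]). f \<inter> {a, b} = {}} = path_edges xs"
proof -
  have "f \<inter> {a, b} = {}" if "f \<in> path_edges xs" for f
    using path_edges_subset[OF that] assms by auto
  then show ?thesis unfolding path_edges_snoc by (auto simp: path_edges_short)
qed

lemma path_edges_delete_first:
  assumes "distinct (b # ys)" "a \<notin> set ys"
  shows "{f \<in> path_edges (b # ys). f \<inter> {a, b} = {}} = path_edges ys"
proof -
  have "f \<inter> {a, b} = {}" if "f \<in> path_edges ys" for f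
    using path_edges_subset[OF that] assms by auto
  then show ?thesis unfolding path_edges_Cons by (auto simp: path_edges_short)
qed

text \<open>This is \<open>matching_count_insert\<close> for the boundary pair
  \<open>{a, b}\<close>: forbidding it joins the two paths into one, using it takes an end point off
  each.\<close>

lemma matching_count_merge:
  assumes "distinct (xs @ [a] @ b # ys @ concat bl)"
  defines "F \<equiv> path_edges (xs @ [a]) \<union> path_edges (b # ys) \<union> \<Union>(path_edges ` set bl)"
  shows "matching_count (set (xs @ [a] @ b # ys @ concat bl)) F =
     matching_count (set (xs @ [a] @ b # ys @ concat bl)) (path_edges (xs @ a # b # ys) \<union> \<Union>(path_edges ` set bl)) +
     matching_count (set (xs @ ys @ concat bl)) (path_edges xs \<union> path_edges ys \<union> \<Union>(path_edges ` set bl))"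
proof -
  let ?X = "set (xs @ [a] @ b # ys @ concat bl)"
  have dbl: "distinct l" if "l \<in> set bl" for l using that assms(1) by (auto simp: distinct_concat_iff)
  have sub: "e \<subseteq> set (concat bl)" if "e \<in> \<Union>(path_edges ` set bl)" for e
    using that path_edges_subset by fastforce
  have sub_a: "e \<subseteq> set (xs @ [a])" if "e \<in> path_edges (xs @ [a])" for e using that path_edges_subset by blast
  have sub_b: "e \<subseteq> set (b # ys)" if "e \<in> path_edges (b # ys)" for e using that path_edges_subset by blast
  have ab_notin: "{a, b} \<notin> F"
  proof
    assume "{a, b} \<in> F"
    then have "{a, b} \<in> path_edges (xs @ [a]) \<or> {a, b} \<in> path_edges (b # ys) \<or> {a, b} \<in> \<Union>(path_edges ` set bl)"
      unfolding F_def by (simp only: Un_iff disj_assoc)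
    then show False
    proof (elim disjE)
      assume "{a, b} \<in> path_edges (xs @ [a])"
      from sub_a[OF this] show False using assms(1) by auto
    next
      assume "{a, b} \<in> path_edges (b # ys)"
      from sub_b[OF this] show False using assms(1) by auto
    next
      assume "{a, b} \<in> \<Union>(path_edges ` set bl)"
      from sub[OF this] show False using assms(1) by auto
    qed
  qed
  have "F \<subseteq> edges ?X"
  proof -
    have "path_edges (xs @ [a]) \<subseteq> edges ?X" "path_edges (b # ys) \<subseteq> edges ?X"
      using path_edges_subset_edges[of "xs @ [a]"] path_edges_subset_edges[of "b # ys"] assms(1)
        edges_mono[of "set (xs @ [a])" ?X] edges_mono[of "set (b # ys)" ?X] by auto
    moreover have "path_edges l \<subseteq> edges ?X" if "l \<in> set bl" for l
      using path_edges_subset_edges[OF dbl[OF that]] edges_mono[of "set l" ?X] that by auto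
    ultimately show ?thesis unfolding F_def by blast
  qed
  moreover have "{a, b} \<in> edges ?X" using assms(1) by (auto simp: pair_in_edges_iff)
  ultimately have "insert {a, b} F \<subseteq> edges ?X" by blast
  note main = matching_count_insert[OF _ this ab_notin]
  have "?X - {a, b} = set (xs @ ys @ concat bl)" using assms(1) by auto
  moreover have "{f \<in> F. f \<inter> {a, b} = {}} = path_edges xs \<union> path_edges ys \<union> \<Union>(path_edges ` set bl)"
  proof -
    have "f \<inter> {a, b} = {}" if "f \<in> \<Union>(path_edges ` set bl)" for f
      using sub[OF that] assms(1) by auto
    then have "{f \<in> \<Union>(path_edges ` set bl). f \<inter> {a, b} = {}} = \<Union>(path_edges ` set bl)" by blast
    moreover have "{f \<in> path_edges (xs @ [a]). f \<inter> {a, b} = {}} = path_edges xs"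
      by (rule path_edges_delete_last) (use assms(1) in auto)
    moreover have "{f \<in> path_edges (b # ys). f \<inter> {a, b} = {}} = path_edges ys"
      by (rule path_edges_delete_first) (use assms(1) in auto)
    moreover have "{f \<in> F. f \<inter> {a, b} = {}} = {f \<in> path_edges (xs @ [a]). f \<inter> {a, b} = {}} \<union>
        {f \<in> path_edges (b # ys). f \<inter> {a, b} = {}} \<union> {f \<in> \<Union>(path_edges ` set bl). f \<inter> {a, b} = {}}"
      unfolding F_def by blast
    ultimately show ?thesis by (simp only:)
  qed
  moreover have "insert {a, b} F = path_edges (xs @ a # b # ys) \<union> \<Union>(path_edges ` set bl)"
    unfolding F_def path_edges_append by blast
  ultimately show ?thesis using main by simp
qed

text \<open>Merging two neighbouring blocks forbids one more pair. The identity
  \<open>geometric_poly_Suc_mult\<close> mirrors the resulting deletion-contraction rule.\<close>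

theorem matching_count_blocks:
  assumes "distinct (concat bl)" "length (concat bl) = 2 * N"
  shows "of_nat (matching_count (set (concat bl)) (\<Union>(path_edges ` set bl))) =
    chord_sum N (\<Prod>b\<leftarrow>bl. geometric_poly (length b))"
  using assms
\<comment> \<open>Every recursive call shrinks this measure: dropping an empty block or merging two
  blocks saves a block, and deleting the boundary pair saves two points.\<close>
proof (induction "length (concat bl) + length bl" arbitrary: bl N rule: less_induct)
  case less
  consider "bl = []" | b where "bl = [b]" | bl' where "bl = [] # bl'" | b bl' where "bl = b # [] # bl'"
    | xs a b ys bl' where "bl = (xs @ [a]) # (b # ys) # bl'"
  proof (cases bl)
    case (Cons c cs)
    show ?thesis
    proof (cases cs)
      case (Cons d ds)
      then show ?thesis using that \<open>bl = c # cs\<close> by (cases c rule: rev_cases; cases d) auto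
    qed (use that Cons in auto)
  qed (use that in auto)
  then show ?case
  proof cases
    case 1
    then have "N = 0" using less.prems by simp
    then show ?thesis using 1 chord_sum_geometric[of 0] matching_count_path[of "[]" 0]
      by (simp add: geometric_poly_0 path_edges_short)
  next
    case 2
    then have "length b = 2 * N" "distinct b" using less.prems by auto
    then show ?thesis using 2 chord_sum_geometric[of N] matching_count_path[of b N] by simp
  next
    case 3
    then have "of_nat (matching_count (set (concat bl')) (\<Union>(path_edges ` set bl'))) =
        chord_sum N (\<Prod>b\<leftarrow>bl'. geometric_poly (length b))"
      using less.prems by (intro less.hyps) auto
    then show ?thesis using 3 by (simp add: geometric_poly_0 path_edges_short)
  next
    case 4
    then have "of_nat (matching_count (set (concat (b # bl'))) (\<Union>(path_edges ` set (b # bl')))) =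
        chord_sum N (\<Prod>b\<leftarrow>b # bl'. geometric_poly (length b))"
      using less.prems by (intro less.hyps) auto
    then show ?thesis using 4 by (simp add: geometric_poly_0 path_edges_short)
  next
    case 5
    have len: "length xs + length ys + length (concat bl') + 2 = 2 * N" using less.prems(2) 5 by simp
    then obtain M where M: "N = Suc M" by (cases N) auto
    have d: "distinct (xs @ [a] @ b # ys @ concat bl')" using less.prems(1) 5 by simp
    have "of_nat (matching_count (set (concat ((xs @ a # b # ys) # bl'))) (\<Union>(path_edges ` set ((xs @ a # b # ys) # bl')))) =
        chord_sum N (\<Prod>b\<leftarrow>(xs @ a # b # ys) # bl'. geometric_poly (length b))"
      using less.prems 5 by (intro less.hyps) auto
    moreover have "of_nat (matching_count (set (concat (xs # ys # bl'))) (\<Union>(path_edges ` set (xs # ys # bl')))) =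
        chord_sum M (\<Prod>b\<leftarrow>xs # ys # bl'. geometric_poly (length b))"
      using less.prems 5 M by (intro less.hyps) auto
    moreover have "(\<Prod>b\<leftarrow>bl. geometric_poly (length b)) = (\<Prod>b\<leftarrow>(xs @ a # b # ys) # bl'. geometric_poly (length b))
        + monom 1 1 * (\<Prod>b\<leftarrow>xs # ys # bl'. geometric_poly (length b))"
    proof -
      have "(\<Prod>b\<leftarrow>bl. geometric_poly (length b)) =
        (geometric_poly (Suc (length xs)) * geometric_poly (Suc (length ys))) * (\<Prod>b\<leftarrow>bl'. geometric_poly (length b))"
        using 5 by (simp add: mult.assoc)
      also have "\<dots> = (geometric_poly (length xs + length ys + 2) +
           monom 1 1 * (geometric_poly (length xs) * geometric_poly (length ys))) * (\<Prod>b\<leftarrow>bl'. geometric_poly (length b))"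
        by (simp only: geometric_poly_Suc_mult)
      finally show ?thesis by (simp add: distrib_right mult.assoc)
    qed
    moreover have "matching_count (set (concat bl)) (\<Union>(path_edges ` set bl)) =
        matching_count (set (concat ((xs @ a # b # ys) # bl'))) (\<Union>(path_edges ` set ((xs @ a # b # ys) # bl'))) +
        matching_count (set (concat (xs # ys # bl'))) (\<Union>(path_edges ` set (xs # ys # bl')))"
      using matching_count_merge[OF d] by (simp add: 5 Un_assoc)
    ultimately show ?thesis by (simp only: of_nat_add chord_sum_add chord_sum_shift M)
  qed
qed

section \<open>Coefficients of the Gallai quasisymmetric function\<close>

lemma sum_fun_apply: "sum f A x = (\<Sum>a\<in>A. f a x)"
  by (induction A rule: infinite_finite_induct) auto

text \<open>The coefficient at X^i counts the submultisets of \<open>m\<close> of size i. It is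
  therefore the coefficient of the monomial \<open>m\<close> in h_i h_{n-i}, where n is the size of
  \<open>m\<close>.\<close>

definition multiset_poly :: "'a multiset \<Rightarrow> complex poly"
  where "multiset_poly m = (\<Prod>k\<in>set_mset m. geometric_poly (count m k))"

text \<open>The only weakly increasing word with content \<open>m\<close> is its sorted list, so the
  coefficient is 0 or 1.\<close>

lemma fundamental_qsym_eq:
  assumes "size m = n" "J \<subseteq> {1..n - 1}"
  shows "fundamental_qsym n J m =
    of_bool (\<forall>j\<in>J. sorted_list_of_multiset m ! (j - 1) < sorted_list_of_multiset m ! j)"
proof -
  let ?s = "sorted_list_of_multiset m"
  have u: "is = ?s" if "sorted is" "mset is = m" for "is"
    using that by (metis sorted_list_of_multiset_mset sorted_sort_id)
  have s: "mset ?s = m" "sorted ?s" "length ?s = n"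
    using assms(1) by (simp_all flip: size_mset)
  have "length is = n \<and> sorted is \<and> (\<forall>j\<in>J. is ! (j - 1) < is ! j) \<and> mset is = m \<longleftrightarrow>
      is = ?s \<and> (\<forall>j\<in>J. ?s ! (j - 1) < ?s ! j)" for "is"
  proof
    assume *: "length is = n \<and> sorted is \<and> (\<forall>j\<in>J. is ! (j - 1) < is ! j) \<and> mset is = m"
    then have "is = ?s" by (intro u) simp_all
    then show "is = ?s \<and> (\<forall>j\<in>J. ?s ! (j - 1) < ?s ! j)" using * by simp
  qed (use s in simp)
  then have "{is. length is = n \<and> sorted is \<and> (\<forall>j\<in>J. is ! (j - 1) < is ! j) \<and> mset is = m} =
      (if \<forall>j\<in>J. ?s ! (j - 1) < ?s ! j then {?s} else {})" by simp
  then show ?thesis unfolding fundamental_qsym_def by simp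
qed

text \<open>By the hypothesis, \<open>P\<close> holds on an interval within \<open>[a..<b]\<close>,
  so neighbours in the filtered list are consecutive numbers.\<close>

lemma path_edges_filter_upt:
  assumes "\<And>i j k. P i \<Longrightarrow> P j \<Longrightarrow> i \<le> k \<Longrightarrow> k \<le> j \<Longrightarrow> a \<le> i \<Longrightarrow> j < b \<Longrightarrow> P k"
  shows "path_edges (filter P [a..<b]) = {{i, i + 1} |i. a \<le> i \<and> i + 1 < b \<and> P i \<and> P (i + 1)}"
  using assms
proof (induction b)
  case 0
  then show ?case by (simp add: path_edges_short)
next
  case (Suc b)
  have IH: "path_edges (filter P [a..<b]) = {{i, i + 1} |i. a \<le> i \<and> i + 1 < b \<and> P i \<and> P (i + 1)}"
    by (rule Suc.IH) (use Suc.prems in \<open>meson less_SucI\<close>)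
  have split: "{{i, i + 1} |i. a \<le> i \<and> i + 1 < Suc b \<and> P i \<and> P (i + 1)} =
      {{i, i + 1} |i. a \<le> i \<and> i + 1 < b \<and> P i \<and> P (i + 1)} \<union>
      {{i, i + 1} |i. a \<le> i \<and> i + 1 = b \<and> P i \<and> P (i + 1)}"
    unfolding less_Suc_eq by blast
  show ?case
  proof (cases "a \<le> b \<and> P b")
    case False
    then have "filter P [a..<Suc b] = filter P [a..<b]" by (auto simp: upt_Suc)
    moreover have "{{i, i + 1} |i. a \<le> i \<and> i + 1 = b \<and> P i \<and> P (i + 1)} = {}"
      using False by auto
    ultimately show ?thesis by (simp only: split IH Un_empty_right)
  next
    case True
    then have f: "filter P [a..<Suc b] = filter P [a..<b] @ [b]" by simp
    show ?thesis
    proof (cases "filter P [a..<b] = []")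
      case True
      then have "\<not> P i" if "a \<le> i" "i < b" for i using that by (auto simp: filter_empty_conv)
      then have "{{i, i + 1} |i. a \<le> i \<and> i + 1 = b \<and> P i \<and> P (i + 1)} = {}" by auto
      then show ?thesis using True IH split f by (simp add: path_edges_short)
    next
      case False
      then obtain i where i: "a \<le> i" "i < b" "P i" by (auto simp: filter_empty_conv)
      then obtain c where c: "b = Suc c" by (cases b) auto
      have "P c" using Suc.prems[of i b c] i c True by simp
      then have "last (filter P [a..<b]) = c" using i c by simp
      moreover have "{{i, i + 1} |i. a \<le> i \<and> i + 1 = b \<and> P i \<and> P (i + 1)} = {{c, b}}"
        using i c True \<open>P c\<close> by auto
      ultimately show ?thesis using False IH split f by (simp add: path_edges_snoc)
    qed
  qed
qed

lemma distinct_concat_filter: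
  assumes "distinct ks" "distinct xs"
  shows "distinct (concat (map (\<lambda>k. filter (\<lambda>i. f i = k) xs) ks))"
  using assms by (induction ks) auto

lemma gallai_qsym_coeff:
  assumes "n > 1"
  shows "gallai_qsym n (n - 1) m =
    (if size m = n then chord_sum (n - 1) (multiset_poly m * [:1, 1:] ^ (n - 2)) else 0)"
proof (cases "size m = n")
  case False
  then have "{is. length is = n \<and> sorted is \<and> (\<forall>j\<in>J. is ! (j - 1) < is ! j) \<and> mset is = m} = {}" for J
    by (auto simp flip: size_mset)
  then have "fundamental_qsym n J m = 0" for J unfolding fundamental_qsym_def by (metis card.empty of_nat_0)
  then show ?thesis using False by (simp add: gallai_qsym_def sum_fun_apply)
next
  case True
  let ?s = "sorted_list_of_multiset m"
  have s: "mset ?s = m" "sorted ?s" "length ?s = n" using True by (simp_all flip: size_mset)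
  define f where "f i = ?s ! (i - 1)" for i
  have f_mono: "f i \<le> f j" if "1 \<le> i" "i \<le> j" "j \<le> n" for i j
    unfolding f_def using that s by (intro sorted_nth_mono) auto
  \<comment> \<open>The coefficient of \<open>m\<close> is 1 exactly if no descent falls between
    equal letters. The edges in \<open>F\<close> are those that must therefore not be singleton
    blocks.\<close>
  define F where "F = {{i, i + 1} |i. 1 \<le> i \<and> i < n \<and> f i = f (i + 1)}"
  have "fundamental_qsym n (Des n p) m = of_bool (\<forall>e\<in>F. {e} \<notin> p)" for p
  proof -
    have "fundamental_qsym n (Des n p) m = of_bool (\<forall>j\<in>Des n p. f j < f (j + 1))"
      using True by (subst fundamental_qsym_eq) (auto simp: Des_def f_def)
    also have "(\<forall>j\<in>Des n p. f j < f (j + 1)) \<longleftrightarrow> (\<forall>e\<in>F. {e} \<notin> p)"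
    proof
      assume L: "\<forall>j\<in>Des n p. f j < f (j + 1)"
      show "\<forall>e\<in>F. {e} \<notin> p"
      proof
        fix e assume "e \<in> F"
        then obtain i where i: "1 \<le> i" "i < n" "f i = f (i + 1)" "e = {i, i + 1}"
          unfolding F_def by blast
        then have "i \<notin> Des n p" using L by auto
        then show "{e} \<notin> p" using i by (auto simp: Des_def)
      qed
    next
      assume R: "\<forall>e\<in>F. {e} \<notin> p"
      show "\<forall>j\<in>Des n p. f j < f (j + 1)"
      proof
        fix j assume "j \<in> Des n p"
        then have j: "1 \<le> j" "j < n" "{{j, j + 1}} \<in> p" by (auto simp: Des_def)
        then have "{j, j + 1} \<notin> F" using R by blast
        then have "f j \<noteq> f (j + 1)" using j unfolding F_def by blast
        then show "f j < f (j + 1)" using f_mono[of j "j + 1"] j by (simp add: order_less_le)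
      qed
    qed
    finally show ?thesis .
  qed
  then have "gallai_qsym n (n - 1) m = (\<Sum>p\<in>gallai_on {1..n}. of_bool (\<forall>e\<in>F. {e} \<notin> p))"
    by (simp add: gallai_qsym_def sum_fun_apply gallai_partitions_eq[simplified])
  also have "\<dots> = of_nat (gallai_count {1..n} F)"
    unfolding gallai_count_def
    by (subst sum_of_bool_eq) (simp_all only: finite_gallai_on finite_atLeastAtMost Int_def mem_Collect_eq)
  also have "gallai_count {1..n} F = matching_count {1..2 * n - 2} F"
  proof (rule gallai_count_eq_matching_count)
    have "{1..n} \<inter> {1..2 * n - 2} = {1..n}" using assms by auto
    moreover have "F \<subseteq> edges {1..n}" by (auto simp: F_def pair_in_edges_iff)
    ultimately show "F \<subseteq> edges ({1..n} \<inter> {1..2 * n - 2})" by (simp only:)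
  qed (use assms in auto)
  also have "of_nat (matching_count {1..2 * n - 2} F) =
      chord_sum (n - 1) (multiset_poly m * [:1, 1:] ^ (n - 2))"
  proof -
    define runs where "runs = map (\<lambda>k. filter (\<lambda>i. f i = k) [1..<n + 1]) (sorted_list_of_set (set_mset m))"
    \<comment> \<open>The points \<open>n + 1\<close> to \<open>2 * n - 2\<close> are in no
      forbidden pair. As blocks of length one they complete the ground set and contribute the factor
      \<open>[:1, 1:] ^ (n - 2)\<close>.\<close>
    define bl where "bl = runs @ map (\<lambda>i. [i]) [n + 1..<2 * n - 1]"
    have fm: "f i \<in># m" if "1 \<le> i" "i \<le> n" for i
    proof -
      have "f i \<in> set ?s" unfolding f_def using that s(3) by (intro nth_mem) auto
      then show ?thesis by (simp only: set_mset_mset[symmetric] s(1))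
    qed
    have set_runs: "set (concat runs) = {1..n}" unfolding runs_def using fm by auto
    have concat_rest: "concat (map (\<lambda>i. [i]) [n + 1..<2 * n - 1]) = [n + 1..<2 * n - 1]"
      by (induction "[n + 1..<2 * n - 1]") auto
    have set_bl: "set (concat bl) = {1..2 * n - 2}"
      using assms unfolding bl_def concat_append set_append set_runs concat_rest by auto
    have "distinct (concat runs)" unfolding runs_def
      by (rule distinct_concat_filter) (simp_all only: distinct_sorted_list_of_set distinct_upt)
    then have dist: "distinct (concat bl)"
      unfolding bl_def concat_append distinct_append set_runs concat_rest by auto
    have len: "length (concat bl) = 2 * (n - 1)"
      using distinct_card[OF dist] set_bl by simp
    have "\<Union>(path_edges ` set runs) = F"
    proof -
      have pe: "path_edges (filter (\<lambda>i. f i = k) [1..<n + 1]) =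
          {{i, i + 1} |i. 1 \<le> i \<and> i + 1 < n + 1 \<and> f i = k \<and> f (i + 1) = k}" for k
      proof (rule path_edges_filter_upt)
        fix i j l assume "f i = k" "f j = k" "i \<le> l" "l \<le> j" "1 \<le> i" "j < n + 1"
        then show "f l = k" using f_mono[of i l] f_mono[of l j] by simp
      qed
      have "\<Union>(path_edges ` set runs) = (\<Union>k\<in>set_mset m. path_edges (filter (\<lambda>i. f i = k) [1..<n + 1]))"
        by (simp add: runs_def)
      also have "\<dots> = F" unfolding pe F_def using fm by fastforce
      finally show ?thesis .
    qed
    moreover have "\<Union>(path_edges ` set bl) = \<Union>(path_edges ` set runs)"
      by (auto simp: bl_def path_edges_short)
    ultimately have F: "\<Union>(path_edges ` set bl) = F" by simp
    have count_map: "count (mset (map f xs)) k = length (filter (\<lambda>i. k = f i) xs)" for xs k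
      by (induction xs) auto
    have lenk: "length (filter (\<lambda>i. f i = k) [1..<n + 1]) = count m k" for k
    proof -
      have "?s = map f [1..<n + 1]"
        using s(3) by (intro nth_equalityI) (simp_all add: f_def del: upt_Suc)
      then have "count (mset ?s) k = length (filter (\<lambda>i. k = f i) [1..<n + 1])"
        by (simp only: count_map)
      then show ?thesis unfolding s(1) by (simp add: eq_commute)
    qed
    have "(\<Prod>b\<leftarrow>runs. geometric_poly (length b)) = multiset_poly m"
      unfolding runs_def multiset_poly_def
      by (simp only: map_map o_def lenk) (simp add: prod.distinct_set_conv_list[symmetric])
    moreover have "(\<Prod>b\<leftarrow>map (\<lambda>i. [i]) [n + 1..<2 * n - 1]. geometric_poly (length b)) = [:1, 1:] ^ (n - 2)"
    proof -
      have "(\<Prod>b\<leftarrow>map (\<lambda>i. [i]) xs. geometric_poly (length b)) = [:1, 1:] ^ length xs" for xs :: "nat list"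
        by (induction xs) (simp_all add: geometric_poly_1)
      then show ?thesis by simp
    qed
    ultimately have "(\<Prod>b\<leftarrow>bl. geometric_poly (length b)) = multiset_poly m * [:1, 1:] ^ (n - 2)"
      by (simp only: bl_def map_append prod_list.append)
    then show ?thesis using matching_count_blocks[OF dist len] F set_bl by simp
  qed
  finally show ?thesis using True by simp
qed

section \<open>Schur functions of two-rowed shapes\<close>

definition palindromic :: "nat \<Rightarrow> complex poly \<Rightarrow> bool"
  where "palindromic n p \<longleftrightarrow> (\<forall>j\<le>n. coeff p (n - j) = coeff p j) \<and> (\<forall>j>n. coeff p j = 0)"

lemma coeff_one_minus_X_mult:
  "coeff ([:1, -1:] * p) j = coeff p j - (if j = 0 then 0 else coeff p (j - 1))" for p :: "complex poly"
  by (cases j) (simp_all add: coeff_pCons)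

text \<open>Reversal about degree \<open>n + 1\<close> preserves the palindromic factor and changes
  the sign of 1 - X.\<close>

lemma palindromic_antisym:
  assumes "palindromic n p"
  shows "j \<le> n + 1 \<Longrightarrow> coeff ([:1, -1:] * p) (n + 1 - j) = - coeff ([:1, -1:] * p) j"
    and "j > n + 1 \<Longrightarrow> coeff ([:1, -1:] * p) j = 0"
proof -
  have p: "\<And>j. j \<le> n \<Longrightarrow> coeff p (n - j) = coeff p j" "\<And>j. j > n \<Longrightarrow> coeff p j = 0"
    using assms by (auto simp: palindromic_def)
  show "coeff ([:1, -1:] * p) j = 0" if "j > n + 1"
    unfolding coeff_one_minus_X_mult using that p(2) by simp
  show "coeff ([:1, -1:] * p) (n + 1 - j) = - coeff ([:1, -1:] * p) j" if jn: "j \<le> n + 1"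
  proof -
    consider "j = 0" | "j = n + 1" | i where "j = Suc i" "Suc i \<le> n"
      using jn by (cases j) (auto simp: le_Suc_eq)
    then show ?thesis
    proof cases
      case 3
      then have "n + 1 - j = Suc (n - Suc i)" "Suc (n - Suc i) = n - i" by auto
      then show ?thesis unfolding coeff_one_minus_X_mult using 3 p(1)[of i] p(1)[of "Suc i"] by simp
    qed (use p(1)[of n] p(1)[of 0] p(2)[of "Suc n"] in \<open>simp_all add: coeff_one_minus_X_mult del: mult_pCons_left\<close>)
  qed
qed

lemma eq_uminus_self: "x = - x \<Longrightarrow> x = 0" for x :: complex
  by (simp add: complex_eq_iff)

lemma palindromic_reflect:
  assumes "reflect_poly p = p" "degree p = n"
  shows "palindromic n p"
  unfolding palindromic_def
proof (intro conjI allI impI)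
  fix j assume "j \<le> n"
  then show "coeff p (n - j) = coeff p j"
    using coeff_reflect_poly[of p j] assms by simp
next
  fix j assume "j > n"
  then show "coeff p j = 0" using assms(2) by (simp add: coeff_eq_0)
qed

lemma coeff_geometric_poly: "coeff (geometric_poly k) i = of_bool (i \<le> k)"
  by (simp add: geometric_poly_def coeff_sum)

lemma degree_geometric_poly: "degree (geometric_poly k) = k"
proof (rule antisym)
  show "degree (geometric_poly k) \<le> k" by (rule degree_le) (simp add: coeff_geometric_poly)
  show "k \<le> degree (geometric_poly k)" by (rule le_degree) (simp add: coeff_geometric_poly)
qed

lemma reflect_geometric_poly: "reflect_poly (geometric_poly k) = geometric_poly k"
  by (rule poly_eqI) (simp add: coeff_reflect_poly degree_geometric_poly coeff_geometric_poly)

lemma geometric_poly_nonzero: "geometric_poly k \<noteq> 0"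
  using coeff_geometric_poly[of k 0] by auto

text \<open>Each geometric factor equals its own reflection, reflection is multiplicative, and the
  degrees of the factors add up to the size of \<open>m\<close>.\<close>

lemma palindromic_multiset_poly: "palindromic (size m) (multiset_poly m)"
proof (rule palindromic_reflect)
  show "reflect_poly (multiset_poly m) = multiset_poly m"
    by (simp add: multiset_poly_def reflect_poly_prod reflect_geometric_poly)
  show "degree (multiset_poly m) = size m"
    unfolding multiset_poly_def
    by (subst degree_prod_eq_sum_degree)
       (simp_all add: geometric_poly_nonzero degree_geometric_poly size_multiset_overloaded_eq)
qed

text \<open>The contents of the second and the first row of a two-rowed semistandard tableau.\<close>

definition row_contents :: "nat multiset \<Rightarrow> nat \<Rightarrow> (nat multiset \<times> nat multiset) set"
  where "row_contents m b = {(A, B). A + B = m \<and> size A = b \<and>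
    (\<forall>k. size (filter_mset (\<lambda>x. x \<le> k) A) \<le> size (filter_mset (\<lambda>x. x < k) B))}"

lemma finite_row_contents: "finite (row_contents m b)"
proof (rule finite_subset)
  let ?L = "{xs. set xs \<subseteq> set_mset m \<and> length xs = b}"
  show "row_contents m b \<subseteq> (\<lambda>A. (A, m - A)) ` mset ` ?L"
  proof
    fix x assume x: "x \<in> row_contents m b"
    obtain A B where AB: "x = (A, B)" by (cases x)
    obtain xs where xs: "mset xs = A" using ex_mset by blast
    have "B = m - A" "size A = b" "set_mset A \<subseteq> set_mset m" using x AB by (auto simp: row_contents_def)
    moreover have "set xs = set_mset A" "length xs = size A" by (simp_all flip: xs)
    ultimately have "xs \<in> ?L" "x = (\<lambda>A. (A, m - A)) (mset xs)" using xs AB by simp_all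
    then show "x \<in> (\<lambda>A. (A, m - A)) ` mset ` ?L" by blast
  qed
  show "finite ((\<lambda>A. (A, m - A)) ` mset ` ?L)"
    by (intro finite_imageI finite_lists_length_eq) simp
qed

lemma filter_replicate_mset: "filter_mset P (replicate_mset i k) = (if P k then replicate_mset i k else {#})"
  by (induction i) auto

lemma filter_mset_all: "(\<And>x. x \<in># A \<Longrightarrow> P x) \<Longrightarrow> filter_mset P A = A"
  by (simp add: filter_mset_eq_conv)

text \<open>Here \<open>k\<close> is larger than all letters of \<open>m\<close>, and
  \<open>j\<close> is the number of old letters in the second row, which receives
  \<open>b - j\<close> of the \<open>c\<close> copies. The only new column condition is that the
  second row, now of length \<open>b\<close>, fits below the \<open>size m - j\<close> old letters
  of the first row; this is \<open>b + j \<le> size m\<close>.\<close>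

lemma row_contents_add_letter:
  assumes "\<And>x. x \<in># m \<Longrightarrow> x < k"
  shows "row_contents (m + replicate_mset c k) b =
    (\<Union>j\<in>{j. j \<le> b \<and> b \<le> j + c \<and> b + j \<le> size m}.
      (\<lambda>(A, B). (A + replicate_mset (b - j) k, B + replicate_mset (c + j - b) k)) ` row_contents m j)"
    (is "?L = ?R")
proof (intro equalityI subsetI)
  fix x assume "x \<in> ?L"
  then obtain A B where x: "x = (A, B)" and AB: "A + B = m + replicate_mset c k" and sA: "size A = b"
    and bal: "\<And>l. size (filter_mset (\<lambda>x. x \<le> l) A) \<le> size (filter_mset (\<lambda>x. x < l) B)"
    by (auto simp: row_contents_def)
  let ?A = "filter_mset (\<lambda>x. x < k) A" and ?B = "filter_mset (\<lambda>x. x < k) B"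
  have le: "y \<le> k" if "y \<in># A + B" for y
    using that assms[of y] unfolding AB by (auto split: if_splits)
  have rep: "C = filter_mset (\<lambda>x. x < k) C + replicate_mset (count C k) k" if "C \<subseteq># A + B" for C
  proof (rule multiset_eqI)
    fix y
    have "y \<in># C \<Longrightarrow> y \<le> k" using le that by (meson mset_subset_eqD)
    then show "count C y = count (filter_mset (\<lambda>x. x < k) C + replicate_mset (count C k) k) y"
      by (cases "y \<in># C") (auto simp: not_in_iff)
  qed
  have A: "A = ?A + replicate_mset (count A k) k" and B: "B = ?B + replicate_mset (count B k) k"
    using rep[of A] rep[of B] by simp_all
  have sum: "?A + ?B = m"
  proof -
    have "?A + ?B = filter_mset (\<lambda>x. x < k) (A + B)" by simp
    also have "\<dots> = m" unfolding AB using filter_mset_all[of m "\<lambda>x. x < k"] assms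
      by (simp add: filter_replicate_mset)
    finally show ?thesis .
  qed
  have "k \<notin># m" using assms by blast
  then have cnt: "count A k + count B k = c"
    using arg_cong[OF AB, of "\<lambda>M. count M k"] by (simp add: not_in_iff)
  have bj: "b = size ?A + count A k" using arg_cong[OF A, of size] sA by simp
  have "filter_mset (\<lambda>x. x \<le> k) A = A" using le by (intro filter_mset_all) simp
  then have "b \<le> size ?B" using bal[of k] sA by simp
  then have J: "b + size ?A \<le> size m" using sum by (metis add.commute add_le_mono1 size_union)
  have "(?A, ?B) \<in> row_contents m (size ?A)"
  proof -
    have "size (filter_mset (\<lambda>x. x \<le> l) ?A) \<le> size (filter_mset (\<lambda>x. x < l) ?B)" for l
    proof (cases "l < k")
      case True
      then have "filter_mset (\<lambda>x. x \<le> l) ?A = filter_mset (\<lambda>x. x \<le> l) A"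
        "filter_mset (\<lambda>x. x < l) ?B = filter_mset (\<lambda>x. x < l) B"
        by (auto simp: filter_filter_mset intro!: filter_mset_cong)
      then show ?thesis using bal[of l] by simp
    next
      case False
      then have "size (filter_mset (\<lambda>x. x < l) ?B) = size ?B"
        by (intro arg_cong[of _ _ size] filter_mset_all) auto
      moreover have "size (filter_mset (\<lambda>x. x \<le> l) ?A) \<le> size ?A" by (rule size_filter_mset_lesseq)
      ultimately show ?thesis using \<open>b \<le> size ?B\<close> bj by linarith
    qed
    then show ?thesis using sum by (simp add: row_contents_def)
  qed
  moreover have "b - size ?A = count A k" "c + size ?A - b = count B k" using bj cnt by simp_all
  then have "x = (\<lambda>(A, B). (A + replicate_mset (b - size ?A) k, B + replicate_mset (c + size ?A - b) k)) (?A, ?B)"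
    using x A B by simp
  moreover have "size ?A \<in> {j. j \<le> b \<and> b \<le> j + c \<and> b + j \<le> size m}" using J bj cnt by simp
  ultimately show "x \<in> ?R" by blast
next
  fix x assume "x \<in> ?R"
  then obtain j A B where j: "j \<le> b" "b \<le> j + c" "b + j \<le> size m" and AB: "(A, B) \<in> row_contents m j"
    and x: "x = (A + replicate_mset (b - j) k, B + replicate_mset (c + j - b) k)" by auto
  have m: "A + B = m" "size A = j" and
    bal: "\<And>l. size (filter_mset (\<lambda>x. x \<le> l) A) \<le> size (filter_mset (\<lambda>x. x < l) B)"
    using AB by (auto simp: row_contents_def)
  have lt: "y < k" if "y \<in># A \<or> y \<in># B" for y using assms[of y] that m(1) by auto
  have sB: "b \<le> size B" using j m by auto
  have "size (filter_mset (\<lambda>x. x \<le> l) (A + replicate_mset (b - j) k)) \<le>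
      size (filter_mset (\<lambda>x. x < l) (B + replicate_mset (c + j - b) k))" for l
  proof (cases "l < k")
    case True
    then show ?thesis using bal[of l] by (simp add: filter_replicate_mset)
  next
    case False
    have "size (filter_mset (\<lambda>x. x \<le> l) (A + replicate_mset (b - j) k)) \<le> size (A + replicate_mset (b - j) k)"
      by (rule size_filter_mset_lesseq)
    also have "\<dots> = b" using m j by simp
    also have "\<dots> \<le> size B" by (rule sB)
    also have "B = filter_mset (\<lambda>x. x < l) B" using lt False by (intro filter_mset_all[symmetric]) force
    also have "size \<dots> \<le> size (filter_mset (\<lambda>x. x < l) (B + replicate_mset (c + j - b) k))" by simp
    finally show ?thesis .
  qed
  moreover have "(A + replicate_mset (b - j) k) + (B + replicate_mset (c + j - b) k) = m + replicate_mset c k"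
  proof -
    have "replicate_mset (b - j) k + replicate_mset (c + j - b) k = replicate_mset c k"
      by (rule multiset_eqI) (use j in auto)
    then show ?thesis unfolding m(1)[symmetric] by (simp add: ac_simps)
  qed
  ultimately show "x \<in> ?L" using x m j by (simp add: row_contents_def)
qed

lemma card_row_contents_add_letter:
  assumes "\<And>x. x \<in># m \<Longrightarrow> x < k"
  shows "card (row_contents (m + replicate_mset c k) b) =
    (\<Sum>j | j \<le> b \<and> b \<le> j + c \<and> b + j \<le> size m. card (row_contents m j))"
proof -
  let ?g = "\<lambda>j. \<lambda>(A :: nat multiset, B :: nat multiset). (A + replicate_mset (b - j) k, B + replicate_mset (c + j - b) k)"
  have "card (row_contents (m + replicate_mset c k) b) =
      (\<Sum>j | j \<le> b \<and> b \<le> j + c \<and> b + j \<le> size m. card (?g j ` row_contents m j))"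
  proof (subst row_contents_add_letter[where m = m and k = k], rule assms, assumption, rule card_UN_disjoint)
    show "\<forall>j\<in>{j. j \<le> b \<and> b \<le> j + c \<and> b + j \<le> size m}. finite (?g j ` row_contents m j)"
      by (simp add: finite_row_contents)
    \<comment> \<open>The index \<open>j\<close> can be read off an element of the image as the
      number of letters below \<open>k\<close> in its first component, so the union is
      disjoint.\<close>
    have sz: "size (filter_mset (\<lambda>x. x < k) (fst x)) = j" if "x \<in> ?g j ` row_contents m j" for x j
    proof -
      obtain A B where "(A, B) \<in> row_contents m j" "x = ?g j (A, B)" using \<open>x \<in> _\<close> by auto
      moreover then have "filter_mset (\<lambda>x. x < k) A = A"
        using assms by (intro filter_mset_all) (auto simp: row_contents_def)
      ultimately show ?thesis by (simp add: filter_replicate_mset row_contents_def)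
    qed
    show "\<forall>i\<in>{j. j \<le> b \<and> b \<le> j + c \<and> b + j \<le> size m}. \<forall>j\<in>{j. j \<le> b \<and> b \<le> j + c \<and> b + j \<le> size m}.
        i \<noteq> j \<longrightarrow> ?g i ` row_contents m i \<inter> ?g j ` row_contents m j = {}"
    proof (intro ballI impI equals0I, elim IntE)
      fix i j x assume "i \<noteq> j" "x \<in> ?g i ` row_contents m i" "x \<in> ?g j ` row_contents m j"
      then show False using sz[of x i] sz[of x j] by simp
    qed
    show "finite {j. j \<le> b \<and> b \<le> j + c \<and> b + j \<le> size m}"
      by (rule finite_subset[of _ "{..b}"]) auto
  qed
  also have "\<dots> = (\<Sum>j | j \<le> b \<and> b \<le> j + c \<and> b + j \<le> size m. card (row_contents m j))"
    by (intro sum.cong refl card_image) (auto simp: inj_on_def)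
  finally show ?thesis .
qed

lemma coeff_mult_geometric_poly:
  "coeff (p * geometric_poly c) b = (\<Sum>j | j \<le> b \<and> b \<le> j + c. coeff p j)"
proof -
  have "coeff (p * geometric_poly c) b = (\<Sum>j\<le>b. if b \<le> j + c then coeff p j else 0)"
    unfolding coeff_mult by (rule sum.cong) (auto simp: coeff_geometric_poly)
  also have "\<dots> = (\<Sum>j | j \<in> {..b} \<and> b \<le> j + c. coeff p j)"
    by (rule sum.inter_filter[symmetric]) simp
  finally show ?thesis by simp
qed

lemma multiset_poly_add_letter:
  assumes "k \<notin># m"
  shows "multiset_poly (m + replicate_mset c k) = multiset_poly m * geometric_poly c"
proof (cases "c = 0")
  case False
  then have "set_mset (m + replicate_mset c k) = insert k (set_mset m)" by auto
  moreover have "(\<Prod>l\<in>set_mset m. geometric_poly (count (m + replicate_mset c k) l)) =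
      (\<Prod>l\<in>set_mset m. geometric_poly (count m l))"
    using assms by (intro prod.cong) auto
  ultimately show ?thesis
    using assms by (simp add: multiset_poly_def mult.commute not_in_iff)
qed (simp add: geometric_poly_0)

text \<open>The terms of the product formula that violate the bound of the recursion cancel in
  pairs, by antisymmetry of the coefficients.\<close>

lemma card_row_contents:
  assumes "2 * b \<le> size m + 1"
  shows "of_nat (card (row_contents m b)) = coeff ([:1, -1:] * multiset_poly m) b"
  using assms
proof (induction "size m" arbitrary: m b rule: less_induct)
  case less
  show ?case
  proof (cases "m = {#}")
    case True
    then have b: "b = 0" using less.prems by simp
    have "row_contents {#} 0 = {({#}, {#})}" by (auto simp: row_contents_def)
    then show ?thesis by (simp add: True b multiset_poly_def)
  next
    case False
    define k where "k = Max (set_mset m)"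
    define m' where "m' = filter_mset (\<lambda>x. x < k) m"
    define c where "c = count m k"
    have le: "x \<le> k" if "x \<in># m" for x unfolding k_def using that by (intro Max_ge) auto
    have km: "k \<in># m" unfolding k_def using False by (intro Max_in) auto
    have m: "m = m' + replicate_mset c k"
    proof (rule multiset_eqI)
      fix y show "count m y = count (m' + replicate_mset c k) y"
        using le[of y] by (cases "y \<in># m") (auto simp: m'_def c_def not_in_iff)
    qed
    have lt: "x < k" if "x \<in># m'" for x using that by (simp add: m'_def)
    let ?n = "size m'"
    have sz: "size m = ?n + c" by (simp add: m)
    have c: "c > 0" using km by (simp add: c_def)
    let ?D = "\<lambda>j. coeff ([:1, -1:] * multiset_poly m') j"
    have IH: "of_nat (card (row_contents m' j)) = ?D j" if "b + j \<le> ?n" "j \<le> b" for j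
      using that sz c by (intro less.hyps) auto
    note anti = palindromic_antisym[OF palindromic_multiset_poly[of m']]
    \<comment> \<open>The indices that violate the bound \<open>b + j \<le> ?n\<close> of the
      recursion, up to degree \<open>?n + 1\<close>. They form a window that
      \<open>j \<mapsto> ?n + 1 - j\<close> maps onto itself.\<close>
    let ?R = "{j. ?n + 1 \<le> b + j \<and> j \<le> b \<and> j \<le> ?n + 1}"
    have fin: "finite ?R" by (rule finite_subset[of _ "{..b}"]) auto
    have "(\<Sum>j\<in>?R. ?D j) = (\<Sum>j\<in>?R. ?D (?n + 1 - j))"
      by (rule sum.reindex_bij_witness[of _ "\<lambda>j. ?n + 1 - j" "\<lambda>j. ?n + 1 - j"]) auto
    also have "\<dots> = - (\<Sum>j\<in>?R. ?D j)"
      unfolding sum_negf[symmetric] by (rule sum.cong) (simp_all only: anti(1) mem_Collect_eq)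
    finally have zero: "(\<Sum>j\<in>?R. ?D j) = 0" by (rule eq_uminus_self)
    let ?J = "{j. j \<le> b \<and> b \<le> j + c \<and> b + j \<le> ?n}"
    have finJ: "finite ?J" by (rule finite_subset[of _ "{..b}"]) auto
    have "coeff ([:1, -1:] * multiset_poly m) b = coeff (([:1, -1:] * multiset_poly m') * geometric_poly c) b"
      using multiset_poly_add_letter[of k m' c] lt m by (metis less_irrefl mult.assoc)
    also have "\<dots> = (\<Sum>j | j \<le> b \<and> b \<le> j + c. ?D j)" by (rule coeff_mult_geometric_poly)
    also have "\<dots> = (\<Sum>j\<in>?J \<union> ?R. ?D j)"
    proof (rule sum.mono_neutral_right)
      \<comment> \<open>Here the bound on \<open>b\<close> enters: for \<open>j\<close> in
        \<open>?R\<close>, the difference \<open>b - j\<close> is at most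
        \<open>2 * b - (?n + 1)\<close>, hence at most \<open>c\<close>.\<close>
      show "?J \<union> ?R \<subseteq> {j. j \<le> b \<and> b \<le> j + c}" using less.prems sz by auto
      show "\<forall>i\<in>{j. j \<le> b \<and> b \<le> j + c} - (?J \<union> ?R). ?D i = 0"
      proof
        fix i assume "i \<in> {j. j \<le> b \<and> b \<le> j + c} - (?J \<union> ?R)"
        then have "i > ?n + 1" by auto
        then show "?D i = 0" by (rule anti(2))
      qed
      show "finite {j. j \<le> b \<and> b \<le> j + c}" by (rule finite_subset[of _ "{..b}"]) auto
    qed
    also have "\<dots> = (\<Sum>j\<in>?J. ?D j) + (\<Sum>j\<in>?R. ?D j)"
      using fin finJ by (intro sum.union_disjoint) auto
    also have "\<dots> = (\<Sum>j\<in>?J. of_nat (card (row_contents m' j)))"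
      unfolding zero add_0_right by (rule sum.cong) (use IH in auto)
    also have "\<dots> = of_nat (card (row_contents m b))"
      unfolding m using card_row_contents_add_letter[OF lt] by simp
    finally show ?thesis by simp
  qed
qed

text \<open>\<open>P\<close> is closed downwards, so in a sorted list the elements that satisfy it
  form a prefix.\<close>

lemma sorted_nth_iff_filter:
  fixes xs :: "'a :: linorder list"
  assumes "sorted xs" "j < length xs" "\<And>x y. P y \<Longrightarrow> x \<le> y \<Longrightarrow> P x"
  shows "P (xs ! j) \<longleftrightarrow> j < length (filter P xs)"
  using assms(1,2)
proof (induction xs arbitrary: j)
  case (Cons x xs)
  show ?case
  proof (cases "P x")
    case True
    then show ?thesis using Cons by (cases j) auto
  next
    case False
    have nP: "\<not> P y" if "y \<in> set (x # xs)" for y using that Cons.prems False assms(3) by auto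
    then have "filter P (x # xs) = []" by (auto simp: filter_empty_conv)
    moreover have "\<not> P ((x # xs) ! j)" using Cons.prems by (intro nP nth_mem)
    ultimately show ?thesis by simp
  qed
qed simp

text \<open>The letters at most \<open>k\<close> form a prefix of \<open>ys\<close>, and the letters
  below \<open>k\<close> a prefix of \<open>xs\<close>. Column strictness says that for no
  \<open>k\<close> the former is longer than the latter.\<close>

lemma column_strict_iff:
  fixes xs ys :: "nat list"
  assumes "sorted xs" "sorted ys" "length ys \<le> length xs"
  shows "(\<forall>j<length ys. xs ! j < ys ! j) \<longleftrightarrow>
    (\<forall>k. size (filter_mset (\<lambda>x. x \<le> k) (mset ys)) \<le> size (filter_mset (\<lambda>x. x < k) (mset xs)))"
proof -
  have sz: "size (filter_mset P (mset zs)) = length (filter P zs)" for P and zs :: "nat list"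
    by (simp flip: mset_filter)
  have x: "xs ! j < k \<longleftrightarrow> j < length (filter (\<lambda>x. x < k) xs)" if "j < length ys" for j k
    using that assms by (intro sorted_nth_iff_filter) auto
  have y: "ys ! j \<le> k \<longleftrightarrow> j < length (filter (\<lambda>x. x \<le> k) ys)" if "j < length ys" for j k
    using that assms by (intro sorted_nth_iff_filter) auto
  show ?thesis unfolding sz
  proof (intro iffI allI impI)
    fix k assume L: "\<forall>j<length ys. xs ! j < ys ! j"
    show "length (filter (\<lambda>x. x \<le> k) ys) \<le> length (filter (\<lambda>x. x < k) xs)"
    proof (cases "length (filter (\<lambda>x. x \<le> k) ys)")
      case (Suc j)
      have j: "j < length ys" using Suc length_filter_le[of "\<lambda>x. x \<le> k" ys] by simp
      then have "ys ! j \<le> k" using y Suc by simp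
      then have "xs ! j < k" using L j by (meson order_less_le_trans)
      then show ?thesis using x[OF j] Suc by simp
    qed simp
  next
    fix j assume R: "\<forall>k. length (filter (\<lambda>x. x \<le> k) ys) \<le> length (filter (\<lambda>x. x < k) xs)" and j: "j < length ys"
    have "j < length (filter (\<lambda>x. x \<le> ys ! j) ys)" using y[OF j, of "ys ! j"] by simp
    then have "j < length (filter (\<lambda>x. x < ys ! j) xs)" using R by (meson order_less_le_trans)
    then show "xs ! j < ys ! j" using x[OF j] by simp
  qed
qed

lemma diagram_two_rows: "diagram (two_rows a b) = Pair 0 ` {..<a} \<union> Pair 1 ` {..<b}"
  by (auto simp: diagram_def two_rows_def split: if_splits)

lemma tableau_content_two_rows:
  "image_mset T (mset_set (diagram (two_rows a b))) =
     mset (map (\<lambda>j. T (1, j)) [0..<b]) + mset (map (\<lambda>j. T (0, j)) [0..<a])"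
proof -
  have row: "image_mset T (mset_set (Pair i ` {..<c})) = mset (map (\<lambda>j. T (i, j)) [0..<c])" for i c
    by (subst image_mset_mset_set[symmetric]) (simp_all add: inj_on_def multiset.map_comp o_def lessThan_atLeast0)
  show ?thesis unfolding diagram_two_rows
    by (subst mset_set_Union) (simp_all add: row disjoint_iff image_iff)
qed

lemma semistandard_two_rows_iff:
  assumes "b \<le> a"
  shows "T \<in> semistandard_tableaux (two_rows a b) \<longleftrightarrow>
    T \<in> extensional (diagram (two_rows a b)) \<and> sorted (map (\<lambda>j. T (0, j)) [0..<a]) \<and>
    sorted (map (\<lambda>j. T (1, j)) [0..<b]) \<and> (\<forall>j<b. T (0, j) < T (1, j))"
proof -
  have cell: "(i, j) \<in> diagram (two_rows a b) \<longleftrightarrow> i = 0 \<and> j < a \<or> i = 1 \<and> j < b" for i j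
    by (auto simp: diagram_def two_rows_def)
  have srt: "sorted (map g [0..<c]) \<longleftrightarrow> (\<forall>i j. i < j \<and> j < c \<longrightarrow> g i \<le> g j)" for g :: "nat \<Rightarrow> nat" and c
    by (auto simp: sorted_iff_nth_mono_less)
  have rows: "(\<forall>i j j'. (i, j) \<in> diagram (two_rows a b) \<and> (i, j') \<in> diagram (two_rows a b) \<and> j < j' \<longrightarrow>
      T (i, j) \<le> T (i, j')) \<longleftrightarrow> (\<forall>j j'. j < j' \<and> j' < a \<longrightarrow> T (0, j) \<le> T (0, j')) \<and>
      (\<forall>j j'. j < j' \<and> j' < b \<longrightarrow> T (1, j) \<le> T (1, j'))"
    unfolding cell by (auto intro: order.strict_trans)
  have cols: "(\<forall>i i' j. (i, j) \<in> diagram (two_rows a b) \<and> (i', j) \<in> diagram (two_rows a b) \<and> i < i' \<longrightarrow>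
      T (i, j) < T (i', j)) \<longleftrightarrow> (\<forall>j<b. T (0, j) < T (1, j))"
    unfolding cell using assms by auto
  show ?thesis unfolding semistandard_tableaux_def srt mem_Collect_eq rows cols by blast
qed

lemma schur_two_rows_size_neq:
  assumes "size m \<noteq> a + b"
  shows "schur (two_rows a b) m = 0"
proof -
  have "image_mset T (mset_set (diagram (two_rows a b))) \<noteq> m" for T
    using assms unfolding tableau_content_two_rows by auto
  then show ?thesis by (simp add: schur_def)
qed

text \<open>A semistandard tableau is determined by the contents of its rows, since these are
  sorted. By \<open>column_strict_iff\<close>, the pairs of contents that occur are those in
  \<open>row_contents m b\<close>.\<close>

lemma schur_two_rows_coeff:
  assumes "size m = n" "2 * b \<le> n"
  shows "schur (two_rows (n - b) b) m = coeff ([:1, -1:] * multiset_poly m) b"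
proof -
  define a where "a = n - b"
  have ab: "b \<le> a" "a + b = n" using assms(2) by (auto simp: a_def)
  let ?l = "two_rows a b"
  let ?S = "{T \<in> semistandard_tableaux ?l. image_mset T (mset_set (diagram ?l)) = m}"
  define f where "f T = (mset (map (\<lambda>j. T (1::nat, j)) [0..<b]), mset (map (\<lambda>j. T (0::nat, j)) [0..<a]))"
    for T :: "nat \<times> nat \<Rightarrow> nat"
  define g where "g = (\<lambda>(A :: nat multiset, B :: nat multiset). restrict (\<lambda>(i :: nat, j). if i = 0 then sorted_list_of_multiset B ! j
    else sorted_list_of_multiset A ! j) (diagram ?l))"
  have cell: "(i, j) \<in> diagram ?l \<longleftrightarrow> i = 0 \<and> j < a \<or> i = 1 \<and> j < b" for i j
    by (auto simp: diagram_def two_rows_def)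
  have rows: "map (\<lambda>j. g (A, B) (1, j)) [0..<b] = sorted_list_of_multiset A"
    "map (\<lambda>j. g (A, B) (0, j)) [0..<a] = sorted_list_of_multiset B" if "size A = b" "size B = a" for A B
  proof -
    have "length (sorted_list_of_multiset A) = b" "length (sorted_list_of_multiset B) = a"
      using that by (simp_all flip: size_mset)
    then show "map (\<lambda>j. g (A, B) (1, j)) [0..<b] = sorted_list_of_multiset A"
      "map (\<lambda>j. g (A, B) (0, j)) [0..<a] = sorted_list_of_multiset B"
      by (auto intro!: nth_equalityI simp: g_def cell)
  qed
  have szB: "size B = a" if "(A, B) \<in> row_contents m b" for A B
    using that assms(1) ab(2) by (auto simp: row_contents_def)
  have "bij_betw f ?S (row_contents m b)"
  proof (rule bij_betw_byWitness[where f' = g])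
    show "\<forall>T\<in>?S. g (f T) = T"
    proof
      fix T assume T: "T \<in> ?S"
      then have s: "T \<in> extensional (diagram ?l)" "sorted (map (\<lambda>j. T (0, j)) [0..<a])"
        "sorted (map (\<lambda>j. T (1, j)) [0..<b])" by (simp_all add: semistandard_two_rows_iff ab)
      have "sorted_list_of_multiset (mset (map (\<lambda>j. T (0, j)) [0..<a])) = map (\<lambda>j. T (0, j)) [0..<a]"
        "sorted_list_of_multiset (mset (map (\<lambda>j. T (1, j)) [0..<b])) = map (\<lambda>j. T (1, j)) [0..<b]"
        using s by (simp_all add: sorted_list_of_multiset_mset sorted_sort_id del: mset_map)
      then have g: "g (f T) = restrict (\<lambda>(i, j). if i = 0 then map (\<lambda>j. T (0, j)) [0..<a] ! j
          else map (\<lambda>j. T (1, j)) [0..<b] ! j) (diagram ?l)" by (simp only: f_def g_def split_conv)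
      show "g (f T) = T"
      proof
        fix x show "g (f T) x = T x"
          using s(1) unfolding g by (cases x) (auto simp: cell extensional_def)
      qed
    qed
    show "\<forall>x\<in>row_contents m b. f (g x) = x"
    proof
      fix x assume x: "x \<in> row_contents m b"
      obtain A B where AB: "x = (A, B)" by (cases x)
      have "size A = b" using x AB by (simp add: row_contents_def)
      moreover have "size B = a" using szB[of A B] x AB by simp
      ultimately show "f (g x) = x" unfolding f_def AB rows[of A B] by (simp only: rows mset_sorted_list_of_multiset)
    qed
    show "f ` ?S \<subseteq> row_contents m b"
    proof
      fix x assume "x \<in> f ` ?S"
      then obtain T where T: "T \<in> semistandard_tableaux ?l" "image_mset T (mset_set (diagram ?l)) = m" "x = f T"
        by blast
      let ?xs = "map (\<lambda>j. T (0, j)) [0..<a]" and ?ys = "map (\<lambda>j. T (1, j)) [0..<b]"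
      have s: "sorted ?xs" "sorted ?ys" "\<forall>j<b. T (0, j) < T (1, j)"
        using T(1) by (simp_all add: semistandard_two_rows_iff ab)
      have "\<forall>j<length ?ys. ?xs ! j < ?ys ! j" using s(3) ab by auto
      then have "\<forall>k. size (filter_mset (\<lambda>x. x \<le> k) (mset ?ys)) \<le> size (filter_mset (\<lambda>x. x < k) (mset ?xs))"
        using column_strict_iff[OF s(1,2)] ab by simp
      moreover have "mset ?ys + mset ?xs = m" using T(2) unfolding tableau_content_two_rows .
      moreover have "size (mset ?ys) = b" by simp
      ultimately show "x \<in> row_contents m b" unfolding T(3) f_def row_contents_def by blast
    qed
    show "g ` row_contents m b \<subseteq> ?S"
    proof
      fix T assume "T \<in> g ` row_contents m b"
      then obtain A B where AB: "(A, B) \<in> row_contents m b" "T = g (A, B)" by auto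
      have sz: "size A = b" "size B = a" "A + B = m"
        using szB[OF AB(1)] AB(1) by (simp_all add: row_contents_def)
      let ?xs = "sorted_list_of_multiset B" and ?ys = "sorted_list_of_multiset A"
      have r: "map (\<lambda>j. T (0, j)) [0..<a] = ?xs" "map (\<lambda>j. T (1, j)) [0..<b] = ?ys"
        using rows[OF sz(1,2)] AB(2) by simp_all
      have len: "length ?ys = b" "length ?xs = a" using sz by (simp_all flip: size_mset)
      have "\<forall>k. size (filter_mset (\<lambda>x. x \<le> k) (mset ?ys)) \<le> size (filter_mset (\<lambda>x. x < k) (mset ?xs))"
        using AB(1) by (simp add: row_contents_def)
      then have lt: "\<forall>j<b. ?xs ! j < ?ys ! j"
        using column_strict_iff[of ?xs ?ys] len ab by simp
      have "T (0, j) < T (1, j)" if "j < b" for j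
      proof -
        have "?xs ! j = T (0, j)" unfolding r(1)[symmetric] using that ab by simp
        moreover have "?ys ! j = T (1, j)" unfolding r(2)[symmetric] using that by simp
        ultimately show ?thesis using lt that by metis
      qed
      moreover have "T \<in> extensional (diagram ?l)" by (simp add: AB(2) g_def)
      ultimately have "T \<in> semistandard_tableaux ?l"
        unfolding semistandard_two_rows_iff[OF ab(1)] r by (intro conjI allI impI) simp_all
      moreover have "image_mset T (mset_set (diagram ?l)) = m"
        unfolding tableau_content_two_rows r using sz(3) by simp
      ultimately show "T \<in> ?S" by simp
    qed
  qed
  then have "card ?S = card (row_contents m b)" by (rule bij_betw_same_card)
  then show ?thesis using card_row_contents[of b m] assms by (simp add: schur_def a_def)
qed

section \<open>Traces on subspaces of a function space\<close>

interpretation cfun_pair: vector_space_pair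
  "cscale :: complex \<Rightarrow> ('a \<Rightarrow> complex) \<Rightarrow> 'a \<Rightarrow> complex"
  "cscale :: complex \<Rightarrow> ('b \<Rightarrow> complex) \<Rightarrow> 'b \<Rightarrow> complex" ..

definition clinear :: "(('a \<Rightarrow> complex) \<Rightarrow> 'b \<Rightarrow> complex) \<Rightarrow> bool"
  where "clinear f \<longleftrightarrow> (\<forall>v w. f (v + w) = f v + f w) \<and> (\<forall>c v. f (cscale c v) = cscale c (f v))"

lemma clinear_iff: "clinear f \<longleftrightarrow> Vector_Spaces.linear cscale cscale f"
  unfolding clinear_def Vector_Spaces.linear_iff by (simp add: cfun.vector_space_axioms)

lemma clinear_add: "clinear f \<Longrightarrow> f (v + w) = f v + f w"
  and clinear_scale: "clinear f \<Longrightarrow> f (cscale c v) = cscale c (f v)"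
  by (simp_all add: clinear_def)

lemma clinear_0: "clinear f \<Longrightarrow> f 0 = 0"
  using clinear_scale[of f 0 0] by (simp only: cfun.scale_zero_left)

lemma clinear_sum: "clinear f \<Longrightarrow> f (sum g A) = (\<Sum>a\<in>A. f (g a))"
  by (induction A rule: infinite_finite_induct)
     (simp_all only: sum.infinite sum.empty sum.insert clinear_add clinear_0 if_False not_False_eq_True)

lemma cscale_apply: "cscale c v x = c * v x"
  by (simp add: cscale_def)

definition delta :: "'a \<Rightarrow> 'a \<Rightarrow> complex"
  where "delta x = (\<lambda>y. of_bool (y = x))"

definition functions_on :: "'a set \<Rightarrow> ('a \<Rightarrow> complex) set"
  where "functions_on X = {v. \<forall>x. x \<notin> X \<longrightarrow> v x = 0}"

lemma subspace_functions_on: "cfun.subspace (functions_on X)"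
  by (rule cfun.subspaceI) (auto simp: functions_on_def cscale_def)

lemma functions_on_expand:
  assumes "finite X" "v \<in> functions_on X"
  shows "v = (\<Sum>x\<in>X. cscale (v x) (delta x))"
proof
  fix y
  have "(\<Sum>x\<in>X. cscale (v x) (delta x)) y = (\<Sum>x\<in>X. if x = y then v y else 0)"
    unfolding sum_fun_apply by (rule sum.cong) (auto simp: cscale_def delta_def)
  also have "\<dots> = v y" using assms by (simp add: functions_on_def)
  finally show "v y = (\<Sum>x\<in>X. cscale (v x) (delta x)) y" by simp
qed

lemma span_clinear_image:
  assumes "clinear f" "f ` S \<subseteq> cfun.span T" "v \<in> cfun.span S"
  shows "f v \<in> cfun.span T"
  using assms(3)
proof (induction rule: cfun.span_induct_alt)
  case base
  then show ?case by (simp only: clinear_0[OF assms(1)] cfun.span_zero)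
next
  case (step c x y)
  then have "cscale c (f x) + f y \<in> cfun.span T"
    using assms(2) by (intro cfun.span_add cfun.span_scale) auto
  then show ?case by (simp only: clinear_add[OF assms(1)] clinear_scale[OF assms(1)])
qed

text \<open>\<open>trace_on\<close> selects its basis by \<open>SOME\<close>. The choice is an
  actual basis because one exists, and it is finite because \<open>V\<close> lies in a space with
  finitely many coordinates.\<close>

lemma basis_of_subspace:
  assumes "finite X" "V \<subseteq> functions_on X" "cfun.subspace V"
  defines "B \<equiv> SOME B. cfun.independent B \<and> cfun.span B = V"
  shows "cfun.independent B" "cfun.span B = V" "finite B"
proof -
  obtain C where C: "C \<subseteq> V" "cfun.independent C" "V \<subseteq> cfun.span C"
    using cfun.maximal_independent_subset by blast
  then have "cfun.span C = V" using assms(3) by (metis cfun.span_minimal subset_antisym)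
  then have "\<exists>B. cfun.independent B \<and> cfun.span B = V" using C(2) by blast
  then have B: "cfun.independent B \<and> cfun.span B = V" unfolding B_def by (rule someI_ex)
  then show "cfun.independent B" "cfun.span B = V" by simp_all
  have "functions_on X \<subseteq> cfun.span (delta ` X)"
  proof
    fix v assume v: "v \<in> functions_on X"
    have "(\<Sum>x\<in>X. cscale (v x) (delta x)) \<in> cfun.span (delta ` X)"
      by (intro cfun.span_sum cfun.span_scale cfun.span_base) auto
    then show "v \<in> cfun.span (delta ` X)" using functions_on_expand[OF assms(1) v] by simp
  qed
  moreover have "B \<subseteq> functions_on X" using B assms(2) cfun.span_superset by blast
  ultimately show "finite B"
    using cfun.independent_span_bound[of "delta ` X" B] B assms(1) by auto
qed

text \<open>The map \<open>f \<circ> P\<close> has its range in \<open>V\<close> and agrees with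
  \<open>f\<close> there, so the trace on \<open>V\<close> is its trace in the coordinates
  \<open>delta x\<close>. The chosen basis no longer appears.\<close>

lemma trace_on_eq:
  assumes X: "finite X" "V \<subseteq> functions_on X" and V: "cfun.subspace V"
    and f: "clinear f" "f ` V \<subseteq> V"
    and P: "clinear P" "range P \<subseteq> V" "\<And>v. v \<in> V \<Longrightarrow> P v = v"
  shows "trace_on V f = (\<Sum>x\<in>X. f (P (delta x)) x)"
proof -
  define B where "B = (SOME B. cfun.independent B \<and> cfun.span B = V)"
  note B = basis_of_subspace[OF X V, folded B_def]
  have inV: "f (P v) \<in> cfun.span B" for v using f(2) P(2) B(2) by blast
  have rep: "cfun.representation B (f b) b = (\<Sum>x\<in>X. b x * cfun.representation B (f (P (delta x))) b)"
    if b: "b \<in> B" for b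
  proof -
    have bV: "b \<in> V" using b B(2) cfun.span_base by blast
    have "b \<in> functions_on X" using bV X(2) by blast
    from functions_on_expand[OF X(1) this]
    have "f (P b) = f (P (\<Sum>x\<in>X. cscale (b x) (delta x)))" by simp
    also have "\<dots> = (\<Sum>x\<in>X. cscale (b x) (f (P (delta x))))"
      by (simp add: clinear_sum[OF P(1)] clinear_sum[OF f(1)] clinear_scale[OF P(1)] clinear_scale[OF f(1)])
    finally have "f b = (\<Sum>x\<in>X. cscale (b x) (f (P (delta x))))" using P(3)[OF bV] by simp
    then show ?thesis
      using inV by (simp add: cfun.representation_sum[OF B(1)] cfun.span_scale cfun.representation_scale[OF B(1)])
  qed
  have "trace_on V f = (\<Sum>b\<in>B. cfun.representation B (f b) b)"
    by (simp add: trace_on_def B_def Let_def)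
  also have "\<dots> = (\<Sum>b\<in>B. \<Sum>x\<in>X. b x * cfun.representation B (f (P (delta x))) b)"
    by (rule sum.cong) (simp_all add: rep)
  also have "\<dots> = (\<Sum>x\<in>X. \<Sum>b\<in>B. b x * cfun.representation B (f (P (delta x))) b)"
    by (rule sum.swap)
  also have "\<dots> = (\<Sum>x\<in>X. f (P (delta x)) x)"
  proof (rule sum.cong)
    fix x
    have "(\<Sum>b\<in>B. b x * cfun.representation B (f (P (delta x))) b) =
        (\<Sum>b\<in>B. cscale (cfun.representation B (f (P (delta x))) b) b) x"
      by (simp add: sum_fun_apply cscale_def mult.commute)
    also have "(\<Sum>b\<in>B. cscale (cfun.representation B (f (P (delta x))) b) b) = f (P (delta x))"
      by (rule cfun.sum_representation_eq[OF B(1) inV B(3)]) simp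
    finally show "(\<Sum>b\<in>B. b x * cfun.representation B (f (P (delta x))) b) = f (P (delta x)) x" .
  qed simp
  finally show ?thesis .
qed

lemma projection_exists:
  fixes V :: "('a \<Rightarrow> complex) set"
  assumes "finite X" "V \<subseteq> functions_on X" "cfun.subspace V"
  shows "\<exists>P :: ('a \<Rightarrow> complex) \<Rightarrow> 'a \<Rightarrow> complex. clinear P \<and> range P \<subseteq> V \<and> (\<forall>v\<in>V. P v = v)"
proof -
  define B where "B = (SOME B. cfun.independent B \<and> cfun.span B = V)"
  note B = basis_of_subspace[OF assms, folded B_def]
  define P :: "('a \<Rightarrow> complex) \<Rightarrow> 'a \<Rightarrow> complex" where "P = cfun_pair.construct B (\<lambda>b. b)"
  have lin: "Vector_Spaces.linear cscale cscale P" unfolding P_def by (rule cfun_pair.linear_construct[OF B(1)])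
  moreover have "range P \<subseteq> V" using cfun_pair.construct_in_span[OF B(1), of "\<lambda>b. b"] B(2)
    by (auto simp: P_def)
  moreover have "P v = v" if "v \<in> V" for v
  proof -
    have "v \<in> cfun.span B" using that B(2) by simp
    then show ?thesis
    proof (induction rule: cfun.span_induct_alt)
      case base
      show ?case using clinear_0[of P] lin by (simp only: clinear_iff)
    next
      case (step c x y)
      have "P x = x" unfolding P_def by (rule cfun_pair.construct_basis[OF B(1) step(1)])
      then show ?case
        by (simp only: clinear_add[OF lin[folded clinear_iff]] clinear_scale[OF lin[folded clinear_iff]] step(2))
    qed
  qed
  ultimately show ?thesis unfolding clinear_iff by blast
qed

text \<open>With one projection for all \<open>f i\<close>, every trace becomes the same coordinate
  sum, which is linear in the map.\<close>

lemma trace_on_linear_combination: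
  assumes X: "finite X" "V \<subseteq> functions_on X" and V: "cfun.subspace V"
    and f: "\<And>i. i \<in> I \<Longrightarrow> clinear (f i)" "\<And>i. i \<in> I \<Longrightarrow> f i ` V \<subseteq> V"
  shows "trace_on V (\<lambda>v. \<Sum>i\<in>I. cscale (c i) (f i v)) = (\<Sum>i\<in>I. c i * trace_on V (f i))"
proof -
  obtain P :: "('a \<Rightarrow> complex) \<Rightarrow> 'a \<Rightarrow> complex" where P: "clinear P" "range P \<subseteq> V" "\<And>v. v \<in> V \<Longrightarrow> P v = v"
    using projection_exists[OF X V] by blast
  let ?g = "\<lambda>v. \<Sum>i\<in>I. cscale (c i) (f i v)"
  have "clinear ?g"
    using f(1) unfolding clinear_def
    by (simp add: cfun.scale_right_distrib sum.distrib cfun.scale_sum_right mult.commute)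
  moreover have "?g ` V \<subseteq> V"
    using f(2) by (auto intro!: cfun.subspace_sum[OF V] cfun.subspace_scale[OF V])
  ultimately have "trace_on V ?g = (\<Sum>x\<in>X. ?g (P (delta x)) x)"
    by (rule trace_on_eq[OF X V _ _ P])
  also have "\<dots> = (\<Sum>i\<in>I. c i * (\<Sum>x\<in>X. f i (P (delta x)) x))"
    unfolding sum_fun_apply cscale_apply sum_distrib_left by (rule sum.swap)
  also have "\<dots> = (\<Sum>i\<in>I. c i * trace_on V (f i))"
    by (rule sum.cong) (simp_all add: trace_on_eq[OF X V f P])
  finally show ?thesis .
qed

lemma trace_on_zero:
  assumes "finite X" "V \<subseteq> functions_on X" "cfun.subspace V" "clinear f" "\<And>v. v \<in> V \<Longrightarrow> f v = 0"
  shows "trace_on V f = 0"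
proof -
  obtain P :: "('a \<Rightarrow> complex) \<Rightarrow> 'a \<Rightarrow> complex" where P: "clinear P" "range P \<subseteq> V" "\<And>v. v \<in> V \<Longrightarrow> P v = v"
    using projection_exists[OF assms(1-3)] by blast
  have "f ` V \<subseteq> V" using assms(5) cfun.subspace_0[OF assms(3)] by auto
  then have "trace_on V f = (\<Sum>x\<in>X. f (P (delta x)) x)"
    by (intro trace_on_eq assms P)
  also have "\<dots> = 0" using assms(5) P(2) by (intro sum.neutral) (auto simp: image_subset_iff)
  finally show ?thesis .
qed

text \<open>A nonzero multiple of an idempotent has nonzero trace: the trace of an idempotent is the
  dimension of its image.\<close>

lemma trace_on_quasi_idempotent_nonzero:
  assumes X: "finite X" "V \<subseteq> functions_on X" and V: "cfun.subspace V"
    and f: "clinear f" "f ` V \<subseteq> V" "\<And>v. v \<in> V \<Longrightarrow> f (f v) = cscale c (f v)"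
    and c: "c \<noteq> 0" and e: "e \<in> V" "f e \<noteq> 0"
  shows "trace_on V f \<noteq> 0"
proof -
  obtain P :: "('a \<Rightarrow> complex) \<Rightarrow> 'a \<Rightarrow> complex" where P: "clinear P" "range P \<subseteq> V" "\<And>v. v \<in> V \<Longrightarrow> P v = v"
    using projection_exists[OF X V] by blast
  define W where "W = f ` V"
  \<comment> \<open>\<open>Q\<close> is a projection onto the image \<open>W\<close> of
    \<open>f\<close>, so its coordinate trace is the trace of the identity on \<open>W\<close>, that
    is, the dimension of \<open>W\<close>.\<close>
  define Q where "Q v = cscale (1 / c) (f (P v))" for v
  have W: "W \<subseteq> functions_on X" "cfun.subspace W"
  proof -
    show "W \<subseteq> functions_on X" using f(2) X(2) by (auto simp: W_def)
    show "cfun.subspace W"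
    proof (rule cfun.subspaceI)
      have "f 0 \<in> W" unfolding W_def using cfun.subspace_0[OF V] by (rule imageI)
      then show "0 \<in> W" by (simp only: clinear_0[OF f(1)])
    next
      fix x y assume "x \<in> W" "y \<in> W"
      then obtain v w where vw: "v \<in> V" "w \<in> V" "x = f v" "y = f w" unfolding W_def by blast
      have "f (v + w) \<in> W" unfolding W_def using cfun.subspace_add[OF V vw(1,2)] by (rule imageI)
      then show "x + y \<in> W" by (simp only: clinear_add[OF f(1)] vw(3,4))
    next
      fix a x assume "x \<in> W"
      then obtain v where v: "v \<in> V" "x = f v" unfolding W_def by blast
      have "f (cscale a v) \<in> W" unfolding W_def using cfun.subspace_scale[OF V v(1)] by (rule imageI)
      then show "cscale a x \<in> W" by (simp only: clinear_scale[OF f(1)] v(2))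
    qed
  qed
  have "clinear Q"
    using P(1) f(1) unfolding clinear_def Q_def by (simp add: cfun.scale_right_distrib mult.commute)
  moreover have "range Q \<subseteq> W" using P(2) cfun.subspace_scale[OF W(2)] by (auto simp: Q_def W_def)
  moreover have "Q w = w" if w: "w \<in> W" for w
  proof -
    obtain v where v: "v \<in> V" "w = f v" using w by (auto simp: W_def)
    then have "P w = w" using P(3) f(2) by auto
    then show ?thesis using f(3)[OF v(1)] c v(2) by (simp add: Q_def)
  qed
  moreover have "clinear (\<lambda>v :: 'a \<Rightarrow> complex. v)" by (simp add: clinear_def)
  ultimately have tr: "trace_on W (\<lambda>v. v) = (\<Sum>x\<in>X. Q (delta x) x)"
    by (intro trace_on_eq[OF X(1) W]) auto
  define B where "B = (SOME B. cfun.independent B \<and> cfun.span B = W)"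
  note B = basis_of_subspace[OF X(1) W, folded B_def]
  have "trace_on W (\<lambda>v. v) = (\<Sum>b\<in>B. cfun.representation B b b)"
    by (simp add: trace_on_def B_def Let_def)
  also have "\<dots> = of_nat (card B)" by (simp add: cfun.representation_basis[OF B(1)])
  finally have "(\<Sum>x\<in>X. Q (delta x) x) = of_nat (card B)" using tr by simp
  moreover have "B \<noteq> {}"
  proof
    assume "B = {}"
    then have "W = {0}" using B(2) by simp
    then show False using e by (auto simp: W_def)
  qed
  ultimately have "(\<Sum>x\<in>X. Q (delta x) x) \<noteq> 0" using B(3) by simp
  moreover have "(\<Sum>x\<in>X. Q (delta x) x) = (1 / c) * trace_on V f"
    using trace_on_eq[OF X V f(1,2) P] by (simp add: Q_def cscale_apply sum_divide_distrib)
  ultimately show ?thesis by auto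
qed

section \<open>Tabloids and Specht modules\<close>

lemma clinear_perm_action: "clinear (perm_action \<sigma>)"
  by (simp add: clinear_def perm_action_def cscale_def fun_eq_iff)

lemma perm_action_comp: "perm_action \<sigma> (perm_action \<tau> v) = perm_action (\<sigma> \<circ> \<tau>) v"
  by (simp add: perm_action_def o_assoc)

lemma perm_action_delta:
  assumes "\<sigma> permutes S"
  shows "perm_action \<sigma> (delta t) = delta (t \<circ> inv \<sigma>)"
proof -
  have "s \<circ> \<sigma> = t \<longleftrightarrow> s = t \<circ> inv \<sigma>" for s :: "nat \<Rightarrow> nat"
    using permutes_inv_o[OF assms] by (metis comp_assoc comp_id)
  then show ?thesis by (simp add: perm_action_def delta_def)
qed

lemma tableaux_comp:
  assumes "T \<in> tableaux n l" "\<pi> permutes {1..n}"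
  shows "T \<circ> \<pi> \<in> tableaux n l"
proof -
  have "T \<circ> \<pi> \<in> extensional {1..n}"
    using assms by (auto simp: tableaux_def extensional_def permutes_not_in)
  moreover have "bij_betw (T \<circ> \<pi>) {1..n} (diagram l)"
    using assms by (auto simp: tableaux_def intro: bij_betw_trans permutes_imp_bij)
  ultimately show ?thesis by (simp add: tableaux_def)
qed

lemma tabloid_comp:
  assumes "\<pi> permutes {1..n}"
  shows "tabloid n (T \<circ> \<pi>) = tabloid n T \<circ> \<pi>"
proof
  fix x
  have "\<pi> x \<in> {1..n} \<longleftrightarrow> x \<in> {1..n}" using assms by (rule permutes_in_image)
  then show "tabloid n (T \<circ> \<pi>) x = (tabloid n T \<circ> \<pi>) x"
    by (simp add: tabloid_def)
qed

definition tabloids :: "nat \<Rightarrow> (nat \<Rightarrow> nat) \<Rightarrow> (nat \<Rightarrow> nat) set"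
  where "tabloids n l = tabloid n ` tableaux n l"

text \<open>For the last claim: a nonzero part at index \<open>i\<close> forces \<open>i + 1\<close>
  nonzero parts, whose sum is at least \<open>i + 1\<close>.\<close>

lemma partition_diagram:
  assumes "l \<in> partitions_of n"
  shows "finite (diagram l)" "card (diagram l) = n" "\<And>i. i \<ge> n \<Longrightarrow> l i = 0"
proof -
  have l: "antimono l" "finite {i. l i \<noteq> 0}" "(\<Sum>i | l i \<noteq> 0. l i) = n"
    using assms by (auto simp: partitions_of_def)
  have d: "diagram l = Sigma {i. l i \<noteq> 0} (\<lambda>i. {..<l i})"
    by (auto simp: diagram_def)
  show "finite (diagram l)" unfolding d using l(2) by simp
  show "card (diagram l) = n" unfolding d using l(2,3) by simp
  show "l i = 0" if "i \<ge> n" for i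
  proof (rule ccontr)
    assume i: "l i \<noteq> 0"
    have "{..i} \<subseteq> {i. l i \<noteq> 0}"
    proof
      fix j assume "j \<in> {..i}"
      then have "l i \<le> l j" using l(1) by (simp add: antimono_def)
      then show "j \<in> {i. l i \<noteq> 0}" using i by simp
    qed
    then have "card {..i} \<le> card {i. l i \<noteq> 0}" by (rule card_mono[OF l(2)])
    also have "\<dots> = (\<Sum>i | l i \<noteq> 0. 1)" by simp
    also have "\<dots> \<le> (\<Sum>i | l i \<noteq> 0. l i)" by (rule sum_mono) auto
    finally show False using l(3) that by simp
  qed
qed

lemma tableaux_nonempty:
  assumes "l \<in> partitions_of n"
  shows "tableaux n l \<noteq> {}"
proof -
  have "card {1..n} = card (diagram l)" using partition_diagram(2)[OF assms] by simp
  then obtain T where T: "bij_betw T {1..n} (diagram l)"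
    using finite_same_card_bij[of "{1..n}" "diagram l"] partition_diagram(1)[OF assms] by auto
  have "bij_betw (restrict T {1..n}) {1..n} (diagram l)"
    using T by (subst bij_betw_cong[of _ _ T]) auto
  then have "restrict T {1..n} \<in> tableaux n l" by (simp add: tableaux_def)
  then show ?thesis by blast
qed

lemma finite_tabloids:
  assumes "l \<in> partitions_of n"
  shows "finite (tabloids n l)"
proof -
  have "tableaux n l \<subseteq> {1..n} \<rightarrow>\<^sub>E diagram l"
    by (auto simp: tableaux_def bij_betw_def PiE_def)
  then have "finite (tableaux n l)"
    by (rule finite_subset) (simp add: finite_PiE partition_diagram(1)[OF assms])
  then show ?thesis by (simp add: tabloids_def)
qed

section \<open>Column stabilizers and antisymmetrizers\<close>

lemma finite_column_stabilizer: "finite (column_stabilizer n T)"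
  by (rule finite_subset[of _ "{\<pi>. \<pi> permutes {1..n}}"])
     (auto simp: column_stabilizer_def finite_permutations)

lemma column_stabilizer_permutes: "\<pi> \<in> column_stabilizer n T \<Longrightarrow> \<pi> permutes {1..n}"
  by (simp add: column_stabilizer_def)

lemma column_stabilizer_id: "id \<in> column_stabilizer n T"
  by (simp add: column_stabilizer_def permutes_id)

lemma column_stabilizer_comp:
  assumes "\<pi> \<in> column_stabilizer n T" "\<rho> \<in> column_stabilizer n T"
  shows "\<pi> \<circ> \<rho> \<in> column_stabilizer n T"
proof -
  have p: "\<pi> permutes {1..n}" "\<rho> permutes {1..n}" using assms by (simp_all add: column_stabilizer_def)
  have "snd (T ((\<pi> \<circ> \<rho>) x)) = snd (T x)" if "x \<in> {1..n}" for x
  proof -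
    have "\<rho> x \<in> {1..n}" using permutes_in_image[OF p(2)] that by simp
    then show ?thesis using assms that by (simp add: column_stabilizer_def)
  qed
  then show ?thesis using permutes_compose[OF p(2,1)] by (simp add: column_stabilizer_def)
qed

lemma column_stabilizer_inv:
  assumes "\<pi> \<in> column_stabilizer n T"
  shows "inv \<pi> \<in> column_stabilizer n T"
proof -
  have p: "\<pi> permutes {1..n}" using assms by (simp add: column_stabilizer_def)
  have "snd (T (inv \<pi> x)) = snd (T x)" if "x \<in> {1..n}" for x
  proof -
    have "inv \<pi> x \<in> {1..n}" using permutes_in_image[OF permutes_inv[OF p]] that by simp
    then have "snd (T (\<pi> (inv \<pi> x))) = snd (T (inv \<pi> x))" using assms by (simp add: column_stabilizer_def)
    then show ?thesis by (simp add: permutes_inverses[OF p])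
  qed
  then show ?thesis using permutes_inv[OF p] by (simp add: column_stabilizer_def)
qed

text \<open>The signed column sum of the group algebra, often written kappa_T, as an operator on
  functions. It can also be applied to tabloids of a shape other than that of \<open>T\<close>,
  which is how different shapes are compared.\<close>

definition column_antisymmetrizer :: "nat \<Rightarrow> (nat \<Rightarrow> nat \<times> nat) \<Rightarrow> ((nat \<Rightarrow> nat) \<Rightarrow> complex) \<Rightarrow> (nat \<Rightarrow> nat) \<Rightarrow> complex"
  where "column_antisymmetrizer n T v =
    (\<Sum>\<pi>\<in>column_stabilizer n T. cscale (of_int (sign \<pi>)) (perm_action \<pi> v))"

lemma clinear_column_antisymmetrizer: "clinear (column_antisymmetrizer n T)"
  unfolding clinear_def column_antisymmetrizer_def
  by (simp add: clinear_add[OF clinear_perm_action] clinear_scale[OF clinear_perm_action]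
      cfun.scale_right_distrib sum.distrib cfun.scale_sum_right mult.commute)

lemma polytabloid_eq: "polytabloid n T = column_antisymmetrizer n T (delta (tabloid n T))"
proof
  fix t
  have "perm_action \<pi> (delta (tabloid n T)) t = of_bool (t = tabloid n (T \<circ> inv \<pi>))"
    if "\<pi> \<in> column_stabilizer n T" for \<pi>
    using perm_action_delta[of \<pi> "{1..n}"] tabloid_comp[of "inv \<pi>" n T] column_stabilizer_permutes[OF that]
    by (simp add: delta_def permutes_inv)
  then show "polytabloid n T t = column_antisymmetrizer n T (delta (tabloid n T)) t"
    unfolding polytabloid_def column_antisymmetrizer_def sum_fun_apply cscale_apply
    by (intro sum.cong) auto
qed

lemma column_antisymmetrizer_shift:
  assumes "\<tau> \<in> column_stabilizer n T"
  shows "column_antisymmetrizer n T (perm_action \<tau> v) = cscale (of_int (sign \<tau>)) (column_antisymmetrizer n T v)"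
proof -
  let ?C = "column_stabilizer n T"
  have tau: "\<tau> permutes {1..n}" by (rule column_stabilizer_permutes[OF assms])
  have "column_antisymmetrizer n T (perm_action \<tau> v) =
      (\<Sum>\<pi>\<in>?C. cscale (of_int (sign \<pi>)) (perm_action (\<pi> \<circ> \<tau>) v))"
    by (simp add: column_antisymmetrizer_def perm_action_comp)
  also have "\<dots> = (\<Sum>\<rho>\<in>?C. cscale (of_int (sign (\<rho> \<circ> inv \<tau>))) (perm_action \<rho> v))"
  proof (rule sum.reindex_bij_witness[of _ "\<lambda>\<rho>. \<rho> \<circ> inv \<tau>" "\<lambda>\<pi>. \<pi> \<circ> \<tau>"])
    show "\<pi> \<circ> \<tau> \<circ> inv \<tau> = \<pi>" "\<pi> \<circ> inv \<tau> \<circ> \<tau> = \<pi>" for \<pi> :: "nat \<Rightarrow> nat"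
      by (simp_all add: comp_assoc permutes_inv_o[OF tau])
    then show "cscale (of_int (sign (\<pi> \<circ> \<tau> \<circ> inv \<tau>))) (perm_action (\<pi> \<circ> \<tau>) v) =
       cscale (of_int (sign \<pi>)) (perm_action (\<pi> \<circ> \<tau>) v)" for \<pi> by simp
  qed (use assms column_stabilizer_comp column_stabilizer_inv in auto)
  also have "\<dots> = (\<Sum>\<rho>\<in>?C. cscale (of_int (sign \<tau>)) (cscale (of_int (sign \<rho>)) (perm_action \<rho> v)))"
  proof (rule sum.cong)
    fix \<rho> assume "\<rho> \<in> ?C"
    then have "permutation \<rho>" "permutation (inv \<tau>)" "permutation \<tau>"
      using column_stabilizer_permutes permutes_inv[OF tau] tau
      by (auto simp: permutation_permutes intro: finite_atLeastAtMost)
    then show "cscale (of_int (sign (\<rho> \<circ> inv \<tau>))) (perm_action \<rho> v) =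
        cscale (of_int (sign \<tau>)) (cscale (of_int (sign \<rho>)) (perm_action \<rho> v))"
      by (simp add: sign_compose sign_inverse mult.commute)
  qed simp
  also have "\<dots> = cscale (of_int (sign \<tau>)) (column_antisymmetrizer n T v)"
    by (simp add: column_antisymmetrizer_def cfun.scale_sum_right)
  finally show ?thesis .
qed

lemma column_antisymmetrizer_square:
  "column_antisymmetrizer n T (column_antisymmetrizer n T v) =
     cscale (of_nat (card (column_stabilizer n T))) (column_antisymmetrizer n T v)"
proof -
  let ?k = "column_antisymmetrizer n T"
  have "?k (?k v) = (\<Sum>\<tau>\<in>column_stabilizer n T. cscale (of_int (sign \<tau>)) (?k (perm_action \<tau> v)))"
    by (simp add: column_antisymmetrizer_def[of n T v] clinear_sum[OF clinear_column_antisymmetrizer]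
        clinear_scale[OF clinear_column_antisymmetrizer])
  also have "\<dots> = (\<Sum>\<tau>\<in>column_stabilizer n T. ?k v)"
  proof (rule sum.cong)
    fix \<tau> assume "\<tau> \<in> column_stabilizer n T"
    moreover have "of_int (sign \<tau>) * of_int (sign \<tau>) = (1 :: complex)"
      by (simp add: sign_def)
    ultimately show "cscale (of_int (sign \<tau>)) (?k (perm_action \<tau> v)) = ?k v"
      by (simp add: column_antisymmetrizer_shift)
  qed simp
  also have "\<dots> = cscale (of_nat (card (column_stabilizer n T))) (?k v)"
    by (simp add: fun_eq_iff sum_fun_apply cscale_apply)
  finally show ?thesis .
qed

text \<open>The transposition of \<open>x\<close> and \<open>y\<close> lies in the column stabilizer
  and fixes \<open>t\<close>, so the result equals its own negative.\<close>

lemma column_antisymmetrizer_kills: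
  assumes xy: "x \<in> {1..n}" "y \<in> {1..n}" "x \<noteq> y" "snd (T x) = snd (T y)" and t: "t x = t y"
  shows "column_antisymmetrizer n T (delta t) = 0"
proof -
  let ?\<tau> = "transpose x y"
  have p: "?\<tau> permutes {1..n}" using xy by (simp add: permutes_swap_id)
  have "?\<tau> \<in> column_stabilizer n T"
    using p xy by (auto simp: column_stabilizer_def transpose_def)
  moreover have "t \<circ> inv ?\<tau> = t" using t by (auto simp: fun_eq_iff transpose_def)
  ultimately have "column_antisymmetrizer n T (delta t) =
      cscale (of_int (sign ?\<tau>)) (column_antisymmetrizer n T (delta t))"
    using column_antisymmetrizer_shift[of ?\<tau> n T "delta t"] perm_action_delta[OF p, of t] by simp
  also have "\<dots> = - column_antisymmetrizer n T (delta t)"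
    using xy(3) by (simp add: sign_swap_id)
  finally have "column_antisymmetrizer n T (delta t) s = - column_antisymmetrizer n T (delta t) s" for s
    by (simp add: fun_eq_iff)
  then show ?thesis using eq_uminus_self by (simp add: fun_eq_iff)
qed

text \<open>Relabelling the entries conjugates the column stabilizer, and conjugation preserves
  signs.\<close>

lemma perm_action_polytabloid:
  assumes s: "\<sigma> permutes {1..n}"
  shows "perm_action \<sigma> (polytabloid n T) = polytabloid n (T \<circ> inv \<sigma>)"
proof -
  let ?C = "column_stabilizer n T" and ?C' = "column_stabilizer n (T \<circ> inv \<sigma>)"
  note ip = permutes_inv[OF s]
  have conj: "\<sigma> \<circ> \<pi> \<circ> inv \<sigma> \<in> column_stabilizer n (T \<circ> inv \<sigma>)"
    if "\<pi> \<in> column_stabilizer n T" "\<sigma> permutes {1..n}" for \<pi> \<sigma> T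
  proof -
    have p: "\<pi> permutes {1..n}" "inv \<sigma> permutes {1..n}"
      using that by (auto simp: column_stabilizer_def permutes_inv)
    have "snd (T (inv \<sigma> (\<sigma> (\<pi> (inv \<sigma> x))))) = snd (T (inv \<sigma> x))" if x: "x \<in> {1..n}" for x
    proof -
      have "inv \<sigma> x \<in> {1..n}" using permutes_in_image[OF p(2)] x by simp
      then show ?thesis using \<open>\<pi> \<in> _\<close> permutes_inverses(2)[OF \<open>\<sigma> permutes _\<close>] by (simp add: column_stabilizer_def)
    qed
    moreover have "\<sigma> \<circ> \<pi> \<circ> inv \<sigma> permutes {1..n}"
      using p that(2) by (intro permutes_compose)
    ultimately show ?thesis by (simp add: column_stabilizer_def)
  qed
  have inv2: "\<sigma> \<circ> inv \<sigma> = id" "inv \<sigma> \<circ> \<sigma> = id" by (rule permutes_inv_o[OF s])+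
  have "perm_action \<sigma> (polytabloid n T) = (\<Sum>\<pi>\<in>?C. cscale (of_int (sign \<pi>)) (perm_action (\<sigma> \<circ> \<pi>) (delta (tabloid n T))))"
    by (simp add: polytabloid_eq column_antisymmetrizer_def clinear_sum[OF clinear_perm_action]
        clinear_scale[OF clinear_perm_action] perm_action_comp)
  also have "\<dots> = (\<Sum>\<rho>\<in>?C'. cscale (of_int (sign \<rho>)) (perm_action \<rho> (delta (tabloid n (T \<circ> inv \<sigma>)))))"
  proof (rule sum.reindex_bij_witness[of _ "\<lambda>\<rho>. inv \<sigma> \<circ> \<rho> \<circ> \<sigma>" "\<lambda>\<pi>. \<sigma> \<circ> \<pi> \<circ> inv \<sigma>"])
    fix \<pi> assume pi: "\<pi> \<in> ?C"
    have "inv \<sigma> \<circ> (\<sigma> \<circ> \<pi> \<circ> inv \<sigma>) \<circ> \<sigma> = (inv \<sigma> \<circ> \<sigma>) \<circ> \<pi> \<circ> (inv \<sigma> \<circ> \<sigma>)" by (simp only: o_assoc)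
    then show "inv \<sigma> \<circ> (\<sigma> \<circ> \<pi> \<circ> inv \<sigma>) \<circ> \<sigma> = \<pi>" by (simp only: inv2 id_comp comp_id)
    show "\<sigma> \<circ> \<pi> \<circ> inv \<sigma> \<in> ?C'" by (rule conj[OF pi s])
    have perms: "permutation \<sigma>" "permutation \<pi>" "permutation (inv \<sigma>)"
      using s ip column_stabilizer_permutes[OF pi] permutation_permutes finite_atLeastAtMost by blast+
    have "sign (\<sigma> \<circ> \<pi> \<circ> inv \<sigma>) = sign \<sigma> * sign \<pi> * sign \<sigma>"
      using perms by (simp add: sign_compose permutation_compose sign_inverse)
    also have "\<dots> = sign \<pi>" by (simp add: sign_def)
    finally have sg: "sign (\<sigma> \<circ> \<pi> \<circ> inv \<sigma>) = sign \<pi>" .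
    have "perm_action (\<sigma> \<circ> \<pi> \<circ> inv \<sigma>) (delta (tabloid n (T \<circ> inv \<sigma>))) =
        perm_action (\<sigma> \<circ> \<pi> \<circ> inv \<sigma>) (perm_action \<sigma> (delta (tabloid n T)))"
      by (simp only: perm_action_delta[OF s] tabloid_comp[OF ip])
    also have "\<dots> = perm_action (\<sigma> \<circ> \<pi>) (delta (tabloid n T))"
      by (simp only: perm_action_comp comp_assoc inv2 comp_id)
    finally show "cscale (of_int (sign (\<sigma> \<circ> \<pi> \<circ> inv \<sigma>))) (perm_action (\<sigma> \<circ> \<pi> \<circ> inv \<sigma>) (delta (tabloid n (T \<circ> inv \<sigma>)))) =
        cscale (of_int (sign \<pi>)) (perm_action (\<sigma> \<circ> \<pi>) (delta (tabloid n T)))"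
      by (simp only: sg)
  next
    fix \<rho> assume rho: "\<rho> \<in> ?C'"
    have "\<sigma> \<circ> (inv \<sigma> \<circ> \<rho> \<circ> \<sigma>) \<circ> inv \<sigma> = (\<sigma> \<circ> inv \<sigma>) \<circ> \<rho> \<circ> (\<sigma> \<circ> inv \<sigma>)" by (simp only: o_assoc)
    then show "\<sigma> \<circ> (inv \<sigma> \<circ> \<rho> \<circ> \<sigma>) \<circ> inv \<sigma> = \<rho>" by (simp only: inv2 id_comp comp_id)
    have "inv (inv \<sigma>) = \<sigma>" by (rule permutes_inv_inv[OF s])
    then show "inv \<sigma> \<circ> \<rho> \<circ> \<sigma> \<in> ?C"
      using conj[OF rho ip] by (simp only: comp_assoc inv2 comp_id)
  qed
  also have "\<dots> = polytabloid n (T \<circ> inv \<sigma>)" by (simp add: polytabloid_eq column_antisymmetrizer_def)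
  finally show ?thesis .
qed

lemma perm_action_specht:
  assumes "\<sigma> permutes {1..n}"
  shows "perm_action \<sigma> ` specht_module n l \<subseteq> specht_module n l"
proof -
  have "perm_action \<sigma> ` polytabloid n ` tableaux n l \<subseteq> specht_module n l"
    using perm_action_polytabloid[OF assms] tableaux_comp[OF _ permutes_inv[OF assms]]
    by (auto simp: specht_module_def intro!: cfun.span_base)
  then show ?thesis
    using span_clinear_image[OF clinear_perm_action] unfolding specht_module_def by blast
qed

lemma subspace_specht: "cfun.subspace (specht_module n l)"
  by (simp add: specht_module_def)

lemma specht_subset_functions_on: "specht_module n l \<subseteq> functions_on (tabloids n l)"
  unfolding specht_module_def
proof (rule cfun.span_minimal[OF _ subspace_functions_on])
  show "polytabloid n ` tableaux n l \<subseteq> functions_on (tabloids n l)"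
  proof
    fix v assume "v \<in> polytabloid n ` tableaux n l"
    then obtain T where T: "T \<in> tableaux n l" "v = polytabloid n T" by blast
    have "v t = 0" if "t \<notin> tabloids n l" for t
    proof -
      have "t \<noteq> tabloid n (T \<circ> inv \<pi>)" if "\<pi> \<in> column_stabilizer n T" for \<pi>
        using tableaux_comp[OF T(1) permutes_inv[OF column_stabilizer_permutes[OF that]]] \<open>t \<notin> _\<close>
        by (auto simp: tabloids_def)
      then show ?thesis unfolding T(2) polytabloid_def by (intro sum.neutral) auto
    qed
    then show "v \<in> functions_on (tabloids n l)" by (simp add: functions_on_def)
  qed
qed

lemma polytabloid_in_specht: "T \<in> tableaux n l \<Longrightarrow> polytabloid n T \<in> specht_module n l"
  by (simp add: specht_module_def cfun.span_base)

text \<open>The coefficient at the tabloid of \<open>T\<close> itself is 1, since a permutation that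
  preserves both the rows and the columns of \<open>T\<close> is the identity.\<close>

lemma polytabloid_nonzero:
  assumes T: "T \<in> tableaux n l"
  shows "polytabloid n T \<noteq> 0"
proof -
  have "\<pi> = id" if pi: "\<pi> \<in> column_stabilizer n T" and t: "tabloid n T = tabloid n (T \<circ> inv \<pi>)" for \<pi>
  proof -
    have p: "\<pi> permutes {1..n}" by (rule column_stabilizer_permutes[OF pi])
    have "inv \<pi> x = x" for x
    proof (cases "x \<in> {1..n}")
      case True
      have ix: "inv \<pi> x \<in> {1..n}" using permutes_in_image[OF permutes_inv[OF p]] True by simp
      have "fst (T x) = fst (T (inv \<pi> x))"
        using fun_cong[OF t, of x] True by (simp add: tabloid_def)
      moreover have "snd (T (inv \<pi> x)) = snd (T x)"
        using column_stabilizer_inv[OF pi] True by (simp add: column_stabilizer_def)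
      ultimately have "T x = T (inv \<pi> x)" by (simp add: prod_eq_iff)
      moreover have "inj_on T {1..n}" using T by (simp add: tableaux_def bij_betw_def)
      ultimately show ?thesis using True ix by (auto dest: inj_onD)
    next
      case False
      then show ?thesis using permutes_not_in[OF permutes_inv[OF p]] by simp
    qed
    then have "inv \<pi> = id" by auto
    then show ?thesis using permutes_inv_inv[OF p] by simp
  qed
  then have "polytabloid n T (tabloid n T) =
      (\<Sum>\<pi>\<in>{id}. of_int (sign \<pi>) * of_bool (tabloid n T = tabloid n (T \<circ> inv \<pi>)))"
    unfolding polytabloid_def
    by (intro sum.mono_neutral_right) (auto simp: finite_column_stabilizer column_stabilizer_id)
  also have "\<dots> = 1" by simp
  finally show ?thesis by auto
qed

section \<open>Linear independence of the irreducible characters\<close>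

lemma card_eq_sum_fibres:
  assumes "finite S" "finite J" "g ` S \<subseteq> J"
  shows "card S = (\<Sum>j\<in>J. card {x\<in>S. g x = j})"
  using sum.group[OF assms, of "\<lambda>_. 1 :: nat"] by simp

text \<open>Count along each column of \<open>T\<close>. Its entries lie in different rows of
  \<open>U\<close>, so at most \<open>k\<close> of them are in the first \<open>k\<close> rows of
  \<open>U\<close>. The first \<open>k\<close> rows of \<open>T\<close> contain either
  \<open>k\<close> entries of this column or all of it.\<close>

lemma dominance:
  assumes T: "T \<in> tableaux n l" and l: "antimono l" and U: "U \<in> tableaux n m"
    and sep: "\<And>x y. x \<in> {1..n} \<Longrightarrow> y \<in> {1..n} \<Longrightarrow> x \<noteq> y \<Longrightarrow> fst (U x) = fst (U y) \<Longrightarrow> snd (T x) \<noteq> snd (T y)"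
  shows "card {x\<in>{1..n}. fst (U x) < k} \<le> card {x\<in>{1..n}. fst (T x) < k}"
proof -
  let ?J = "snd ` T ` {1..n}"
  have bij: "bij_betw T {1..n} (diagram l)" using T by (simp add: tableaux_def)
  then have inj: "inj_on T {1..n}" and img: "T ` {1..n} = diagram l" by (simp_all add: bij_betw_def)
  have column: "card {x\<in>{x\<in>{1..n}. fst (U x) < k}. snd (T x) = j} \<le> card {x\<in>{x\<in>{1..n}. fst (T x) < k}. snd (T x) = j}" for j
  proof (cases "\<forall>i<k. j < l i")
    case True
    have "inj_on (\<lambda>x. fst (U x)) {x\<in>{x\<in>{1..n}. fst (U x) < k}. snd (T x) = j}"
      using sep by (intro inj_onI) (metis (mono_tags, lifting) mem_Collect_eq)
    moreover have "(\<lambda>x. fst (U x)) ` {x\<in>{x\<in>{1..n}. fst (U x) < k}. snd (T x) = j} \<subseteq> {..<k}" by auto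
    ultimately have "card {x\<in>{x\<in>{1..n}. fst (U x) < k}. snd (T x) = j} \<le> card {..<k}"
      by (rule card_inj_on_le) simp
    also have "\<dots> \<le> card {x\<in>{x\<in>{1..n}. fst (T x) < k}. snd (T x) = j}"
    proof (rule surj_card_le)
      show "{..<k} \<subseteq> (\<lambda>x. fst (T x)) ` {x\<in>{x\<in>{1..n}. fst (T x) < k}. snd (T x) = j}"
      proof
        fix i assume i: "i \<in> {..<k}"
        then have "(i, j) \<in> T ` {1..n}" using True unfolding img by (simp add: diagram_def)
        then obtain x where "x \<in> {1..n}" "T x = (i, j)" by force
        then show "i \<in> (\<lambda>x. fst (T x)) ` {x\<in>{x\<in>{1..n}. fst (T x) < k}. snd (T x) = j}"
          using i by (intro image_eqI[of _ _ x]) auto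
      qed
    qed simp
    finally show ?thesis .
  next
    case False
    then obtain i where i: "i < k" "l i \<le> j" by (auto simp: not_less)
    have "fst (T x) < k" if x: "x \<in> {1..n}" "snd (T x) = j" for x
    proof -
      have "T x \<in> diagram l" using x img by blast
      then have "j < l (fst (T x))" using x(2) by (auto simp: diagram_def)
      moreover have "l (fst (T x)) \<le> l i" if "i \<le> fst (T x)" using antimonoD[OF l that] .
      ultimately show ?thesis using i by linarith
    qed
    then show ?thesis by (intro card_mono) auto
  qed
  have "card {x\<in>{1..n}. fst (U x) < k} = (\<Sum>j\<in>?J. card {x\<in>{x\<in>{1..n}. fst (U x) < k}. snd (T x) = j})"
    by (rule card_eq_sum_fibres) auto
  also have "\<dots> \<le> (\<Sum>j\<in>?J. card {x\<in>{x\<in>{1..n}. fst (T x) < k}. snd (T x) = j})"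
    by (rule sum_mono) (rule column)
  also have "\<dots> = card {x\<in>{1..n}. fst (T x) < k}"
    by (rule card_eq_sum_fibres[symmetric]) auto
  finally show ?thesis .
qed

lemma card_first_rows:
  assumes "T \<in> tableaux n l"
  shows "card {x\<in>{1..n}. fst (T x) < k} = (\<Sum>i<k. l i)"
proof -
  have bij: "bij_betw T {1..n} (diagram l)" using assms by (simp add: tableaux_def)
  have "bij_betw T {x\<in>{1..n}. fst (T x) < k} {c\<in>diagram l. fst c < k}"
  proof (rule bij_betw_subset[OF bij])
    show "T ` {x\<in>{1..n}. fst (T x) < k} = {c\<in>diagram l. fst c < k}"
    proof (intro equalityI subsetI)
      fix c assume c: "c \<in> {c\<in>diagram l. fst c < k}"
      then have "c \<in> T ` {1..n}" using bij by (simp add: bij_betw_def)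
      then obtain x where "x \<in> {1..n}" "c = T x" by blast
      then show "c \<in> T ` {x\<in>{1..n}. fst (T x) < k}" using c by (intro image_eqI[of _ _ x]) simp_all
    next
      fix c assume "c \<in> T ` {x\<in>{1..n}. fst (T x) < k}"
      then obtain x where x: "x \<in> {1..n}" "fst (T x) < k" "c = T x" by blast
      then have "T x \<in> T ` {1..n}" by blast
      then show "c \<in> {c\<in>diagram l. fst c < k}" using bij x by (simp add: bij_betw_def)
    qed
  qed auto
  then have "card {x\<in>{1..n}. fst (T x) < k} = card {c\<in>diagram l. fst c < k}" by (rule bij_betw_same_card)
  also have "{c\<in>diagram l. fst c < k} = Sigma {..<k} (\<lambda>i. {..<l i})" by (auto simp: diagram_def)
  also have "card \<dots> = (\<Sum>i<k. l i)" by simp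
  finally show ?thesis .
qed

text \<open>If the antisymmetrizer of \<open>T\<close> does not kill \<open>v\<close>, it does not
  kill some tabloid \<open>tabloid n U\<close> of shape \<open>m\<close>. By
  \<open>column_antisymmetrizer_kills\<close>, entries in a common row of \<open>U\<close> are then
  in different columns of \<open>T\<close>, as \<open>dominance\<close> requires.\<close>

lemma specht_antisymmetrizer_dominance:
  assumes T: "T \<in> tableaux n l" and l: "l \<in> partitions_of n" and m: "m \<in> partitions_of n"
    and v: "v \<in> specht_module n m" "column_antisymmetrizer n T v \<noteq> 0"
  shows "(\<Sum>i<k. m i) \<le> (\<Sum>i<k. l i)"
proof -
  let ?X = "tabloids n m"
  have "v = (\<Sum>t\<in>?X. cscale (v t) (delta t))"
    using functions_on_expand[OF finite_tabloids[OF m]] specht_subset_functions_on v(1) by blast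
  then have "column_antisymmetrizer n T v = (\<Sum>t\<in>?X. cscale (v t) (column_antisymmetrizer n T (delta t)))"
    by (metis (no_types, lifting) sum.cong clinear_scale clinear_sum clinear_column_antisymmetrizer)
  then have "\<exists>t\<in>?X. column_antisymmetrizer n T (delta t) \<noteq> 0"
    using v(2) by (metis (no_types, lifting) cfun.scale_zero_right sum.neutral)
  then obtain U where U: "U \<in> tableaux n m" "column_antisymmetrizer n T (delta (tabloid n U)) \<noteq> 0"
    by (auto simp: tabloids_def)
  have "card {x\<in>{1..n}. fst (U x) < k} \<le> card {x\<in>{1..n}. fst (T x) < k}"
  proof (rule dominance[OF T _ U(1)])
    show "antimono l" using l by (simp add: partitions_of_def)
    fix x y assume xy: "x \<in> {1..n}" "y \<in> {1..n}" "x \<noteq> y" "fst (U x) = fst (U y)"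
    then have "tabloid n U x = tabloid n U y" by (simp add: tabloid_def)
    then show "snd (T x) \<noteq> snd (T y)" using column_antisymmetrizer_kills[OF xy(1-3)] U(2) by blast
  qed
  then show ?thesis by (simp only: card_first_rows[OF T] card_first_rows[OF U(1)])
qed

text \<open>The pairing with the sign on the column stabilizer. As linear functionals, these are
  triangular on the irreducible characters with respect to dominance, with nonzero diagonal.\<close>

definition column_trace :: "nat \<Rightarrow> (nat \<Rightarrow> nat \<times> nat) \<Rightarrow> ((nat \<Rightarrow> nat) \<Rightarrow> complex) \<Rightarrow> complex"
  where "column_trace n T f = (\<Sum>\<pi>\<in>column_stabilizer n T. of_int (sign \<pi>) * f \<pi>)"

lemma column_trace_irr_char:
  assumes "m \<in> partitions_of n"
  shows "column_trace n T (irr_char n m) = trace_on (specht_module n m) (column_antisymmetrizer n T)"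
proof -
  have "column_trace n T (irr_char n m) =
      (\<Sum>\<pi>\<in>column_stabilizer n T. of_int (sign \<pi>) * trace_on (specht_module n m) (perm_action \<pi>))"
    unfolding column_trace_def irr_char_def restrict_to_sym_def
  proof (rule sum.cong[OF refl])
    fix \<pi> assume "\<pi> \<in> column_stabilizer n T"
    then have "\<pi> permutes {1..n}" by (rule column_stabilizer_permutes)
    then show "of_int (sign \<pi>) * (if \<pi> permutes {1..n} then trace_on (specht_module n m) (perm_action \<pi>) else 0) =
        of_int (sign \<pi>) * trace_on (specht_module n m) (perm_action \<pi>)" by (simp only: if_True)
  qed
  also have "\<dots> = trace_on (specht_module n m)
      (\<lambda>v. \<Sum>\<pi>\<in>column_stabilizer n T. cscale (of_int (sign \<pi>)) (perm_action \<pi> v))"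
    using clinear_perm_action perm_action_specht column_stabilizer_permutes
    by (intro trace_on_linear_combination[symmetric, OF finite_tabloids[OF assms] specht_subset_functions_on subspace_specht]) auto
  also have "\<dots> = trace_on (specht_module n m) (column_antisymmetrizer n T)"
    by (rule arg_cong[of _ _ "trace_on _"]) (simp add: column_antisymmetrizer_def fun_eq_iff)
  finally show ?thesis .
qed

lemma antisymmetrizer_specht:
  "column_antisymmetrizer n T ` specht_module n m \<subseteq> specht_module n m"
proof
  fix w assume "w \<in> column_antisymmetrizer n T ` specht_module n m"
  then obtain v where v: "v \<in> specht_module n m" "w = column_antisymmetrizer n T v" by blast
  have "perm_action \<pi> v \<in> specht_module n m" if "\<pi> \<in> column_stabilizer n T" for \<pi>
    using perm_action_specht[OF column_stabilizer_permutes[OF that]] v(1) by blast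
  then show "w \<in> specht_module n m" unfolding v(2) column_antisymmetrizer_def
    by (intro cfun.subspace_sum[OF subspace_specht] cfun.subspace_scale[OF subspace_specht])
qed

text \<open>By \<open>column_antisymmetrizer_square\<close>, the antisymmetrizer is a multiple of an
  idempotent. It multiplies the polytabloid of \<open>T\<close> by the order of the column
  stabilizer, so it is not zero on the Specht module.\<close>

lemma column_trace_irr_char_nonzero:
  assumes l: "l \<in> partitions_of n" and T: "T \<in> tableaux n l"
  shows "column_trace n T (irr_char n l) \<noteq> 0"
  unfolding column_trace_irr_char[OF l]
proof (rule trace_on_quasi_idempotent_nonzero[OF finite_tabloids[OF l] specht_subset_functions_on subspace_specht
      clinear_column_antisymmetrizer antisymmetrizer_specht column_antisymmetrizer_square])
  let ?c = "of_nat (card (column_stabilizer n T)) :: complex"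
  have "card (column_stabilizer n T) \<noteq> 0"
    using column_stabilizer_id finite_column_stabilizer by (metis card_0_eq empty_iff)
  then show c: "?c \<noteq> 0" by simp
  show "polytabloid n T \<in> specht_module n l" by (rule polytabloid_in_specht[OF T])
  have "column_antisymmetrizer n T (polytabloid n T) = cscale ?c (polytabloid n T)"
    by (simp add: polytabloid_eq column_antisymmetrizer_square)
  then show "column_antisymmetrizer n T (polytabloid n T) \<noteq> 0"
    using c polytabloid_nonzero[OF T] cfun.scale_eq_0_iff by metis
qed

text \<open>A linear refinement of the dominance order on partitions of \<open>n\<close>: the sum of
  the partial sums grows strictly with dominance.\<close>

definition dominance_weight :: "nat \<Rightarrow> (nat \<Rightarrow> nat) \<Rightarrow> nat"
  where "dominance_weight n l = (\<Sum>k\<le>n. \<Sum>i<k. l i)"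

text \<open>If some \<open>v\<close> were not killed by the antisymmetrizer, \<open>l\<close> would
  dominate \<open>m\<close>. The weights would then force all partial sums up to \<open>n\<close> to
  agree, and both partitions vanish from index \<open>n\<close> on, so \<open>l = m\<close>.\<close>

lemma column_trace_irr_char_zero:
  assumes l: "l \<in> partitions_of n" and m: "m \<in> partitions_of n" and T: "T \<in> tableaux n l"
    and ne: "l \<noteq> m" and weight: "dominance_weight n l \<le> dominance_weight n m"
  shows "column_trace n T (irr_char n m) = 0"
  unfolding column_trace_irr_char[OF m]
proof (rule trace_on_zero[OF finite_tabloids[OF m] specht_subset_functions_on subspace_specht
      clinear_column_antisymmetrizer], rule ccontr)
  fix v assume "v \<in> specht_module n m" "column_antisymmetrizer n T v \<noteq> 0"
  then have le: "(\<Sum>i<k. m i) \<le> (\<Sum>i<k. l i)" for k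
    by (rule specht_antisymmetrizer_dominance[OF T l m])
  have eq: "(\<Sum>i<k. m i) = (\<Sum>i<k. l i)" if k: "k \<le> n" for k
  proof (rule ccontr)
    assume "(\<Sum>i<k. m i) \<noteq> (\<Sum>i<k. l i)"
    then have "(\<Sum>i<k. m i) < (\<Sum>i<k. l i)" using le[of k] by simp
    then have "dominance_weight n m < dominance_weight n l"
      unfolding dominance_weight_def using le k by (intro sum_strict_mono_ex1) auto
    then show False using weight by simp
  qed
  have "l i = m i" for i
  proof (cases "i < n")
    case True
    then show ?thesis using eq[of i] eq[of "Suc i"] by simp
  next
    case False
    then show ?thesis using partition_diagram(3)[OF l, of i] partition_diagram(3)[OF m, of i] by simp
  qed
  then show False using ne by auto
qed

text \<open>Among the shapes with nonzero scalar, take one of minimal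
  \<open>dominance_weight\<close>; the column trace for a tableau of this shape kills all other
  terms. The sum is indexed by shapes and not by characters, so that the injectivity of
  \<open>irr_char\<close> can be derived from it.\<close>

lemma irr_chars_scalars_zero:
  assumes L: "finite L" "L \<subseteq> partitions_of n"
    and zero: "(\<Sum>l\<in>L. cscale (u l) (irr_char n l)) = 0" and l0: "l0 \<in> L"
  shows "u l0 = 0"
proof (rule ccontr)
  assume "u l0 \<noteq> 0"
  then have ne: "{l\<in>L. u l \<noteq> 0} \<noteq> {}" using l0 by blast
  obtain l where l: "l \<in> L" "u l \<noteq> 0" and
    minl: "\<And>m. m \<in> L \<Longrightarrow> u m \<noteq> 0 \<Longrightarrow> dominance_weight n l \<le> dominance_weight n m"
  proof -
    have "finite {l\<in>L. u l \<noteq> 0}" using L(1) by simp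
    from ex_min_if_finite[OF finite_imageI[OF this, of "dominance_weight n"]] ne
    obtain w where w: "w \<in> dominance_weight n ` {l\<in>L. u l \<noteq> 0}"
      "\<not> (\<exists>x\<in>dominance_weight n ` {l\<in>L. u l \<noteq> 0}. x < w)" by auto
    from w(1) obtain l where "l \<in> L" "u l \<noteq> 0" "w = dominance_weight n l" by blast
    moreover have "w \<le> dominance_weight n m" if "m \<in> L" "u m \<noteq> 0" for m
    proof -
      have "dominance_weight n m \<in> dominance_weight n ` {l\<in>L. u l \<noteq> 0}"
        by (rule imageI) (use \<open>m \<in> L\<close> \<open>u m \<noteq> 0\<close> in simp)
      then show ?thesis using w(2) not_less by blast
    qed
    ultimately show ?thesis using that by simp
  qed
  have part: "l \<in> partitions_of n" using l L by blast
  obtain T where T: "T \<in> tableaux n l" using tableaux_nonempty[OF part] by blast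
  have "0 = column_trace n T (\<Sum>m\<in>L. cscale (u m) (irr_char n m))"
    unfolding zero by (simp add: column_trace_def)
  also have "\<dots> = (\<Sum>m\<in>L. u m * column_trace n T (irr_char n m))"
    unfolding column_trace_def sum_fun_apply cscale_apply sum_distrib_left
    by (subst sum.swap) (simp only: mult.left_commute)
  also have "\<dots> = (\<Sum>m\<in>L. if m = l then u l * column_trace n T (irr_char n l) else 0)"
  proof (rule sum.cong)
    fix m assume m: "m \<in> L"
    show "u m * column_trace n T (irr_char n m) = (if m = l then u l * column_trace n T (irr_char n l) else 0)"
    proof (cases "m = l \<or> u m = 0")
      case False
      then have "column_trace n T (irr_char n m) = 0"
        using column_trace_irr_char_zero[OF part _ T] minl m L(2) by blast
      then show ?thesis using False by simp
    qed auto
  qed simp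
  also have "\<dots> = u l * column_trace n T (irr_char n l)" using L(1) l(1) by simp
  finally show False using l(2) column_trace_irr_char_nonzero[OF part T] by simp
qed

lemma inj_on_irr_char: "inj_on (irr_char n) (partitions_of n)"
proof (rule inj_onI, rule ccontr)
  fix l m assume lm: "l \<in> partitions_of n" "m \<in> partitions_of n" "irr_char n l = irr_char n m" "l \<noteq> m"
  let ?u = "\<lambda>k. if k = l then 1 else - 1 :: complex"
  have "(\<Sum>k\<in>{l, m}. cscale (?u k) (irr_char n k)) = 0"
  proof
    show "(\<Sum>k\<in>{l, m}. cscale (?u k) (irr_char n k)) \<sigma> = 0 \<sigma>" for \<sigma>
      using lm(4) by (simp add: sum_fun_apply cscale_apply lm(3))
  qed
  then have "?u l = 0" using lm by (intro irr_chars_scalars_zero[of "{l, m}" n ?u l]) auto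
  then show False by simp
qed

lemma independent_irr_chars: "cfun.independent (irr_char n ` partitions_of n)"
  unfolding cfun.independent_explicit_finite_subsets
proof (intro allI impI ballI)
  fix S u v assume S: "S \<subseteq> irr_char n ` partitions_of n" "finite S" "(\<Sum>v\<in>S. cscale (u v) v) = 0" "v \<in> S"
  obtain L where L: "L \<subseteq> partitions_of n" "finite L" "S = irr_char n ` L"
    using finite_subset_image[OF S(2,1)] by blast
  have "(\<Sum>l\<in>L. cscale (u (irr_char n l)) (irr_char n l)) = 0"
    using S(3) inj_on_subset[OF inj_on_irr_char L(1)] by (simp add: L(3) sum.reindex)
  moreover obtain l where "l \<in> L" "v = irr_char n l" using S(4) L(3) by blast
  ultimately show "u v = 0" using irr_chars_scalars_zero[OF L(2,1), of "\<lambda>l. u (irr_char n l)" l] by simp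
qed

text \<open>The \<open>SOME\<close> in \<open>frobenius_ch\<close> is informative only if a map with
  these properties exists. As the characters are independent, their values can be prescribed and
  extended linearly to all functions.\<close>

lemma frobenius_ch_props:
  "(\<forall>f\<in>class_functions n. \<forall>g\<in>class_functions n. frobenius_ch n (f + g) = frobenius_ch n f + frobenius_ch n g) \<and>
   (\<forall>c. \<forall>f\<in>class_functions n. frobenius_ch n (cscale c f) = cscale c (frobenius_ch n f)) \<and>
   (\<forall>l\<in>partitions_of n. frobenius_ch n (irr_char n l) = schur l)"
proof -
  obtain \<phi> :: "((nat \<Rightarrow> nat) \<Rightarrow> complex) \<Rightarrow> power_series" where
    lin: "Vector_Spaces.linear cscale cscale \<phi>" and
    val: "\<forall>\<chi>\<in>irr_char n ` partitions_of n. \<phi> \<chi> = schur (inv_into (partitions_of n) (irr_char n) \<chi>)"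
    using cfun_pair.linear_independent_extend[OF independent_irr_chars[of n],
      of "\<lambda>\<chi>. schur (inv_into (partitions_of n) (irr_char n) \<chi>)"] by blast
  have "clinear \<phi>" using lin by (simp add: clinear_iff)
  moreover have "\<phi> (irr_char n l) = schur l" if "l \<in> partitions_of n" for l
    using val that inv_into_f_f[OF inj_on_irr_char that] by simp
  ultimately have "\<exists>\<phi>. (\<forall>f\<in>class_functions n. \<forall>g\<in>class_functions n. \<phi> (f + g) = \<phi> f + \<phi> g) \<and>
    (\<forall>c. \<forall>f\<in>class_functions n. \<phi> (cscale c f) = cscale c (\<phi> f)) \<and>
    (\<forall>l\<in>partitions_of n. \<phi> (irr_char n l) = schur l)"
    unfolding clinear_def by blast
  from someI_ex[OF this] show ?thesis unfolding frobenius_ch_def .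
qed

text \<open>Additivity of \<open>frobenius_ch\<close> is known on class functions only, so the
  induction carries along that the partial sums are class functions.\<close>

lemma frobenius_ch_combination:
  assumes "finite I" "\<And>i. i \<in> I \<Longrightarrow> l i \<in> partitions_of n" "\<And>i. i \<in> I \<Longrightarrow> irr_char n (l i) \<in> class_functions n"
  shows "frobenius_ch n (\<Sum>i\<in>I. cscale (c i) (irr_char n (l i))) = (\<Sum>i\<in>I. cscale (c i) (schur (l i)))"
proof -
  have closed: "f + g \<in> class_functions n" "cscale a f \<in> class_functions n"
    if "f \<in> class_functions n" "g \<in> class_functions n" for f g a
    using that by (auto simp: class_functions_def cscale_def)
  have zero: "0 \<in> class_functions n" by (simp add: class_functions_def)
  have ch0: "frobenius_ch n 0 = 0"
    using frobenius_ch_props[of n] zero by (metis cfun.scale_zero_left)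
  have "(\<Sum>i\<in>I. cscale (c i) (irr_char n (l i))) \<in> class_functions n \<and>
    frobenius_ch n (\<Sum>i\<in>I. cscale (c i) (irr_char n (l i))) = (\<Sum>i\<in>I. cscale (c i) (schur (l i)))"
    using assms
  proof (induction I rule: finite_induct)
    case empty
    then show ?case unfolding sum.empty using zero ch0 by blast
  next
    case (insert i I)
    let ?f = "cscale (c i) (irr_char n (l i))" and ?g = "\<Sum>i\<in>I. cscale (c i) (irr_char n (l i))"
    have g: "?g \<in> class_functions n" "frobenius_ch n ?g = (\<Sum>i\<in>I. cscale (c i) (schur (l i)))"
      using insert by simp_all
    have X: "irr_char n (l i) \<in> class_functions n" and p: "l i \<in> partitions_of n" using insert.prems by simp_all
    have f: "?f \<in> class_functions n" using closed(2)[OF X X] .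
    have "frobenius_ch n (?f + ?g) = frobenius_ch n ?f + frobenius_ch n ?g"
      using frobenius_ch_props[of n] f g(1) by blast
    moreover have "frobenius_ch n ?f = cscale (c i) (schur (l i))"
      using frobenius_ch_props[of n] X p by metis
    moreover have "?f + ?g \<in> class_functions n" using closed(1)[OF f g(1)] .
    ultimately show ?case unfolding sum.insert[OF insert.hyps] g(2) by (simp only: simp_thms)
  qed
  then show ?thesis by blast
qed

section \<open>Characters of two-rowed shapes\<close>

text \<open>A set \<open>A\<close> of entries encodes the tabloid whose second row is \<open>A\<close>.\<close>

definition set_tabloid :: "nat \<Rightarrow> nat set \<Rightarrow> nat \<Rightarrow> nat"
  where "set_tabloid m A = restrict (\<lambda>x. of_bool (x \<in> A)) {1..m}"

lemma set_tabloid_eq_iff: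
  assumes "A \<subseteq> {1..m}" "B \<subseteq> {1..m}"
  shows "set_tabloid m A = set_tabloid m B \<longleftrightarrow> A = B"
proof
  assume eq: "set_tabloid m A = set_tabloid m B"
  have "x \<in> A \<longleftrightarrow> x \<in> B" if "x \<in> {1..m}" for x
  proof -
    have "(of_bool (x \<in> A) :: nat) = of_bool (x \<in> B)"
      using fun_cong[OF eq, of x] that by (simp add: set_tabloid_def)
    then show ?thesis by (simp only: of_bool_eq_iff)
  qed
  then show "A = B" using assms by blast
qed simp

lemma set_tabloid_comp:
  assumes "\<pi> permutes {1..m}"
  shows "set_tabloid m A \<circ> inv \<pi> = set_tabloid m (\<pi> ` A)"
proof
  fix x
  have "inv \<pi> x \<in> {1..m} \<longleftrightarrow> x \<in> {1..m}" using permutes_in_image[OF permutes_inv[OF assms]] .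
  moreover have "inv \<pi> x \<in> A \<longleftrightarrow> x \<in> \<pi> ` A"
    using permutes_inverses[OF assms] by (metis image_iff)
  ultimately show "(set_tabloid m A \<circ> inv \<pi>) x = set_tabloid m (\<pi> ` A) x"
    by (simp add: set_tabloid_def)
qed

abbreviation subsets_of_size :: "nat \<Rightarrow> nat \<Rightarrow> nat set set"
  where "subsets_of_size m b \<equiv> {A. A \<subseteq> {1..m} \<and> card A = b}"

text \<open>Writing \<open>Suc (card S) = b\<close> instead of \<open>card S = b - 1\<close> makes
  this family empty for \<open>b = 0\<close>, so that \<open>down_kernel\<close> then imposes no
  condition.\<close>

abbreviation subsets_below :: "nat \<Rightarrow> nat \<Rightarrow> nat set set"
  where "subsets_below m b \<equiv> {S. S \<subseteq> {1..m} \<and> Suc (card S) = b}"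

lemma finite_subsets_of_size: "finite (subsets_of_size m b)" "finite (subsets_below m b)"
  by (rule finite_subset[of _ "Pow {1..m}"]; auto)+

lemma set_tabloid_insert_mem:
  assumes "S \<in> subsets_below m b" "y \<in> {1..m} - S"
  shows "insert y S \<in> subsets_of_size m b"
proof -
  have "finite S" using assms(1) finite_subset[of S "{1..m}"] by simp
  then show ?thesis using assms by simp
qed

definition pair_points :: "(nat \<times> nat) list \<Rightarrow> nat set"
  where "pair_points ps = fst ` set ps \<union> snd ` set ps"

definition disjoint_pairs :: "(nat \<times> nat) list \<Rightarrow> bool"
  where "disjoint_pairs ps \<longleftrightarrow> distinct (map fst ps @ map snd ps)"

lemma pair_points_simps: "pair_points [] = {}" "pair_points ((x, y) # ps) = {x, y} \<union> pair_points ps"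
  by (auto simp: pair_points_def)

lemma finite_pair_points: "finite (pair_points ps)"
  by (simp add: pair_points_def)

lemma disjoint_pairs_Cons:
  "disjoint_pairs ((x, y) # ps) \<longleftrightarrow> x \<noteq> y \<and> x \<notin> pair_points ps \<and> y \<notin> pair_points ps \<and> disjoint_pairs ps"
  by (auto simp: disjoint_pairs_def pair_points_def)

text \<open>The multilinear extension of \<open>f\<close> evaluated at the product of the differences
  \<open>x - y\<close>, over the pairs \<open>(x, y)\<close>, and the elements of \<open>C\<close>.\<close>

fun pair_product :: "(nat set \<Rightarrow> 'v::ab_group_add) \<Rightarrow> (nat \<times> nat) list \<Rightarrow> nat set \<Rightarrow> 'v" where
  "pair_product f [] C = f C"
| "pair_product f ((x, y) # ps) C = pair_product f ps (insert x C) - pair_product f ps (insert y C)"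

text \<open>The expanded product only involves sets that consist of \<open>C\<close> and one point
  of each pair.\<close>

lemma pair_product_in_subspace:
  assumes "cfun.subspace V" "disjoint_pairs ps" "C \<inter> pair_points ps = {}" "finite C"
    "\<And>A. A \<subseteq> C \<union> pair_points ps \<Longrightarrow> card A = card C + length ps \<Longrightarrow> f A \<in> V"
  shows "pair_product f ps C \<in> V"
  using assms(2-5)
proof (induction ps arbitrary: C)
  case Nil
  then show ?case by (simp add: pair_points_simps)
next
  case (Cons p ps)
  obtain x y where p: "p = (x, y)" by (cases p)
  have d: "x \<noteq> y" "x \<notin> pair_points ps" "y \<notin> pair_points ps" "disjoint_pairs ps"
    using Cons.prems(1) by (simp_all add: p disjoint_pairs_Cons)
  have "pair_product f ps (insert z C) \<in> V" if z: "z = x \<or> z = y" for z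
  proof (rule Cons.IH[OF d(4)])
    have zC: "z \<notin> C" using z Cons.prems(2) by (auto simp: p pair_points_simps)
    show "insert z C \<inter> pair_points ps = {}"
      using z d Cons.prems(2) by (auto simp: p pair_points_simps)
    show "finite (insert z C)" using Cons.prems(3) by simp
    fix A assume A: "A \<subseteq> insert z C \<union> pair_points ps" "card A = card (insert z C) + length ps"
    show "f A \<in> V"
    proof (rule Cons.prems(4))
      show "A \<subseteq> C \<union> pair_points (p # ps)" using A(1) z by (auto simp: p pair_points_simps)
      show "card A = card C + length (p # ps)" using A(2) zC Cons.prems(3) by simp
    qed
  qed
  then show ?case unfolding p pair_product.simps by (intro cfun.subspace_diff[OF assms(1)]) simp_all
qed

section \<open>Inclusion maps between subsets of adjacent sizes\<close>

definition tabloid_delta :: "nat \<Rightarrow> nat set \<Rightarrow> (nat \<Rightarrow> nat) \<Rightarrow> complex"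
  where "tabloid_delta m A = delta (set_tabloid m A)"

definition up_vector :: "nat \<Rightarrow> nat set \<Rightarrow> (nat \<Rightarrow> nat) \<Rightarrow> complex"
  where "up_vector m S = (\<Sum>y\<in>{1..m} - S. tabloid_delta m (insert y S))"

text \<open>The transpose of the map that sends \<open>S\<close> to \<open>up_vector m S\<close>.
  Its values are functions of sets rather than of tabloids.\<close>

definition down_map :: "nat \<Rightarrow> ((nat \<Rightarrow> nat) \<Rightarrow> complex) \<Rightarrow> nat set \<Rightarrow> complex"
  where "down_map m v S = (\<Sum>y\<in>{1..m} - S. v (set_tabloid m (insert y S)))"

lemma clinear_down_map: "clinear (down_map m)"
  by (auto simp: clinear_def down_map_def cscale_def fun_eq_iff sum.distrib sum_distrib_left)

text \<open>A term that ends up with both points of a pair arises once from \<open>insert x\<close>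
  and once from \<open>insert y\<close>, with opposite signs. Only the points outside all pairs
  remain to be added.\<close>

lemma pair_product_up:
  assumes "disjoint_pairs ps" "pair_points ps \<subseteq> {1..m}" "C \<subseteq> {1..m}" "C \<inter> pair_points ps = {}"
  shows "pair_product (up_vector m) ps C =
    (\<Sum>z\<in>{1..m} - C - pair_points ps. pair_product (tabloid_delta m) ps (insert z C))"
  using assms
proof (induction ps arbitrary: C)
  case Nil
  then show ?case by (simp only: pair_product.simps up_vector_def pair_points_simps Diff_empty)
next
  case (Cons p ps)
  obtain x y where p: "p = (x, y)" by (cases p)
  have d: "x \<noteq> y" "x \<notin> pair_points ps" "y \<notin> pair_points ps" "disjoint_pairs ps"
    using Cons.prems(1) by (simp_all add: p disjoint_pairs_Cons)
  have xy: "x \<in> {1..m}" "y \<in> {1..m}" "x \<notin> C" "y \<notin> C" "pair_points ps \<subseteq> {1..m}" "C \<inter> pair_points ps = {}"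
    using Cons.prems(2,4) by (auto simp: p pair_points_simps)
  let ?R = "{1..m} - C - pair_points (p # ps)"
  let ?g = "pair_product (tabloid_delta m) ps"
  have R: "finite ?R" "x \<notin> ?R" "y \<notin> ?R" by (auto simp: p pair_points_simps)
  have Rx: "{1..m} - insert x C - pair_points ps = insert y ?R"
    using d xy by (auto simp: p pair_points_simps)
  have Ry: "{1..m} - insert y C - pair_points ps = insert x ?R"
    using d xy by (auto simp: p pair_points_simps)
  have "pair_product (up_vector m) ps (insert x C) = (\<Sum>z\<in>insert y ?R. ?g (insert z (insert x C)))"
    unfolding Rx[symmetric] using d xy Cons.prems(3) by (intro Cons.IH) auto
  moreover have "pair_product (up_vector m) ps (insert y C) = (\<Sum>z\<in>insert x ?R. ?g (insert z (insert y C)))"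
    unfolding Ry[symmetric] using d xy Cons.prems(3) by (intro Cons.IH) auto
  ultimately have "pair_product (up_vector m) (p # ps) C =
      (?g (insert y (insert x C)) + (\<Sum>z\<in>?R. ?g (insert z (insert x C)))) -
      (?g (insert x (insert y C)) + (\<Sum>z\<in>?R. ?g (insert z (insert y C))))"
    using R by (simp only: p pair_product.simps sum.insert not_False_eq_True)
  also have "?g (insert y (insert x C)) = ?g (insert x (insert y C))"
    by (simp only: insert_commute[of y x C])
  also have "(?g (insert x (insert y C)) + (\<Sum>z\<in>?R. ?g (insert z (insert x C)))) -
      (?g (insert x (insert y C)) + (\<Sum>z\<in>?R. ?g (insert z (insert y C)))) =
      (\<Sum>z\<in>?R. ?g (insert z (insert x C)) - ?g (insert z (insert y C)))"
    by (simp only: add_diff_cancel_left sum_subtractf)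
  also have "\<dots> = (\<Sum>z\<in>?R. pair_product (tabloid_delta m) (p # ps) (insert z C))"
  proof (rule sum.cong[OF refl])
    fix z
    have "insert z (insert x C) = insert x (insert z C)" "insert z (insert y C) = insert y (insert z C)" by auto
    then show "?g (insert z (insert x C)) - ?g (insert z (insert y C)) =
        pair_product (tabloid_delta m) (p # ps) (insert z C)" by (simp only: p pair_product.simps)
  qed
  finally show ?case .
qed

definition down_delta :: "nat set \<Rightarrow> nat set \<Rightarrow> complex"
  where "down_delta A = (\<Sum>a\<in>A. delta (A - {a}))"

text \<open>Removing the point chosen from a pair leaves the same set whichever point was chosen, so
  these terms cancel. For empty \<open>C\<close> nothing remains, which puts the pair products into
  the kernel of \<open>down_map\<close>.\<close>

lemma pair_product_down:
  assumes "disjoint_pairs ps" "finite C" "C \<inter> pair_points ps = {}"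
  shows "pair_product down_delta ps C = (\<Sum>c\<in>C. pair_product delta ps (C - {c}))"
  using assms
proof (induction ps arbitrary: C)
  case Nil
  then show ?case by (simp only: pair_product.simps down_delta_def)
next
  case (Cons p ps)
  obtain x y where p: "p = (x, y)" by (cases p)
  have d: "x \<noteq> y" "x \<notin> pair_points ps" "y \<notin> pair_points ps" "disjoint_pairs ps"
    using Cons.prems(1) by (simp_all add: p disjoint_pairs_Cons)
  have xy: "x \<notin> C" "y \<notin> C" "C \<inter> pair_points ps = {}"
    using Cons.prems(3) by (auto simp: p pair_points_simps)
  let ?g = "pair_product (delta :: nat set \<Rightarrow> nat set \<Rightarrow> complex) ps"
  have step: "pair_product down_delta ps (insert z C) = ?g C + (\<Sum>c\<in>C. ?g (insert z (C - {c})))"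
    if z: "z \<notin> C" "z \<notin> pair_points ps" for z
  proof -
    have "pair_product down_delta ps (insert z C) = (\<Sum>c\<in>insert z C. ?g (insert z C - {c}))"
      using d(4) xy(3) z Cons.prems(2) by (intro Cons.IH) auto
    also have "\<dots> = ?g (insert z C - {z}) + (\<Sum>c\<in>C. ?g (insert z C - {c}))"
      by (rule sum.insert[OF Cons.prems(2) z(1)])
    also have "insert z C - {z} = C" using z(1) by simp
    also have "(\<Sum>c\<in>C. ?g (insert z C - {c})) = (\<Sum>c\<in>C. ?g (insert z (C - {c})))"
    proof (rule sum.cong[OF refl])
      fix c assume "c \<in> C"
      then have "insert z C - {c} = insert z (C - {c})" using z(1) by auto
      then show "?g (insert z C - {c}) = ?g (insert z (C - {c}))" by (simp only:)
    qed
    finally show ?thesis .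
  qed
  show ?case
    unfolding p pair_product.simps step[OF xy(1) d(2)] step[OF xy(2) d(3)] sum_subtractf add_diff_cancel_left ..
qed

lemma down_map_tabloid_delta:
  assumes A: "A \<subseteq> {1..m}" and S: "S \<subseteq> {1..m}"
  shows "down_map m (tabloid_delta m A) S = down_delta A S"
proof -
  have finA: "finite A" using A finite_subset by blast
  have "down_map m (tabloid_delta m A) S = (\<Sum>y\<in>{1..m} - S. of_bool (insert y S = A))"
    unfolding down_map_def tabloid_delta_def delta_def
    by (rule sum.cong) (use A S in \<open>simp_all add: set_tabloid_eq_iff\<close>)
  also have "\<dots> = (\<Sum>y\<in>A. of_bool (S = A - {y}))"
    by (rule sum.mono_neutral_cong) (use A finA in auto)
  finally show ?thesis by (simp add: down_delta_def sum_fun_apply delta_def)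
qed

lemma down_map_pair_product:
  assumes "pair_points ps \<subseteq> {1..m}" "C \<subseteq> {1..m}" "S \<subseteq> {1..m}"
  shows "down_map m (pair_product (tabloid_delta m) ps C) S = pair_product down_delta ps C S"
  using assms
proof (induction ps arbitrary: C)
  case Nil
  then show ?case by (simp add: down_map_tabloid_delta)
next
  case (Cons p ps)
  obtain x y where p: "p = (x, y)" by (cases p)
  have sub: "\<And>v w. down_map m (v - w) S = down_map m v S - down_map m w S"
    by (simp add: down_map_def sum_subtractf)
  have "x \<in> {1..m}" "y \<in> {1..m}" "pair_points ps \<subseteq> {1..m}"
    using Cons.prems(1) by (auto simp: p pair_points_simps)
  then have h: "down_map m (pair_product (tabloid_delta m) ps (insert z C)) S = pair_product down_delta ps (insert z C) S"
    if "z = x \<or> z = y" for z using that Cons.prems(2,3) by (intro Cons.IH) auto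
  show ?case
    unfolding p pair_product.simps sub h[OF disjI1[OF refl]] h[OF disjI2[OF refl]]
    by (simp only: minus_apply)
qed

definition pair_products :: "nat \<Rightarrow> nat \<Rightarrow> ((nat \<Rightarrow> nat) \<Rightarrow> complex) set"
  where "pair_products m b = {pair_product (tabloid_delta m) ps {} |ps.
    disjoint_pairs ps \<and> pair_points ps \<subseteq> {1..m} \<and> length ps = b}"

text \<open>Straightening by averaging. Exchanging a point \<open>c\<close> of \<open>C\<close> for
  a point \<open>z\<close> outside changes the product by one with an additional pair and fewer
  points in \<open>C\<close>, while the sum over all \<open>z\<close> is a combination of vectors
  \<open>up_vector m A\<close>.\<close>

lemma pair_product_in_span:
  assumes "disjoint_pairs ps" "pair_points ps \<subseteq> {1..m}" "C \<subseteq> {1..m}" "C \<inter> pair_points ps = {}"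
    "length ps + card C = b"
  shows "pair_product (tabloid_delta m) ps C \<in> cfun.span (pair_products m b \<union> up_vector m ` subsets_below m b)"
    (is "_ \<in> cfun.span ?Z")
  using assms
proof (induction "card C" arbitrary: ps C)
  case 0
  then have "C = {}" using finite_subset[of C "{1..m}"] by simp
  then have "pair_product (tabloid_delta m) ps C \<in> pair_products m b"
    using 0 by (auto simp: pair_products_def)
  then show ?case by (intro cfun.span_base) simp
next
  case (Suc j)
  have finC: "finite C" using Suc.prems(3) finite_subset by blast
  obtain c C' where c: "C = insert c C'" "c \<notin> C'" "card C' = j"
    using Suc.hyps(2) finC by (metis card_Suc_eq)
  have finC': "finite C'" using finC c(1) by simp
  have C': "C' \<subseteq> {1..m}" "C' \<inter> pair_points ps = {}" "c \<in> {1..m}" "c \<notin> pair_points ps"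
    using Suc.prems(3,4) c(1) by auto
  let ?R = "{1..m} - C' - pair_points ps" and ?g = "pair_product (tabloid_delta m) ps"
  have cR: "c \<in> ?R" using C' c(2) by blast
  have "pair_product (up_vector m) ps C' \<in> cfun.span ?Z"
  proof (rule pair_product_in_subspace[OF cfun.subspace_span Suc.prems(1) C'(2) finC'])
    fix A assume A: "A \<subseteq> C' \<union> pair_points ps" "card A = card C' + length ps"
    have "A \<subseteq> {1..m}" using A(1) C'(1) Suc.prems(2) by blast
    moreover have "Suc (card A) = b" using A(2) Suc.prems(5) c finC' by simp
    ultimately have "up_vector m A \<in> up_vector m ` subsets_below m b" by blast
    then show "up_vector m A \<in> cfun.span ?Z" by (intro cfun.span_base) simp
  qed
  then have up: "(\<Sum>z\<in>?R. ?g (insert z C')) \<in> cfun.span ?Z"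
    using pair_product_up[OF Suc.prems(1,2) C'(1,2)] by simp
  have diff: "?g (insert c C') - ?g (insert z C') \<in> cfun.span ?Z" if z: "z \<in> ?R" for z
  proof (cases "z = c")
    case True
    then show ?thesis by (simp only: diff_self cfun.span_zero)
  next
    case False
    have "pair_product (tabloid_delta m) ((c, z) # ps) C' \<in> cfun.span ?Z"
    proof (rule Suc.hyps(1))
      show "j = card C'" using c(3) by simp
      show "disjoint_pairs ((c, z) # ps)" using False z C' Suc.prems(1) by (auto simp: disjoint_pairs_Cons)
      show "pair_points ((c, z) # ps) \<subseteq> {1..m}" using z C' Suc.prems(2) by (auto simp: pair_points_simps)
      show "C' \<inter> pair_points ((c, z) # ps) = {}" using z C' c(2) by (auto simp: pair_points_simps)
      show "length ((c, z) # ps) + card C' = b" using Suc.prems(5) c finC' by simp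
    qed (rule C'(1))
    then show ?thesis by simp
  qed
  \<comment> \<open>The differences and the sum add up to \<open>card ?R\<close> copies of
    \<open>?g C\<close>. Since \<open>c\<close> lies in \<open>?R\<close>, this factor is not zero
    and can be divided out.\<close>
  have "(\<Sum>z\<in>?R. ?g (insert c C') - ?g (insert z C')) + (\<Sum>z\<in>?R. ?g (insert z C')) \<in> cfun.span ?Z"
    by (intro cfun.span_add cfun.span_sum diff up)
  moreover have "(\<Sum>z\<in>?R. ?g (insert c C') - ?g (insert z C')) + (\<Sum>z\<in>?R. ?g (insert z C')) =
      cscale (of_nat (card ?R)) (?g C)"
    unfolding sum_subtractf c(1) by (simp add: fun_eq_iff cscale_apply sum_fun_apply)
  ultimately have mem: "cscale (of_nat (card ?R)) (?g C) \<in> cfun.span ?Z" by (simp only:)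
  define r where "r = (of_nat (card ?R) :: complex)"
  have "card ?R \<noteq> 0" using cR by (metis card_0_eq empty_iff finite_Diff finite_atLeastAtMost)
  then have "r \<noteq> 0" unfolding r_def by (simp only: of_nat_eq_0_iff not_False_eq_True)
  then show ?case using cfun.span_scale[OF mem[folded r_def], of "1 / r"] by simp
qed

text \<open>For \<open>2 * b \<le> m\<close> this is the Specht module of shape
  \<open>two_rows (m - b) b\<close>, by \<open>specht_two_rows\<close>: the two-rowed case, in
  characteristic zero, of the kernel intersection theorem of James.\<close>

definition down_kernel :: "nat \<Rightarrow> nat \<Rightarrow> ((nat \<Rightarrow> nat) \<Rightarrow> complex) set"
  where "down_kernel m b = {v \<in> functions_on (set_tabloid m ` subsets_of_size m b).
    \<forall>S\<in>subsets_below m b. down_map m v S = 0}"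

lemma subspace_down_kernel: "cfun.subspace (down_kernel m b)"
  by (rule cfun.subspaceI)
     (auto simp: down_kernel_def functions_on_def down_map_def cscale_def sum.distrib
       simp flip: sum_distrib_left)

lemma pair_products_subset_down_kernel: "pair_products m b \<subseteq> down_kernel m b"
proof
  fix v assume "v \<in> pair_products m b"
  then obtain ps where ps: "disjoint_pairs ps" "pair_points ps \<subseteq> {1..m}" "length ps = b"
    and v: "v = pair_product (tabloid_delta m) ps {}" by (auto simp: pair_products_def)
  have "v \<in> functions_on (set_tabloid m ` subsets_of_size m b)" unfolding v
  proof (rule pair_product_in_subspace[OF subspace_functions_on ps(1)])
    fix A assume "A \<subseteq> {} \<union> pair_points ps" "card A = card ({} :: nat set) + length ps"
    then have "A \<in> subsets_of_size m b" using ps by auto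
    then show "tabloid_delta m A \<in> functions_on (set_tabloid m ` subsets_of_size m b)"
      by (auto simp: functions_on_def tabloid_delta_def delta_def)
  qed auto
  moreover have "down_map m v S = 0" if "S \<in> subsets_below m b" for S
  proof -
    have "down_map m v S = pair_product down_delta ps {} S"
      unfolding v using that ps by (intro down_map_pair_product) auto
    also have "\<dots> = 0" by (subst pair_product_down) (simp_all add: ps)
    finally show ?thesis .
  qed
  ultimately show "v \<in> down_kernel m b" by (simp add: down_kernel_def)
qed

lemma up_vector_orthogonal:
  assumes w: "w \<in> cfun.span (up_vector m ` subsets_below m b)"
    and v: "\<And>S. S \<in> subsets_below m b \<Longrightarrow> down_map m v S = 0"
  shows "(\<Sum>t\<in>set_tabloid m ` subsets_of_size m b. w t * v t) = 0"
  using w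
proof (induction rule: cfun.span_induct_alt)
  case base
  then show ?case by simp
next
  case (step c u w)
  let ?X = "set_tabloid m ` subsets_of_size m b"
  have finX: "finite ?X" using finite_subsets_of_size by simp
  obtain S where S: "S \<in> subsets_below m b" "u = up_vector m S" using step(1) by blast
  have one: "(\<Sum>t\<in>?X. tabloid_delta m (insert y S) t * v t) = v (set_tabloid m (insert y S))"
    if y: "y \<in> {1..m} - S" for y
  proof -
    have mem: "set_tabloid m (insert y S) \<in> ?X" using set_tabloid_insert_mem[OF S(1) y] by (rule imageI)
    have "(\<Sum>t\<in>?X. tabloid_delta m (insert y S) t * v t) =
        (\<Sum>t\<in>?X. if t = set_tabloid m (insert y S) then v t else 0)"
      by (rule sum.cong) (auto simp: tabloid_delta_def delta_def)
    also have "\<dots> = v (set_tabloid m (insert y S))" using finX mem by simp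
    finally show ?thesis .
  qed
  have "(\<Sum>t\<in>?X. u t * v t) = (\<Sum>y\<in>{1..m} - S. \<Sum>t\<in>?X. tabloid_delta m (insert y S) t * v t)"
    unfolding S(2) up_vector_def sum_fun_apply sum_distrib_right by (rule sum.swap)
  also have "\<dots> = down_map m v S" unfolding down_map_def by (rule sum.cong[OF refl]) (rule one)
  also have "\<dots> = 0" by (rule v[OF S(1)])
  finally have u0: "(\<Sum>t\<in>?X. u t * v t) = 0" .
  have "(\<Sum>t\<in>?X. (cscale c u + w) t * v t) = c * (\<Sum>t\<in>?X. u t * v t) + (\<Sum>t\<in>?X. w t * v t)"
    by (simp add: cscale_apply distrib_right sum.distrib sum_distrib_left mult.assoc)
  then show ?case unfolding u0 step(2) by simp
qed

text \<open>The span of the vectors \<open>up_vector m S\<close> is orthogonal to the kernel of the adjoint map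
  \<open>down_map m\<close>, so it meets this kernel only in zero.\<close>

lemma down_kernel_eq_span: "down_kernel m b = cfun.span (pair_products m b)"
proof (intro equalityI subsetI)
  fix v assume "v \<in> cfun.span (pair_products m b)"
  then show "v \<in> down_kernel m b"
    using cfun.span_minimal[OF pair_products_subset_down_kernel subspace_down_kernel] by blast
next
  fix v assume v: "v \<in> down_kernel m b"
  let ?X = "set_tabloid m ` subsets_of_size m b"
  have finX: "finite ?X" using finite_subsets_of_size by simp
  have "v = (\<Sum>t\<in>?X. cscale (v t) (delta t))"
    using v functions_on_expand[OF finX] by (simp add: down_kernel_def)
  also have "\<dots> \<in> cfun.span (pair_products m b \<union> up_vector m ` subsets_below m b)"
  proof (intro cfun.span_sum cfun.span_scale)
    fix t assume "t \<in> ?X"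
    then obtain A where A: "A \<in> subsets_of_size m b" "t = set_tabloid m A" by blast
    have "pair_product (tabloid_delta m) [] A \<in> cfun.span (pair_products m b \<union> up_vector m ` subsets_below m b)"
      using A by (intro pair_product_in_span) (auto simp: disjoint_pairs_def pair_points_simps)
    then show "delta t \<in> cfun.span (pair_products m b \<union> up_vector m ` subsets_below m b)"
      by (simp add: A tabloid_delta_def)
  qed
  finally obtain e w where ew: "v = e + w" "e \<in> cfun.span (pair_products m b)"
    "w \<in> cfun.span (up_vector m ` subsets_below m b)"
    unfolding cfun.span_Un by blast
  have eK: "e \<in> down_kernel m b"
    using ew(2) cfun.span_minimal[OF pair_products_subset_down_kernel subspace_down_kernel] by blast
  have "w = v - e" using ew(1) by simp
  then have wK: "w \<in> down_kernel m b" using cfun.subspace_diff[OF subspace_down_kernel v eK] by simp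
  \<comment> \<open>\<open>up_vector_orthogonal\<close> is a bilinear statement. Applied to
    \<open>w\<close> and its complex conjugate, which \<open>down_map\<close> kills too, it yields
    the squared norm of \<open>w\<close>.\<close>
  have "down_map m (\<lambda>t. cnj (w t)) S = 0" if "S \<in> subsets_below m b" for S
  proof -
    have "down_map m (\<lambda>t. cnj (w t)) S = cnj (down_map m w S)" by (simp add: down_map_def)
    also have "down_map m w S = 0" using wK that by (simp add: down_kernel_def)
    finally show ?thesis by simp
  qed
  then have "(\<Sum>t\<in>?X. w t * cnj (w t)) = 0" by (rule up_vector_orthogonal[OF ew(3)])
  then have "complex_of_real (\<Sum>t\<in>?X. (cmod (w t))\<^sup>2) = 0"
    by (simp only: complex_norm_square[symmetric] of_real_sum[symmetric])
  then have "(\<Sum>t\<in>?X. (cmod (w t))\<^sup>2) = 0" by (simp only: of_real_eq_0_iff)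
  then have "\<forall>t\<in>?X. (cmod (w t))\<^sup>2 = 0" using finX by (subst (asm) sum_nonneg_eq_0_iff) simp_all
  then have "w t = 0" for t using wK by (cases "t \<in> ?X") (auto simp: down_kernel_def functions_on_def)
  then have "w = 0" by (simp add: fun_eq_iff)
  then show "v \<in> cfun.span (pair_products m b)" using ew(1,2) by simp
qed

section \<open>Specht modules of two-rowed shapes\<close>

lemma two_rows_partition:
  assumes "2 * b \<le> m"
  shows "two_rows (m - b) b \<in> partitions_of m"
proof -
  have "antimono (two_rows (m - b) b)"
    by (rule antimonoI) (use assms in \<open>auto simp: two_rows_def\<close>)
  moreover have sub: "{i. two_rows (m - b) b i \<noteq> 0} \<subseteq> {0, 1}"
    by (auto simp: two_rows_def split: if_splits)
  then have "finite {i. two_rows (m - b) b i \<noteq> 0}" by (rule finite_subset) simp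
  moreover have "(\<Sum>i | two_rows (m - b) b i \<noteq> 0. two_rows (m - b) b i) = (\<Sum>i\<in>{0, 1}. two_rows (m - b) b i)"
    using sub by (intro sum.mono_neutral_left) auto
  moreover have "\<dots> = m" using assms by (simp add: two_rows_def)
  ultimately show ?thesis by (simp add: partitions_of_def)
qed

text \<open>For disjoint pairs, this is the group generated by the transpositions of the
  pairs.\<close>

definition pair_swaps :: "(nat \<times> nat) list \<Rightarrow> (nat \<Rightarrow> nat) set"
  where "pair_swaps ps = {\<pi>. \<pi> permutes pair_points ps \<and>
    (\<forall>x. \<pi> x = x \<or> (\<pi> x, x) \<in> set ps \<or> (x, \<pi> x) \<in> set ps)}"

lemma finite_pair_swaps: "finite (pair_swaps ps)"
  by (rule finite_subset[of _ "{\<pi>. \<pi> permutes pair_points ps}"])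
     (auto simp: pair_swaps_def finite_permutations finite_pair_points)

lemma pair_in_pair_points: "(x, y) \<in> set ps \<Longrightarrow> x \<in> pair_points ps \<and> y \<in> pair_points ps"
  by (force simp: pair_points_def)

lemma pair_swaps_Cons:
  assumes "disjoint_pairs ((x, y) # ps)"
  shows "pair_swaps ((x, y) # ps) = pair_swaps ps \<union> (\<lambda>\<pi>. \<pi> \<circ> transpose x y) ` pair_swaps ps"
proof -
  have d: "x \<noteq> y" "x \<notin> pair_points ps" "y \<notin> pair_points ps"
    using assms by (simp_all add: disjoint_pairs_Cons)
  have notin: "(x, z) \<notin> set ps" "(z, x) \<notin> set ps" "(y, z) \<notin> set ps" "(z, y) \<notin> set ps" for z
    using d pair_in_pair_points by blast+
  let ?t = "transpose x y" and ?Q = "pair_points ((x, y) # ps)"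
  have Q: "?Q = insert x (insert y (pair_points ps))" by (simp add: pair_points_simps)
  have t: "?t permutes ?Q" by (rule permutes_swap_id) (simp_all add: Q)
  have fixd: "\<pi> x = x" "\<pi> y = y" if "\<pi> \<in> pair_swaps ps" for \<pi>
    using that d by (auto simp: pair_swaps_def permutes_not_in)
  have big: "\<pi> \<in> pair_swaps ((x, y) # ps)" if pi: "\<pi> \<in> pair_swaps ps" for \<pi>
  proof -
    have "\<pi> permutes ?Q" using pi permutes_subset[of \<pi> "pair_points ps" ?Q] by (auto simp: pair_swaps_def Q)
    then show ?thesis using pi by (auto simp: pair_swaps_def)
  qed
  have small: "\<pi> \<in> pair_swaps ps" if pi: "\<pi> permutes ?Q" "\<pi> x = x" "\<pi> y = y"
    and c: "\<And>z. z \<noteq> x \<Longrightarrow> z \<noteq> y \<Longrightarrow> \<pi> z = z \<or> (\<pi> z, z) \<in> set ((x, y) # ps) \<or> (z, \<pi> z) \<in> set ((x, y) # ps)" for \<pi>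
  proof -
    have "\<pi> permutes pair_points ps"
      by (rule permutes_superset[OF pi(1)]) (use pi(2,3) in \<open>auto simp: Q\<close>)
    moreover have "\<pi> z = z \<or> (\<pi> z, z) \<in> set ps \<or> (z, \<pi> z) \<in> set ps" for z
      using c[of z] pi(2,3) by (cases "z = x \<or> z = y") auto
    ultimately show ?thesis by (simp add: pair_swaps_def)
  qed
  show ?thesis
  proof (intro equalityI subsetI)
    fix \<pi> assume pi: "\<pi> \<in> pair_swaps ((x, y) # ps)"
    then have perm: "\<pi> permutes ?Q" and
      c: "\<And>z. \<pi> z = z \<or> (\<pi> z, z) \<in> set ((x, y) # ps) \<or> (z, \<pi> z) \<in> set ((x, y) # ps)"
      by (auto simp: pair_swaps_def)
    have px: "\<pi> x = x \<or> \<pi> x = y" and py: "\<pi> y = x \<or> \<pi> y = y"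
      using c[of x] c[of y] notin d by auto
    have inj: "\<pi> x \<noteq> \<pi> y" using permutes_inj[OF perm] d(1) by (auto dest: injD)
    show "\<pi> \<in> pair_swaps ps \<union> (\<lambda>\<pi>. \<pi> \<circ> ?t) ` pair_swaps ps"
    proof (cases "\<pi> x = x")
      case True
      then have "\<pi> \<in> pair_swaps ps" using small[OF perm] py inj c by auto
      then show ?thesis by simp
    next
      case False
      then have sw: "\<pi> x = y" "\<pi> y = x" using px py inj by auto
      have "\<pi> \<circ> ?t \<in> pair_swaps ps"
      proof (rule small)
        show "\<pi> \<circ> ?t permutes ?Q" by (rule permutes_compose[OF t perm])
        show "(\<pi> \<circ> ?t) x = x" "(\<pi> \<circ> ?t) y = y" using sw by simp_all
        fix z assume "z \<noteq> x" "z \<noteq> y"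
        then have "(\<pi> \<circ> ?t) z = \<pi> z" by simp
        then show "(\<pi> \<circ> ?t) z = z \<or> ((\<pi> \<circ> ?t) z, z) \<in> set ((x, y) # ps) \<or> (z, (\<pi> \<circ> ?t) z) \<in> set ((x, y) # ps)"
          using c[of z] by simp
      qed
      moreover have "\<pi> = (\<pi> \<circ> ?t) \<circ> ?t" by (simp add: comp_assoc)
      ultimately show ?thesis by blast
    qed
  next
    fix \<pi> assume "\<pi> \<in> pair_swaps ps \<union> (\<lambda>\<pi>. \<pi> \<circ> ?t) ` pair_swaps ps"
    then consider "\<pi> \<in> pair_swaps ps" | \<rho> where "\<rho> \<in> pair_swaps ps" "\<pi> = \<rho> \<circ> ?t" by blast
    then show "\<pi> \<in> pair_swaps ((x, y) # ps)"
    proof cases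
      case 1 then show ?thesis by (rule big)
    next
      case 2
      have rho: "\<rho> permutes ?Q" "\<And>z. \<rho> z = z \<or> (\<rho> z, z) \<in> set ((x, y) # ps) \<or> (z, \<rho> z) \<in> set ((x, y) # ps)"
        using big[OF 2(1)] by (auto simp: pair_swaps_def)
      have "\<pi> z = z \<or> (\<pi> z, z) \<in> set ((x, y) # ps) \<or> (z, \<pi> z) \<in> set ((x, y) # ps)" for z
        using rho(2)[of z] fixd[OF 2(1)] by (cases "z = x \<or> z = y") (auto simp: 2(2))
      moreover have "\<pi> permutes ?Q" unfolding 2(2) by (rule permutes_compose[OF t rho(1)])
      ultimately show ?thesis by (simp add: pair_swaps_def)
    qed
  qed
qed

text \<open>Every pair is swapped or not, independently of the others, and each swap contributes a
  sign. The sum is thus the expansion of the product of differences.\<close>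

lemma pair_swaps_sum:
  assumes "disjoint_pairs ps" "C \<inter> pair_points ps = {}"
  shows "(\<Sum>\<pi>\<in>pair_swaps ps. cscale (of_int (sign \<pi>)) (f (\<pi> ` (fst ` set ps \<union> C)))) = pair_product f ps C"
  using assms
proof (induction ps arbitrary: C)
  case Nil
  have "pair_swaps [] = {id}" by (auto simp: pair_swaps_def pair_points_simps)
  then show ?case by (simp add: cscale_def)
next
  case (Cons p ps)
  obtain x y where p: "p = (x, y)" by (cases p)
  have d: "x \<noteq> y" "x \<notin> pair_points ps" "y \<notin> pair_points ps" "disjoint_pairs ps"
    using Cons.prems(1) by (simp_all add: p disjoint_pairs_Cons)
  have xy: "x \<notin> C" "y \<notin> C" "C \<inter> pair_points ps = {}"
    using Cons.prems(2) by (auto simp: p pair_points_simps)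
  let ?t = "transpose x y" and ?A = "fst ` set ps"
  let ?h = "\<lambda>\<pi>. cscale (of_int (sign \<pi>)) (f (\<pi> ` (fst ` set (p # ps) \<union> C)))"
  have A: "?A \<subseteq> pair_points ps" by (auto simp: pair_points_def)
  have fixd: "\<pi> x = x" "\<pi> y = y" if "\<pi> \<in> pair_swaps ps" for \<pi>
    using that d by (auto simp: pair_swaps_def permutes_not_in)
  have tt: "\<pi> \<circ> ?t \<circ> ?t = \<pi>" for \<pi> :: "nat \<Rightarrow> nat" by (simp add: comp_assoc)
  have inj: "inj_on (\<lambda>\<pi>. \<pi> \<circ> ?t) (pair_swaps ps)" by (rule inj_on_inverseI[of _ "\<lambda>\<pi>. \<pi> \<circ> ?t"]) (rule tt)
  have disj: "pair_swaps ps \<inter> (\<lambda>\<pi>. \<pi> \<circ> ?t) ` pair_swaps ps = {}"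
  proof (intro equals0I, elim IntE imageE)
    fix \<pi> \<rho> assume "\<pi> \<in> pair_swaps ps" "\<pi> = \<rho> \<circ> ?t" "\<rho> \<in> pair_swaps ps"
    then have "\<pi> x = y" "\<pi> x = x" using fixd[of \<pi>] fixd[of \<rho>] by simp_all
    then show False using d(1) by simp
  qed
  have "(\<Sum>\<pi>\<in>pair_swaps (p # ps). ?h \<pi>) =
      (\<Sum>\<pi>\<in>pair_swaps ps. ?h \<pi>) + (\<Sum>\<pi>\<in>(\<lambda>\<pi>. \<pi> \<circ> ?t) ` pair_swaps ps. ?h \<pi>)"
    unfolding p pair_swaps_Cons[OF Cons.prems(1)[unfolded p]]
    using finite_pair_swaps disj by (intro sum.union_disjoint) auto
  also have "(\<Sum>\<pi>\<in>(\<lambda>\<pi>. \<pi> \<circ> ?t) ` pair_swaps ps. ?h \<pi>) = (\<Sum>\<pi>\<in>pair_swaps ps. ?h (\<pi> \<circ> ?t))"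
    by (rule sum.reindex_cong[OF inj]) simp_all
  also have "\<dots> = (\<Sum>\<pi>\<in>pair_swaps ps. - cscale (of_int (sign \<pi>)) (f (\<pi> ` (?A \<union> insert y C))))"
  proof (rule sum.cong[OF refl])
    fix \<pi> assume pi: "\<pi> \<in> pair_swaps ps"
    have "permutation \<pi>" using pi finite_pair_points permutation_permutes by (auto simp: pair_swaps_def)
    then have sg: "sign (\<pi> \<circ> ?t) = - sign \<pi>"
      using d(1) by (simp add: sign_compose permutation_swap_id sign_swap_id)
    have "?t z = z" if "z \<in> ?A \<union> C" for z using that A d xy by (intro transpose_apply_other) auto
    then have "?t ` (?A \<union> C) = ?A \<union> C" by (simp add: image_def)
    then have "?t ` (fst ` set (p # ps) \<union> C) = ?A \<union> insert y C"
      by (simp add: p image_Un insert_commute)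
    then have "(\<pi> \<circ> ?t) ` (fst ` set (p # ps) \<union> C) = \<pi> ` (?A \<union> insert y C)"
      by (simp only: image_comp[symmetric])
    then show "?h (\<pi> \<circ> ?t) = - cscale (of_int (sign \<pi>)) (f (\<pi> ` (?A \<union> insert y C)))"
      unfolding sg by (simp add: fun_eq_iff cscale_def)
  qed
  also have "\<dots> = - pair_product f ps (insert y C)"
    unfolding sum_negf using xy d by (subst Cons.IH) auto
  also have "(\<Sum>\<pi>\<in>pair_swaps ps. ?h \<pi>) = pair_product f ps (insert x C)"
  proof -
    have "fst ` set (p # ps) \<union> C = ?A \<union> insert x C" by (auto simp: p)
    then show ?thesis using xy d by (simp only:) (subst Cons.IH; auto)
  qed
  finally show ?case by (simp add: p)
qed

text \<open>The entry in the second row comes first, since \<open>set_tabloid\<close> records the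
  second row and \<open>pair_product\<close> gives first components the positive sign.\<close>

definition pairs_of_columns :: "nat \<Rightarrow> (nat \<Rightarrow> nat \<times> nat) \<Rightarrow> (nat \<times> nat) list \<Rightarrow> bool"
  where "pairs_of_columns b T ps \<longleftrightarrow> length ps = b \<and>
    (\<forall>j<b. T (fst (ps ! j)) = (1, j) \<and> T (snd (ps ! j)) = (0, j))"

text \<open>Only the first \<open>b\<close> columns have two cells, so the column stabilizer
  consists of the swaps within the pairs, and \<open>pair_swaps_sum\<close> turns the signed sum
  into a product of differences.\<close>

lemma polytabloid_eq_pair_product:
  assumes T: "T \<in> tableaux m (two_rows (m - b) b)" and b: "2 * b \<le> m"
    and ps: "disjoint_pairs ps" "pair_points ps \<subseteq> {1..m}" "pairs_of_columns b T ps"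
  shows "polytabloid m T = pair_product (tabloid_delta m) ps {}"
proof -
  have bij: "bij_betw T {1..m} (diagram (two_rows (m - b) b))" using T by (simp add: tableaux_def)
  then have inj: "inj_on T {1..m}" and img: "T ` {1..m} = diagram (two_rows (m - b) b)"
    by (simp_all add: bij_betw_def)
  have cell: "(i, j) \<in> diagram (two_rows (m - b) b) \<longleftrightarrow> i = 0 \<and> j < m - b \<or> i = 1 \<and> j < b" for i j
    by (auto simp: diagram_def two_rows_def)
  have len: "length ps = b" and pT: "\<And>j. j < b \<Longrightarrow> T (fst (ps ! j)) = (1, j) \<and> T (snd (ps ! j)) = (0, j)"
    using ps(3) by (auto simp: pairs_of_columns_def)
  have pin: "fst (ps ! j) \<in> {1..m}" "snd (ps ! j) \<in> {1..m}" if "j < b" for j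
  proof -
    have "ps ! j \<in> set ps" using that len by simp
    then have "fst (ps ! j) \<in> pair_points ps" "snd (ps ! j) \<in> pair_points ps"
      by (auto simp: pair_points_def)
    then show "fst (ps ! j) \<in> {1..m}" "snd (ps ! j) \<in> {1..m}" using ps(2) by auto
  qed
  have row1: "fst (T x) = 1 \<longleftrightarrow> x \<in> fst ` set ps" if x: "x \<in> {1..m}" for x
  proof
    assume r: "fst (T x) = 1"
    obtain i j where ij: "T x = (i, j)" by (cases "T x")
    have "(i, j) \<in> diagram (two_rows (m - b) b)" using img x ij by (metis imageI)
    then have "i = 1" "j < b" using r ij by (auto simp: cell)
    then have "T x = T (fst (ps ! j))" using pT ij by simp
    then have "x = fst (ps ! j)" using inj x pin(1)[OF \<open>j < b\<close>] by (auto dest: inj_onD)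
    then show "x \<in> fst ` set ps" using \<open>j < b\<close> len by auto
  next
    assume "x \<in> fst ` set ps"
    then obtain j where "j < b" "x = fst (ps ! j)" using len by (auto simp: in_set_conv_nth)
    then show "fst (T x) = 1" using pT by simp
  qed
  have rows: "fst (T x) = 0 \<or> fst (T x) = 1" if "x \<in> {1..m}" for x
  proof -
    have "T x \<in> diagram (two_rows (m - b) b)" using img that by blast
    then show ?thesis using cell[of "fst (T x)" "snd (T x)"] by auto
  qed
  have tab: "tabloid m T = set_tabloid m (fst ` set ps)"
  proof
    fix x show "tabloid m T x = set_tabloid m (fst ` set ps) x"
      using row1[of x] rows[of x] by (cases "x \<in> {1..m}") (auto simp: tabloid_def set_tabloid_def)
  qed
  have column: "snd (T x) = snd (T z) \<longleftrightarrow> x = z \<or> (x, z) \<in> set ps \<or> (z, x) \<in> set ps"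
    if xz: "x \<in> {1..m}" "z \<in> {1..m}" for x z
  proof
    assume eq: "snd (T x) = snd (T z)"
    show "x = z \<or> (x, z) \<in> set ps \<or> (z, x) \<in> set ps"
    proof (cases "fst (T x) = fst (T z)")
      case True
      then have "T x = T z" using eq by (simp add: prod_eq_iff)
      then show ?thesis using inj xz by (auto dest: inj_onD)
    next
      case False
      have *: "(u, w) \<in> set ps" if uw: "u \<in> {1..m}" "w \<in> {1..m}" "fst (T u) = 1" "fst (T w) = 0" "snd (T u) = snd (T w)" for u w
      proof -
        let ?j = "snd (T u)"
        have Tu: "T u = (1, ?j)" and Tw: "T w = (0, ?j)" using uw(3-5) by (simp_all add: prod_eq_iff)
        have "T u \<in> diagram (two_rows (m - b) b)" using img uw(1) by blast
        then have j: "?j < b" using Tu cell[of 1 ?j] by simp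
        have "T u = T (fst (ps ! ?j))" "T w = T (snd (ps ! ?j))" using pT[OF j] Tu Tw by simp_all
        then have "u = fst (ps ! ?j)" "w = snd (ps ! ?j)"
          using inj uw(1,2) pin[OF j] by (auto dest: inj_onD)
        then have "(u, w) = ps ! ?j" by (metis prod.collapse)
        then show ?thesis using j len by (metis nth_mem)
      qed
      show ?thesis using rows[OF xz(1)] rows[OF xz(2)] False *[of x z] *[of z x] xz eq by auto
    qed
  next
    assume "x = z \<or> (x, z) \<in> set ps \<or> (z, x) \<in> set ps"
    moreover have "snd (T u) = snd (T w)" if uw: "(u, w) \<in> set ps" for u w
    proof -
      obtain j where "j < b" "ps ! j = (u, w)" using uw len by (auto simp: in_set_conv_nth)
      then show ?thesis using pT[of j] by simp
    qed
    ultimately show "snd (T x) = snd (T z)" by metis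
  qed
  have stab: "column_stabilizer m T = pair_swaps ps"
  proof (intro equalityI subsetI)
    fix \<pi> assume pi: "\<pi> \<in> column_stabilizer m T"
    then have perm: "\<pi> permutes {1..m}" and st: "\<And>x. x \<in> {1..m} \<Longrightarrow> snd (T (\<pi> x)) = snd (T x)"
      by (auto simp: column_stabilizer_def)
    have c: "\<pi> x = x \<or> (\<pi> x, x) \<in> set ps \<or> (x, \<pi> x) \<in> set ps" for x
    proof (cases "x \<in> {1..m}")
      case True
      moreover have "\<pi> x \<in> {1..m}" using permutes_in_image[OF perm] True by simp
      ultimately show ?thesis using column[of "\<pi> x" x] st by simp
    next
      case False then show ?thesis using permutes_not_in[OF perm] by simp
    qed
    have "\<pi> permutes pair_points ps"
    proof (rule permutes_superset[OF perm])
      fix x assume "x \<in> {1..m} - pair_points ps"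
      then show "\<pi> x = x" using c[of x] pair_in_pair_points by blast
    qed
    then show "\<pi> \<in> pair_swaps ps" using c by (simp add: pair_swaps_def)
  next
    fix \<pi> assume pi: "\<pi> \<in> pair_swaps ps"
    have perm: "\<pi> permutes {1..m}" using pi ps(2) permutes_subset by (auto simp: pair_swaps_def)
    have "snd (T (\<pi> x)) = snd (T x)" if "x \<in> {1..m}" for x
    proof -
      have "\<pi> x \<in> {1..m}" using permutes_in_image[OF perm] that by simp
      then show ?thesis using column[OF _ that, of "\<pi> x"] pi by (simp add: pair_swaps_def)
    qed
    then show "\<pi> \<in> column_stabilizer m T" using perm by (simp add: column_stabilizer_def)
  qed
  have "polytabloid m T = (\<Sum>\<pi>\<in>pair_swaps ps. cscale (of_int (sign \<pi>)) (tabloid_delta m (\<pi> ` (fst ` set ps \<union> {}))))"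
    unfolding polytabloid_eq column_antisymmetrizer_def stab
  proof (rule sum.cong[OF refl])
    fix \<pi> assume "\<pi> \<in> pair_swaps ps"
    then have perm: "\<pi> permutes {1..m}" using stab column_stabilizer_permutes by blast
    show "cscale (of_int (sign \<pi>)) (perm_action \<pi> (delta (tabloid m T))) =
        cscale (of_int (sign \<pi>)) (tabloid_delta m (\<pi> ` (fst ` set ps \<union> {})))"
      by (simp only: perm_action_delta[OF perm] tab set_tabloid_comp[OF perm] tabloid_delta_def Un_empty_right)
  qed
  also have "\<dots> = pair_product (tabloid_delta m) ps {}"
    by (rule pair_swaps_sum[OF ps(1)]) simp
  finally show ?thesis .
qed

lemma columns_of_tableau:
  assumes T: "T \<in> tableaux m (two_rows (m - b) b)" and b: "2 * b \<le> m"
  shows "\<exists>ps. disjoint_pairs ps \<and> pair_points ps \<subseteq> {1..m} \<and> pairs_of_columns b T ps"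
proof -
  let ?d = "diagram (two_rows (m - b) b)"
  have bij: "bij_betw T {1..m} ?d" using T by (simp add: tableaux_def)
  let ?g = "inv_into {1..m} T"
  have d: "(1, j) \<in> ?d" "(0, j) \<in> ?d" if "j < b" for j
    using that b by (auto simp: diagram_def two_rows_def)
  have g: "T (?g c) = c" "?g c \<in> {1..m}" if "c \<in> ?d" for c
  proof -
    have "c \<in> T ` {1..m}" using that bij by (simp only: bij_betw_def)
    then show "T (?g c) = c" "?g c \<in> {1..m}" by (rule f_inv_into_f, rule inv_into_into)
  qed
  define ps where "ps = map (\<lambda>j. (?g (1, j), ?g (0, j))) [0..<b]"
  have "pairs_of_columns b T ps" using g d by (auto simp: pairs_of_columns_def ps_def)
  moreover have "pair_points ps \<subseteq> {1..m}" using g(2) d by (auto simp: pair_points_def ps_def)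
  moreover have "disjoint_pairs ps"
  proof -
    have "inj_on ?g ?d" using bij by (metis bij_betw_def bij_betw_inv_into)
    moreover have "map fst ps @ map snd ps = map ?g (map (Pair 1) [0..<b] @ map (Pair 0) [0..<b])"
      by (simp add: ps_def o_def)
    moreover have "set (map (Pair 1) [0..<b] @ map (Pair 0) [0..<b]) \<subseteq> ?d" using d by auto
    moreover have "distinct (map (Pair (1::nat)) [0..<b] @ map (Pair 0) [0..<b])"
      by (auto simp: distinct_map inj_on_def)
    ultimately show ?thesis unfolding disjoint_pairs_def by (metis distinct_map inj_on_subset)
  qed
  ultimately show ?thesis by blast
qed

lemma tableau_of_columns:
  assumes ps: "disjoint_pairs ps" "pair_points ps \<subseteq> {1..m}" "length ps = b"
  shows "2 * b \<le> m" "\<exists>T\<in>tableaux m (two_rows (m - b) b). pairs_of_columns b T ps"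
proof -
  have dist: "distinct (map fst ps @ map snd ps)" using ps(1) by (simp add: disjoint_pairs_def)
  have pp: "set (map fst ps @ map snd ps) = pair_points ps" by (simp add: pair_points_def)
  have card: "card (pair_points ps) = 2 * b" using distinct_card[OF dist] pp ps(3) by simp
  then show b: "2 * b \<le> m" using card_mono[OF _ ps(2)] by simp
  \<comment> \<open>The points outside the pairs fill the rest of the first row in any order; by
    \<open>polytabloid_eq_pair_product\<close>, the polytabloid does not depend on it.\<close>
  obtain rs where rs: "set rs = {1..m} - pair_points ps" "distinct rs"
    using finite_distinct_list[of "{1..m} - pair_points ps"] by auto
  have lrs: "length rs = m - 2 * b"
    using distinct_card[OF rs(2)] rs(1) card card_Diff_subset[OF finite_pair_points ps(2)] by simp
  define as where "as = map fst ps"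
  define bs where "bs = map snd ps @ rs"
  have len: "length as = b" "length bs = m - b" using ps(3) lrs b by (simp_all add: as_def bs_def)
  have dab: "distinct (as @ bs)" using dist rs pp by (auto simp: as_def bs_def)
  have sab: "set (as @ bs) = {1..m}" using rs(1) pp ps(2) by (auto simp: as_def bs_def)
  let ?d = "diagram (two_rows (m - b) b)"
  have cell: "(i, j) \<in> ?d \<longleftrightarrow> i = 0 \<and> j < m - b \<or> i = 1 \<and> j < b" for i j
    by (auto simp: diagram_def two_rows_def)
  define g where "g c = (if fst c = 1 then as ! snd c else bs ! snd c)" for c :: "nat \<times> nat"
  have "inj_on g ?d"
  proof (rule inj_onI)
    fix c e assume ce: "c \<in> ?d" "e \<in> ?d" "g c = g e"
    obtain i j k l where eq: "c = (i, j)" "e = (k, l)" by (cases c, cases e)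
    have ne: "as ! u \<noteq> bs ! w" if uw: "u < b" "w < m - b" for u w
    proof -
      have "as ! u \<in> set as" "bs ! w \<in> set bs" using uw len by simp_all
      then show ?thesis using dab by auto
    qed
    have da: "distinct as" "distinct bs" using dab by simp_all
    show "c = e" using ce ne[of j l] ne[of l j] da len unfolding eq cell
      by (auto simp: g_def nth_eq_iff_index_eq)
  qed
  moreover have "g ` ?d = {1..m}"
  proof (intro equalityI subsetI)
    fix x assume "x \<in> g ` ?d"
    then obtain i j where "(i, j) \<in> ?d" "x = g (i, j)" by auto
    then have "x \<in> set (as @ bs)" using len by (auto simp: cell g_def)
    then show "x \<in> {1..m}" using sab by (simp only:)
  next
    fix x assume "x \<in> {1..m}"
    then have "x \<in> set as \<or> x \<in> set bs" using sab by auto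
    then obtain j where "j < b \<and> x = as ! j \<or> j < m - b \<and> x = bs ! j"
      using len by (auto simp: in_set_conv_nth)
    then have "(1, j) \<in> ?d \<and> x = g (1, j) \<or> (0, j) \<in> ?d \<and> x = g (0, j)" by (auto simp: cell g_def)
    then show "x \<in> g ` ?d" by blast
  qed
  ultimately have bg: "bij_betw g ?d {1..m}" by (simp add: bij_betw_def)
  define T where "T = restrict (inv_into ?d g) {1..m}"
  have "bij_betw T {1..m} ?d"
    unfolding T_def using bij_betw_inv_into[OF bg] by (subst bij_betw_cong[of _ _ "inv_into ?d g"]) auto
  then have "T \<in> tableaux m (two_rows (m - b) b)" by (simp add: tableaux_def T_def)
  moreover have "pairs_of_columns b T ps"
    unfolding pairs_of_columns_def
  proof (intro conjI allI impI)
    fix j assume j: "j < b"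
    have Tg: "T (g c) = c" if "c \<in> ?d" for c
    proof -
      have "g c \<in> {1..m}" by (rule bij_betw_apply[OF bg that])
      then have "T (g c) = inv_into ?d g (g c)" by (simp only: T_def restrict_apply if_True)
      also have "\<dots> = c" using bg that by (intro inv_into_f_f) (simp_all only: bij_betw_def)
      finally show ?thesis .
    qed
    have c1: "(1, j) \<in> ?d" and c0: "(0, j) \<in> ?d" using j b by (auto simp: cell)
    have "fst (ps ! j) = g (1, j)" "snd (ps ! j) = g (0, j)"
      using j ps(3) by (simp_all add: g_def as_def bs_def nth_append)
    then show "T (fst (ps ! j)) = (1, j)" "T (snd (ps ! j)) = (0, j)" using Tg c1 c0 by simp_all
  qed (rule ps(3))
  ultimately show "\<exists>T\<in>tableaux m (two_rows (m - b) b). pairs_of_columns b T ps" by blast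
qed

lemma specht_two_rows:
  assumes "2 * b \<le> m"
  shows "specht_module m (two_rows (m - b) b) = down_kernel m b"
proof -
  have "polytabloid m ` tableaux m (two_rows (m - b) b) = pair_products m b"
  proof (intro equalityI subsetI)
    fix v assume "v \<in> polytabloid m ` tableaux m (two_rows (m - b) b)"
    then obtain T where T: "T \<in> tableaux m (two_rows (m - b) b)" "v = polytabloid m T" by blast
    obtain ps where ps: "disjoint_pairs ps" "pair_points ps \<subseteq> {1..m}" "pairs_of_columns b T ps"
      using columns_of_tableau[OF T(1) assms] by blast
    then show "v \<in> pair_products m b"
      using polytabloid_eq_pair_product[OF T(1) assms ps] T(2)
      unfolding pair_products_def pairs_of_columns_def by blast
  next
    fix v assume "v \<in> pair_products m b"
    then obtain ps where ps: "disjoint_pairs ps" "pair_points ps \<subseteq> {1..m}" "length ps = b"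
      and v: "v = pair_product (tabloid_delta m) ps {}" unfolding pair_products_def by blast
    obtain T where T: "T \<in> tableaux m (two_rows (m - b) b)" "pairs_of_columns b T ps"
      using tableau_of_columns(2)[OF ps] by blast
    have "v = polytabloid m T" using polytabloid_eq_pair_product[OF T(1) assms ps(1,2) T(2)] v by (simp only:)
    then show "v \<in> polytabloid m ` tableaux m (two_rows (m - b) b)" using T(1) by (simp only: imageI)
  qed
  then show ?thesis by (simp add: specht_module_def down_kernel_eq_span)
qed

section \<open>The trace of a permutation on the kernel\<close>

lemma sum_of_bool_card:
  assumes "finite A"
  shows "(\<Sum>x\<in>A. of_bool (P x)) = (of_nat (card {x \<in> A. P x}) :: complex)"
proof -
  have "{x \<in> A. P x} = A \<inter> {x. P x}" by blast
  then show ?thesis using assms by simp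
qed

text \<open>Count the points \<open>y\<close> whose addition to \<open>S'\<close> leads into the
  layer. A point of \<open>S\<close> enlarges the intersection, and there are
  \<open>card S - c\<close> of them to add; any other point must avoid \<open>S \<union> S'\<close>,
  which has \<open>2 * card S - c\<close> elements.\<close>

lemma down_map_layer:
  assumes S: "S \<in> subsets_below m b" and S': "S' \<in> subsets_below m b"
  defines "c \<equiv> card (S' \<inter> S)"
  shows "down_map m (\<Sum>A | A \<in> subsets_of_size m b \<and> card (A \<inter> S) = i. tabloid_delta m A) S' =
    of_nat (card S - c) * of_bool (Suc c = i) + of_nat (m - (2 * card S - c)) * of_bool (c = i)"
proof -
  let ?L = "{A. A \<in> subsets_of_size m b \<and> card (A \<inter> S) = i}"
  have fS: "finite S" "finite S'" using S S' finite_subset[of _ "{1..m}"] by auto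
  have cards: "card S' = card S" using S S' by simp
  have finL: "finite ?L" by (rule finite_subset[OF _ finite_subsets_of_size(1)[of m b]]) auto
  have point: "(\<Sum>A\<in>?L. tabloid_delta m A) (set_tabloid m (insert y S')) =
      of_bool (Suc c = i) * of_bool (y \<in> S) + of_bool (c = i) * of_bool (y \<notin> S)" if y: "y \<in> {1..m} - S'" for y
  proof -
    have ins: "insert y S' \<in> subsets_of_size m b" by (rule set_tabloid_insert_mem[OF S' y])
    have "(\<Sum>A\<in>?L. tabloid_delta m A) (set_tabloid m (insert y S')) = (\<Sum>A\<in>?L. if A = insert y S' then 1 else 0)"
      unfolding sum_fun_apply
    proof (rule sum.cong[OF refl])
      fix A assume "A \<in> ?L"
      then have "set_tabloid m (insert y S') = set_tabloid m A \<longleftrightarrow> insert y S' = A"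
        using ins by (intro set_tabloid_eq_iff) simp_all
      then show "tabloid_delta m A (set_tabloid m (insert y S')) = (if A = insert y S' then 1 else 0)"
        by (auto simp: tabloid_delta_def delta_def)
    qed
    also have "\<dots> = of_bool (insert y S' \<in> ?L)" using finL by simp
    also have "insert y S' \<in> ?L \<longleftrightarrow> card (insert y S' \<inter> S) = i" using ins by simp
    also have "card (insert y S' \<inter> S) = (if y \<in> S then Suc c else c)"
      using y fS by (simp add: c_def)
    finally show ?thesis by (cases "y \<in> S") simp_all
  qed
  have n1: "card ({y\<in>{1..m} - S'. y \<in> S}) = card S - c"
  proof -
    have "{y\<in>{1..m} - S'. y \<in> S} = S - (S' \<inter> S)" using S by auto
    then show ?thesis using fS by (simp add: c_def card_Diff_subset)
  qed
  have n2: "card ({y\<in>{1..m} - S'. y \<notin> S}) = m - (2 * card S - c)"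
  proof -
    have "{y\<in>{1..m} - S'. y \<notin> S} = {1..m} - (S' \<union> S)" by auto
    moreover have "card (S' \<union> S) = 2 * card S - c"
      using card_Un_Int[OF fS(2,1)] cards by (simp add: c_def)
    moreover have "S' \<union> S \<subseteq> {1..m}" using S S' by auto
    ultimately show ?thesis using fS by (simp add: card_Diff_subset)
  qed
  have fin: "finite ({1..m} - S')" by simp
  have "down_map m (\<Sum>A\<in>?L. tabloid_delta m A) S' =
      (\<Sum>y\<in>{1..m} - S'. of_bool (Suc c = i) * of_bool (y \<in> S) + of_bool (c = i) * of_bool (y \<notin> S))"
    unfolding down_map_def by (rule sum.cong[OF refl]) (rule point)
  also have "\<dots> = of_bool (Suc c = i) * (\<Sum>y\<in>{1..m} - S'. of_bool (y \<in> S)) +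
      of_bool (c = i) * (\<Sum>y\<in>{1..m} - S'. of_bool (y \<notin> S))"
    by (simp only: sum.distrib sum_distrib_left)
  also have "(\<Sum>y\<in>{1..m} - S'. of_bool (y \<in> S)) = (of_nat (card S - c) :: complex)"
    unfolding n1[symmetric] by (rule sum_of_bool_card[OF fin])
  also have "(\<Sum>y\<in>{1..m} - S'. of_bool (y \<notin> S)) = (of_nat (m - (2 * card S - c)) :: complex)"
    unfolding n2[symmetric] by (rule sum_of_bool_card[OF fin])
  finally show ?thesis by (simp only: mult.commute)
qed

text \<open>By \<open>down_map_layer\<close>, the layers around \<open>S\<close> are mapped to the
  indicators of intersection sizes by a bidiagonal system with diagonal entries
  \<open>m - (2 * card S - i)\<close>. These are positive because \<open>card S < b\<close> and
  \<open>2 * b \<le> m\<close>, so the system can be solved by induction on \<open>i\<close>. For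
  \<open>i = card S\<close>, the indicator singles out \<open>S\<close>.\<close>

lemma down_map_preimage:
  assumes b: "2 * b \<le> m" and S: "S \<in> subsets_below m b"
  shows "\<exists>h\<in>functions_on (set_tabloid m ` subsets_of_size m b).
    \<forall>S'\<in>subsets_below m b. down_map m h S' = of_bool (card (S' \<inter> S) = i)"
proof (induction i)
  let ?V = "functions_on (set_tabloid m ` subsets_of_size m b)"
  let ?layer = "\<lambda>i. \<Sum>A | A \<in> subsets_of_size m b \<and> card (A \<inter> S) = i. tabloid_delta m A"
  note lin = clinear_add[OF clinear_down_map] clinear_scale[OF clinear_down_map]
  have layer: "?layer i \<in> ?V" for i
    by (rule cfun.subspace_sum[OF subspace_functions_on])
       (auto simp: functions_on_def tabloid_delta_def delta_def)
  have bS: "b = Suc (card S)" using S by simp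
  have cle: "card (S' \<inter> S) \<le> card S" for S' using S finite_subset[of S "{1..m}"] by (intro card_mono) auto
  {
    case 0
    define r where "r = (of_nat (m - 2 * card S) :: complex)"
    have "m - 2 * card S \<noteq> 0" using b bS by simp
    then have r: "r \<noteq> 0" unfolding r_def by (simp only: of_nat_eq_0_iff not_False_eq_True)
    show ?case
    proof (intro bexI ballI)
      show "cscale (1 / r) (?layer 0) \<in> ?V" by (rule cfun.subspace_scale[OF subspace_functions_on layer])
      fix S' assume S': "S' \<in> subsets_below m b"
      define c where "c = card (S' \<inter> S)"
      have e: "of_nat (m - (2 * card S - c)) * of_bool (c = 0) = r * of_bool (c = 0)"
        by (cases "c = 0") (simp_all add: r_def)
      have "down_map m (cscale (1 / r) (?layer 0)) S' = 1 / r * (of_nat (card S - c) * of_bool (Suc c = 0) + r * of_bool (c = 0))"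
        unfolding lin cscale_apply down_map_layer[OF S S'] c_def[symmetric] e ..
      then show "down_map m (cscale (1 / r) (?layer 0)) S' = of_bool (card (S' \<inter> S) = 0)"
        unfolding c_def[symmetric] using r by simp
    qed
  next
    case (Suc i)
    then obtain h where h: "h \<in> ?V" "\<And>S'. S' \<in> subsets_below m b \<Longrightarrow> down_map m h S' = of_bool (card (S' \<inter> S) = i)"
      by blast
    define r where "r = (of_nat (m - (2 * card S - Suc i)) :: complex)"
    define s where "s = (of_nat (card S - i) :: complex)"
    have "m - (2 * card S - Suc i) \<noteq> 0" using b bS by simp
    then have r: "r \<noteq> 0" unfolding r_def by (simp only: of_nat_eq_0_iff not_False_eq_True)
    show ?case
    proof (intro bexI ballI)
      show "cscale (1 / r) (?layer (Suc i) + cscale (- s) h) \<in> ?V"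
        by (intro cfun.subspace_scale[OF subspace_functions_on] cfun.subspace_add[OF subspace_functions_on] layer h(1))
      fix S' assume S': "S' \<in> subsets_below m b"
      define c where "c = card (S' \<inter> S)"
      have e1: "of_nat (card S - c) * of_bool (Suc c = Suc i) = s * of_bool (c = i)"
        by (cases "c = i") (simp_all add: s_def)
      have e2: "of_nat (m - (2 * card S - c)) * of_bool (c = Suc i) = r * of_bool (c = Suc i)"
        by (cases "c = Suc i") (simp_all add: r_def)
      have "down_map m (cscale (1 / r) (?layer (Suc i) + cscale (- s) h)) S' =
          1 / r * (down_map m (?layer (Suc i)) S' + - s * down_map m h S')"
        unfolding lin cscale_apply plus_fun_apply ..
      also have "\<dots> = 1 / r * ((s * of_bool (c = i) + r * of_bool (c = Suc i)) + - s * of_bool (c = i))"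
        unfolding down_map_layer[OF S S'] h(2)[OF S'] c_def[symmetric] e1 e2 ..
      also have "\<dots> = of_bool (c = Suc i)" using r by simp
      finally show "down_map m (cscale (1 / r) (?layer (Suc i) + cscale (- s) h)) S' = of_bool (card (S' \<inter> S) = Suc i)"
        unfolding c_def .
    qed
  }
qed

lemma sum_down_map_delta:
  assumes "S \<in> subsets_below m b"
  shows "(\<Sum>t\<in>set_tabloid m ` subsets_of_size m b. down_map m (delta t) S * f t) = down_map m f S"
proof -
  let ?X = "set_tabloid m ` subsets_of_size m b"
  have finX: "finite ?X" using finite_subsets_of_size by simp
  have "(\<Sum>t\<in>?X. down_map m (delta t) S * f t) =
      (\<Sum>y\<in>{1..m} - S. \<Sum>t\<in>?X. delta t (set_tabloid m (insert y S)) * f t)"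
    unfolding down_map_def sum_distrib_right by (rule sum.swap)
  also have "\<dots> = (\<Sum>y\<in>{1..m} - S. f (set_tabloid m (insert y S)))"
  proof (rule sum.cong[OF refl])
    fix y assume y: "y \<in> {1..m} - S"
    have "set_tabloid m (insert y S) \<in> ?X" by (rule imageI[OF set_tabloid_insert_mem[OF assms y]])
    moreover have "(\<Sum>t\<in>?X. delta t (set_tabloid m (insert y S)) * f t) =
        (\<Sum>t\<in>?X. if t = set_tabloid m (insert y S) then f t else 0)"
      by (rule sum.cong) (auto simp: delta_def)
    ultimately show "(\<Sum>t\<in>?X. delta t (set_tabloid m (insert y S)) * f t) = f (set_tabloid m (insert y S))"
      using finX by simp
  qed
  finally show ?thesis unfolding down_map_def .
qed

lemma set_tabloid_comp_inv:
  assumes "\<sigma> permutes {1..m}"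
  shows "set_tabloid m A \<circ> \<sigma> = set_tabloid m (inv \<sigma> ` A)"
  using set_tabloid_comp[OF permutes_inv[OF assms], of A] by (simp only: permutes_inv_inv[OF assms])

lemma inv_image_fixed_iff:
  assumes "\<sigma> permutes S"
  shows "inv \<sigma> ` A = A \<longleftrightarrow> \<sigma> ` A = A"
proof -
  have "\<sigma> ` inv \<sigma> ` A = A" "inv \<sigma> ` \<sigma> ` A = A"
    by (simp_all add: image_image permutes_inverses[OF assms])
  then show ?thesis by metis
qed

lemma inv_image_subsets:
  assumes "\<sigma> permutes {1..m}" "A \<subseteq> {1..m}"
  shows "inv \<sigma> ` A \<subseteq> {1..m}" "card (inv \<sigma> ` A) = card A"
proof -
  show "inv \<sigma> ` A \<subseteq> {1..m}"
    using permutes_image[OF permutes_inv[OF assms(1)]] assms(2) by blast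
  show "card (inv \<sigma> ` A) = card A"
    by (rule card_image[OF inj_on_subset[OF permutes_inj[OF permutes_inv[OF assms(1)]]]]) simp
qed

text \<open>\<open>down_map\<close> has a right inverse \<open>s\<close>, so \<open>1 - s \<circ> down_map\<close> projects onto its kernel, and the
  trace of \<open>\<sigma> \<circ> s \<circ> down_map\<close> is the trace of \<open>\<sigma>\<close> on the target of \<open>down_map\<close>.\<close>

lemma trace_down_kernel:
  assumes b: "2 * b \<le> m" and s: "\<sigma> permutes {1..m}"
  shows "trace_on (down_kernel m b) (perm_action \<sigma>) =
    of_nat (card {A \<in> subsets_of_size m b. \<sigma> ` A = A}) - of_nat (card {S \<in> subsets_below m b. \<sigma> ` S = S})"
proof -
  let ?X = "set_tabloid m ` subsets_of_size m b" and ?B = "subsets_below m b"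
  have finX: "finite ?X" and finB: "finite ?B" using finite_subsets_of_size by simp_all
  have "\<exists>h\<in>functions_on ?X. \<forall>S'\<in>?B. down_map m h S' = of_bool (S' = S)" if S: "S \<in> ?B" for S
  proof -
    obtain h where h: "h \<in> functions_on ?X" "\<And>S'. S' \<in> ?B \<Longrightarrow> down_map m h S' = of_bool (card (S' \<inter> S) = card S)"
      using down_map_preimage[OF b S, of "card S"] by blast
    have "card (S' \<inter> S) = card S \<longleftrightarrow> S' = S" if S': "S' \<in> ?B" for S'
    proof
      assume eq: "card (S' \<inter> S) = card S"
      have f: "finite S" "finite S'" using S S' finite_subset[of _ "{1..m}"] by auto
      have "S' \<inter> S = S" by (rule card_subset_eq[OF f(1) _ eq]) simp
      moreover have "S' \<inter> S = S'" by (rule card_subset_eq[OF f(2)]) (use eq S S' in auto)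
      ultimately show "S' = S" by blast
    qed simp
    then show ?thesis using h by (intro bexI[of _ h]) simp_all
  qed
  then have "\<forall>S\<in>?B. \<exists>h. h \<in> functions_on ?X \<and> (\<forall>S'\<in>?B. down_map m h S' = of_bool (S' = S))" by blast
  from bchoice[OF this] obtain w where "\<forall>S\<in>?B. w S \<in> functions_on ?X \<and> (\<forall>S'\<in>?B. down_map m (w S) S' = of_bool (S' = S))" ..
  then have w: "\<And>S. S \<in> ?B \<Longrightarrow> w S \<in> functions_on ?X"
    "\<And>S S'. S \<in> ?B \<Longrightarrow> S' \<in> ?B \<Longrightarrow> down_map m (w S) S' = of_bool (S' = S)" by blast+
  \<comment> \<open>\<open>trace_on_eq\<close> asks for a projection defined on all functions, so
    the values outside \<open>?X\<close> are cut off first.\<close>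
  define rest where "rest v = (\<lambda>t. if t \<in> ?X then v t else 0)" for v :: "(nat \<Rightarrow> nat) \<Rightarrow> complex"
  define sec where "sec g = (\<Sum>S\<in>?B. cscale (g S) (w S))" for g
  define P where "P v = rest v - sec (down_map m v)" for v
  have P_apply: "P v t = rest v t - (\<Sum>S\<in>?B. down_map m v S * w S t)" for v t
    unfolding P_def sec_def minus_apply sum_fun_apply cscale_apply ..
  have linP: "clinear P"
    unfolding clinear_def
  proof (intro conjI allI ext)
    fix u v c t
    show "P (u + v) t = (P u + P v) t"
      by (simp add: P_apply rest_def clinear_add[OF clinear_down_map] distrib_right sum.distrib)
    show "P (cscale c v) t = cscale c (P v) t"
      by (simp add: P_apply rest_def clinear_scale[OF clinear_down_map] cscale_apply right_diff_distrib
          sum_distrib_left mult.assoc)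
  qed
  have sec_in: "sec g \<in> functions_on ?X" for g
    unfolding sec_def
    by (intro cfun.subspace_sum[OF subspace_functions_on] cfun.subspace_scale[OF subspace_functions_on] w(1))
  have rest_in: "rest v \<in> functions_on ?X" for v by (simp add: functions_on_def rest_def)
  have rest_down: "down_map m (rest v) S = down_map m v S" if S: "S \<in> ?B" for v S
    unfolding down_map_def
  proof (rule sum.cong[OF refl])
    fix y assume "y \<in> {1..m} - S"
    then have "set_tabloid m (insert y S) \<in> ?X" by (rule imageI[OF set_tabloid_insert_mem[OF S]])
    then show "rest v (set_tabloid m (insert y S)) = v (set_tabloid m (insert y S))"
      unfolding rest_def by (rule if_P)
  qed
  have sec_down: "down_map m (sec g) S = g S" if S: "S \<in> ?B" for g S
  proof -
    have "down_map m (sec g) S = (\<Sum>S'\<in>?B. g S' * down_map m (w S') S)"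
      unfolding sec_def clinear_sum[OF clinear_down_map] clinear_scale[OF clinear_down_map] sum_fun_apply cscale_apply ..
    also have "\<dots> = (\<Sum>S'\<in>?B. if S' = S then g S else 0)"
      by (rule sum.cong[OF refl]) (use w(2) S in auto)
    also have "\<dots> = g S" using finB S by simp
    finally show ?thesis .
  qed
  have diff_down: "down_map m (u - v) S = down_map m u S - down_map m v S" for u v S
    by (simp add: down_map_def sum_subtractf)
  have "P v \<in> down_kernel m b" for v
  proof -
    have "P v \<in> functions_on ?X"
      unfolding P_def by (rule cfun.subspace_diff[OF subspace_functions_on rest_in sec_in])
    moreover have "down_map m (P v) S = 0" if "S \<in> ?B" for S
      unfolding P_def diff_down rest_down[OF that] sec_down[OF that] by simp
    ultimately show ?thesis unfolding down_kernel_def by blast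
  qed
  then have rangeP: "range P \<subseteq> down_kernel m b" by blast
  have idP: "P v = v" if v: "v \<in> down_kernel m b" for v
  proof
    fix t
    have "(\<Sum>S\<in>?B. down_map m v S * w S t) = 0"
      by (rule sum.neutral) (use v in \<open>simp add: down_kernel_def\<close>)
    moreover have "rest v t = v t" using v by (simp add: rest_def down_kernel_def functions_on_def)
    ultimately show "P v t = v t" by (simp add: P_apply)
  qed
  have subX: "down_kernel m b \<subseteq> functions_on ?X" by (auto simp: down_kernel_def)
  have inv: "perm_action \<sigma> ` down_kernel m b \<subseteq> down_kernel m b"
    using perm_action_specht[OF s, of "two_rows (m - b) b"] by (simp only: specht_two_rows[OF b])
  have comp_in: "t \<circ> \<sigma> \<in> ?X" if t: "t \<in> ?X" for t
  proof -
    obtain A where A: "A \<in> subsets_of_size m b" "t = set_tabloid m A" using t by blast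
    have "inv \<sigma> ` A \<in> subsets_of_size m b" using A(1) inv_image_subsets[OF s, of A] by simp
    then show ?thesis unfolding A(2) set_tabloid_comp_inv[OF s] by (rule imageI)
  qed
  have "trace_on (down_kernel m b) (perm_action \<sigma>) = (\<Sum>t\<in>?X. perm_action \<sigma> (P (delta t)) t)"
    by (rule trace_on_eq[OF finX subX subspace_down_kernel clinear_perm_action inv linP rangeP idP])
  also have "\<dots> = (\<Sum>t\<in>?X. of_bool (t \<circ> \<sigma> = t) - (\<Sum>S\<in>?B. down_map m (delta t) S * perm_action \<sigma> (w S) t))"
  proof (rule sum.cong[OF refl])
    fix t assume "t \<in> ?X"
    then have "rest (delta t) (t \<circ> \<sigma>) = of_bool (t \<circ> \<sigma> = t)"
      unfolding rest_def delta_def using comp_in by simp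
    then show "perm_action \<sigma> (P (delta t)) t =
        of_bool (t \<circ> \<sigma> = t) - (\<Sum>S\<in>?B. down_map m (delta t) S * perm_action \<sigma> (w S) t)"
      unfolding perm_action_def P_apply by (simp only:)
  qed
  also have "\<dots> = (\<Sum>t\<in>?X. of_bool (t \<circ> \<sigma> = t)) -
      (\<Sum>S\<in>?B. \<Sum>t\<in>?X. down_map m (delta t) S * perm_action \<sigma> (w S) t)"
    unfolding sum_subtractf by (subst (2) sum.swap) (rule refl)
  also have "(\<Sum>t\<in>?X. of_bool (t \<circ> \<sigma> = t)) = (of_nat (card {A \<in> subsets_of_size m b. \<sigma> ` A = A}) :: complex)"
  proof -
    have inj: "inj_on (set_tabloid m) (subsets_of_size m b)"
      by (rule inj_onI) (simp add: set_tabloid_eq_iff)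
    have "(\<Sum>t\<in>?X. of_bool (t \<circ> \<sigma> = t)) = (\<Sum>A\<in>subsets_of_size m b. of_bool (set_tabloid m A \<circ> \<sigma> = set_tabloid m A) :: complex)"
      by (subst sum.reindex[OF inj]) (simp only: o_def)
    also have "\<dots> = (\<Sum>A\<in>subsets_of_size m b. of_bool (\<sigma> ` A = A))"
    proof (rule sum.cong[OF refl])
      fix A assume A: "A \<in> subsets_of_size m b"
      then have "set_tabloid m (inv \<sigma> ` A) = set_tabloid m A \<longleftrightarrow> inv \<sigma> ` A = A"
        using inv_image_subsets[OF s, of A] by (intro set_tabloid_eq_iff) simp_all
      then show "of_bool (set_tabloid m A \<circ> \<sigma> = set_tabloid m A) = (of_bool (\<sigma> ` A = A) :: complex)"
        by (simp only: set_tabloid_comp_inv[OF s] inv_image_fixed_iff[OF s])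
    qed
    also have "\<dots> = of_nat (card {A \<in> subsets_of_size m b. \<sigma> ` A = A})"
      by (rule sum_of_bool_card[OF finite_subsets_of_size(1)])
    finally show ?thesis .
  qed
  also have "(\<Sum>S\<in>?B. \<Sum>t\<in>?X. down_map m (delta t) S * perm_action \<sigma> (w S) t) =
      of_nat (card {S \<in> ?B. \<sigma> ` S = S})"
  proof -
    \<comment> \<open>Equivariance of \<open>down_map\<close>: the value of
      \<open>down_map m (perm_action \<sigma> (w S))\<close> at \<open>S\<close> is that of
      \<open>down_map m (w S)\<close> at the preimage of \<open>S\<close> under
      \<open>\<sigma>\<close>. By the choice of \<open>w S\<close> it is 1 if \<open>S\<close> is
      fixed and 0 otherwise.\<close>
    have "(\<Sum>t\<in>?X. down_map m (delta t) S * perm_action \<sigma> (w S) t) = of_bool (\<sigma> ` S = S)" if S: "S \<in> ?B" for S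
    proof -
      have S1: "inv \<sigma> ` S \<in> ?B" using S inv_image_subsets[OF s, of S] by simp
      have "(\<Sum>t\<in>?X. down_map m (delta t) S * perm_action \<sigma> (w S) t) = down_map m (perm_action \<sigma> (w S)) S"
        by (rule sum_down_map_delta[OF S])
      also have "\<dots> = (\<Sum>y\<in>{1..m} - S. w S (set_tabloid m (insert (inv \<sigma> y) (inv \<sigma> ` S))))"
        by (simp only: down_map_def perm_action_def set_tabloid_comp_inv[OF s] image_insert)
      also have "\<dots> = (\<Sum>y\<in>{1..m} - inv \<sigma> ` S. w S (set_tabloid m (insert y (inv \<sigma> ` S))))"
      proof (rule sum.reindex_bij_witness[of _ \<sigma> "inv \<sigma>"])
        have in1: "inv \<sigma> y \<in> {1..m} \<longleftrightarrow> y \<in> {1..m}" "\<sigma> y \<in> {1..m} \<longleftrightarrow> y \<in> {1..m}" for y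
          by (rule permutes_in_image[OF permutes_inv[OF s]], rule permutes_in_image[OF s])
        have in2: "inv \<sigma> y \<in> inv \<sigma> ` S \<longleftrightarrow> y \<in> S" "\<sigma> y \<in> S \<longleftrightarrow> y \<in> inv \<sigma> ` S" for y
          using permutes_inverses[OF s] by (metis image_iff)+
        show "inv \<sigma> y \<in> {1..m} - inv \<sigma> ` S" if "y \<in> {1..m} - S" for y
          using that by (simp only: Diff_iff in1 in2 simp_thms)
        show "\<sigma> y \<in> {1..m} - S" if "y \<in> {1..m} - inv \<sigma> ` S" for y
          using that by (simp only: Diff_iff in1 in2 simp_thms)
      qed (simp_all only: permutes_inverses[OF s])
      also have "\<dots> = down_map m (w S) (inv \<sigma> ` S)" by (simp only: down_map_def)
      also have "\<dots> = of_bool (inv \<sigma> ` S = S)" by (rule w(2)[OF S S1])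
      finally show ?thesis by (simp only: inv_image_fixed_iff[OF s])
    qed
    then have "(\<Sum>S\<in>?B. \<Sum>t\<in>?X. down_map m (delta t) S * perm_action \<sigma> (w S) t) = (\<Sum>S\<in>?B. of_bool (\<sigma> ` S = S))"
      by (intro sum.cong[OF refl])
    also have "\<dots> = of_nat (card {S \<in> ?B. \<sigma> ` S = S})"
      by (rule sum_of_bool_card[OF finB])
    finally show ?thesis .
  qed
  finally show ?thesis .
qed

text \<open>For a permutation, this is the product of 1 + X^c over its cycle lengths c on
  \<open>{1..m}\<close>. The coefficients are the permutation characters on subsets of a given size.
  It is for characters what \<open>multiset_poly\<close> is for monomials.\<close>

definition fixed_subset_poly :: "nat \<Rightarrow> (nat \<Rightarrow> nat) \<Rightarrow> complex poly"
  where "fixed_subset_poly m \<sigma> = (\<Sum>A | A \<subseteq> {1..m} \<and> \<sigma> ` A = A. monom 1 (card A))"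

lemma coeff_fixed_subset_poly:
  "coeff (fixed_subset_poly m \<sigma>) b = of_nat (card {A \<in> subsets_of_size m b. \<sigma> ` A = A})"
proof -
  let ?F = "{A. A \<subseteq> {1..m} \<and> \<sigma> ` A = A}"
  have fin: "finite ?F" by (rule finite_subset[of _ "Pow {1..m}"]) auto
  have "coeff (fixed_subset_poly m \<sigma>) b = (\<Sum>A\<in>?F. of_bool (card A = b))"
    unfolding fixed_subset_poly_def coeff_sum by (rule sum.cong) auto
  also have "\<dots> = of_nat (card {A \<in> subsets_of_size m b. \<sigma> ` A = A})"
  proof -
    have "{A \<in> subsets_of_size m b. \<sigma> ` A = A} = {A \<in> ?F. card A = b}" by blast
    then show ?thesis using sum_of_bool_card[OF fin, of "\<lambda>A. card A = b"] by (simp only:)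
  qed
  finally show ?thesis .
qed

lemma irr_char_two_rows:
  assumes "2 * b \<le> m" "\<sigma> permutes {1..m}"
  shows "irr_char m (two_rows (m - b) b) \<sigma> = coeff ([:1, -1:] * fixed_subset_poly m \<sigma>) b"
proof -
  have "irr_char m (two_rows (m - b) b) \<sigma> = trace_on (down_kernel m b) (perm_action \<sigma>)"
    using assms by (simp only: irr_char_def restrict_to_sym_def if_True specht_two_rows)
  moreover have "(of_nat (card {S \<in> subsets_below m b. \<sigma> ` S = S}) :: complex) =
      (if b = 0 then 0 else coeff (fixed_subset_poly m \<sigma>) (b - 1))"
    unfolding coeff_fixed_subset_poly by (cases b) auto
  ultimately show ?thesis
    unfolding trace_down_kernel[OF assms] coeff_one_minus_X_mult coeff_fixed_subset_poly[of m \<sigma> b] by simp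
qed

text \<open>The complement of a fixed subset is fixed.\<close>

lemma palindromic_fixed_subset_poly:
  assumes s: "\<sigma> permutes {1..n}"
  shows "palindromic n (fixed_subset_poly n \<sigma>)"
  unfolding palindromic_def
proof (intro conjI allI impI)
  have compl: "{1..n} - A \<in> subsets_of_size n (n - j) \<and> \<sigma> ` ({1..n} - A) = {1..n} - A"
    if A: "A \<in> subsets_of_size n j" "\<sigma> ` A = A" for A j
  proof -
    have "finite A" using A finite_subset[of A "{1..n}"] by auto
    then have "card ({1..n} - A) = n - j" using A by (simp add: card_Diff_subset)
    moreover have "\<sigma> ` ({1..n} - A) = \<sigma> ` {1..n} - \<sigma> ` A"
      by (rule image_set_diff[OF permutes_inj[OF s]])
    ultimately show ?thesis using A(2) permutes_image[OF s] by auto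
  qed
  fix j assume j: "j \<le> n"
  have "bij_betw (\<lambda>A. {1..n} - A) {A \<in> subsets_of_size n (n - j). \<sigma> ` A = A} {A \<in> subsets_of_size n j. \<sigma> ` A = A}"
  proof (rule bij_betw_byWitness[where f' = "\<lambda>A. {1..n} - A"])
    show "(\<lambda>A. {1..n} - A) ` {A \<in> subsets_of_size n (n - j). \<sigma> ` A = A} \<subseteq> {A \<in> subsets_of_size n j. \<sigma> ` A = A}"
    proof (rule image_subsetI)
      fix A assume "A \<in> {A \<in> subsets_of_size n (n - j). \<sigma> ` A = A}"
      then show "{1..n} - A \<in> {A \<in> subsets_of_size n j. \<sigma> ` A = A}"
        using compl[of A "n - j"] j by simp
    qed
    show "(\<lambda>A. {1..n} - A) ` {A \<in> subsets_of_size n j. \<sigma> ` A = A} \<subseteq> {A \<in> subsets_of_size n (n - j). \<sigma> ` A = A}"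
    proof (rule image_subsetI)
      fix A assume "A \<in> {A \<in> subsets_of_size n j. \<sigma> ` A = A}"
      then show "{1..n} - A \<in> {A \<in> subsets_of_size n (n - j). \<sigma> ` A = A}"
        using compl[of A j] by simp
    qed
  qed (auto simp: double_diff)
  then show "coeff (fixed_subset_poly n \<sigma>) (n - j) = coeff (fixed_subset_poly n \<sigma>) j"
    unfolding coeff_fixed_subset_poly by (simp only: bij_betw_same_card)
next
  fix j assume j: "j > n"
  have "card A \<noteq> j" if "A \<subseteq> {1..n}" for A
    using card_mono[OF _ that] j by simp
  then have "{A \<in> subsets_of_size n j. \<sigma> ` A = A} = {}" by blast
  then show "coeff (fixed_subset_poly n \<sigma>) j = 0" unfolding coeff_fixed_subset_poly by (simp only: card.empty of_nat_0)
qed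

text \<open>The point \<open>Suc m\<close> is fixed by \<open>\<sigma>\<close>, so it may or may not
  be added to a fixed subset.\<close>

lemma fixed_subset_poly_Suc:
  assumes s: "\<sigma> permutes {1..m}"
  shows "fixed_subset_poly (Suc m) \<sigma> = fixed_subset_poly m \<sigma> * [:1, 1:]"
proof -
  let ?F = "{A. A \<subseteq> {1..m} \<and> \<sigma> ` A = A}"
  have fin: "finite ?F" by (rule finite_subset[of _ "Pow {1..m}"]) auto
  have fixed: "\<sigma> (Suc m) = Suc m" using permutes_not_in[OF s] by simp
  have interval: "{1..Suc m} = insert (Suc m) {1..m}" by auto
  have split: "{A. A \<subseteq> {1..Suc m} \<and> \<sigma> ` A = A} = ?F \<union> insert (Suc m) ` ?F"
  proof (intro equalityI subsetI)
    fix A assume A: "A \<in> {A. A \<subseteq> {1..Suc m} \<and> \<sigma> ` A = A}"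
    show "A \<in> ?F \<union> insert (Suc m) ` ?F"
    proof (cases "Suc m \<in> A")
      case True
      have "\<sigma> ` (A - {Suc m}) = \<sigma> ` A - \<sigma> ` {Suc m}" by (rule image_set_diff[OF permutes_inj[OF s]])
      then have "A - {Suc m} \<in> ?F" using A fixed by (auto simp: interval)
      then have "insert (Suc m) (A - {Suc m}) \<in> insert (Suc m) ` ?F" by (rule imageI)
      then show ?thesis using True by (simp only: insert_Diff UnI2)
    next
      case False
      have "A \<subseteq> insert (Suc m) {1..m}" using A by (simp only: interval mem_Collect_eq)
      then have "A \<subseteq> {1..m}" using False by blast
      then show ?thesis using A by blast
    qed
  next
    fix A assume "A \<in> ?F \<union> insert (Suc m) ` ?F"
    then consider "A \<in> ?F" | B where "B \<in> ?F" "A = insert (Suc m) B" by blast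
    then show "A \<in> {A. A \<subseteq> {1..Suc m} \<and> \<sigma> ` A = A}"
    proof cases
      case 1 then show ?thesis unfolding interval by blast
    next
      case 2
      then have "\<sigma> ` A = A" by (simp only: image_insert fixed mem_Collect_eq)
      moreover have "A \<subseteq> {1..Suc m}" using 2 unfolding interval by blast
      ultimately show ?thesis by blast
    qed
  qed
  have notin: "Suc m \<notin> A" if "A \<in> ?F" for A
  proof
    assume "Suc m \<in> A"
    then have "Suc m \<in> {1..m}" using that by blast
    then show False by simp
  qed
  have inj: "inj_on (insert (Suc m)) ?F"
    by (rule inj_onI) (use notin in \<open>metis insert_ident\<close>)
  have cardA: "card (insert (Suc m) A) = Suc (card A)" if "A \<in> ?F" for A
    using notin[OF that] that finite_subset[of A "{1..m}"] by simp
  have "fixed_subset_poly (Suc m) \<sigma> = (\<Sum>A\<in>?F. monom 1 (card A)) + (\<Sum>A\<in>insert (Suc m) ` ?F. monom 1 (card A))"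
    unfolding fixed_subset_poly_def split
    by (rule sum.union_disjoint) (use fin notin in auto)
  also have "(\<Sum>A\<in>insert (Suc m) ` ?F. monom (1::complex) (card A)) = (\<Sum>A\<in>?F. monom 1 (Suc (card A)))"
    by (rule sum.reindex_cong[OF inj refl]) (simp only: cardA)
  also have "\<dots> = (\<Sum>A\<in>?F. monom 1 (card A) * [:0, 1:])"
    by (rule sum.cong) (simp_all add: monom_Suc)
  also have "(\<Sum>A\<in>?F. monom 1 (card A)) + \<dots> = fixed_subset_poly m \<sigma> * ([:1:] + [:0, 1:])"
    unfolding distrib_left fixed_subset_poly_def sum_distrib_right by simp
  finally show ?thesis by simp
qed

lemma fixed_subset_poly_extend:
  assumes "\<sigma> permutes {1..n}"
  shows "fixed_subset_poly (n + k) \<sigma> = fixed_subset_poly n \<sigma> * [:1, 1:] ^ k"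
proof (induction k)
  case (Suc k)
  have "\<sigma> permutes {1..n + k}" by (rule permutes_subset[OF assms]) auto
  from fixed_subset_poly_Suc[OF this] show ?case
    unfolding add_Suc_right Suc.IH by (simp only: power_Suc2 mult.assoc)
qed simp

lemma fixed_subset_poly_conj:
  assumes s: "\<sigma> permutes {1..n}" and t: "\<tau> permutes {1..n}"
  shows "fixed_subset_poly n (\<tau> \<circ> \<sigma> \<circ> inv \<tau>) = fixed_subset_poly n \<sigma>"
proof -
  have inv: "inv \<tau> ` \<tau> ` A = A" "\<tau> ` inv \<tau> ` A = A" for A
    by (simp_all add: image_image permutes_inverses[OF t])
  have sub: "\<tau> ` A \<subseteq> {1..n}" "inv \<tau> ` A \<subseteq> {1..n}" if "A \<subseteq> {1..n}" for A
    using that permutes_image[OF t] permutes_image[OF permutes_inv[OF t]] by blast+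
  have conj: "(\<tau> \<circ> \<sigma> \<circ> inv \<tau>) ` A = \<tau> ` \<sigma> ` inv \<tau> ` A" for A by (simp only: image_comp comp_assoc)
  show ?thesis unfolding fixed_subset_poly_def
  proof (rule sum.reindex_bij_witness[of _ "(`) \<tau>" "(`) (inv \<tau>)"])
    fix A assume A: "A \<in> {A. A \<subseteq> {1..n} \<and> (\<tau> \<circ> \<sigma> \<circ> inv \<tau>) ` A = A}"
    then have "inv \<tau> ` \<tau> ` \<sigma> ` inv \<tau> ` A = inv \<tau> ` A" by (simp only: conj mem_Collect_eq)
    then show "inv \<tau> ` A \<in> {A. A \<subseteq> {1..n} \<and> \<sigma> ` A = A}" using A sub(2)[of A] by (simp only: inv(1)) blast
    show "monom 1 (card (inv \<tau> ` A)) = (monom 1 (card A) :: complex poly)"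
      using A inv_image_subsets(2)[OF t, of A] by simp
  next
    fix A assume A: "A \<in> {A. A \<subseteq> {1..n} \<and> \<sigma> ` A = A}"
    then have "(\<tau> \<circ> \<sigma> \<circ> inv \<tau>) ` \<tau> ` A = \<tau> ` A" by (simp only: conj inv mem_Collect_eq)
    then show "\<tau> ` A \<in> {A. A \<subseteq> {1..n} \<and> (\<tau> \<circ> \<sigma> \<circ> inv \<tau>) ` A = A}" using A sub(1)[of A] by blast
  qed (simp_all only: inv)
qed

lemma irr_char_two_rows_class_function:
  assumes "2 * b \<le> n"
  shows "irr_char n (two_rows (n - b) b) \<in> class_functions n"
  unfolding class_functions_def
proof (rule CollectI, intro conjI allI impI)
  show "irr_char n (two_rows (n - b) b) \<sigma> = 0" if "\<not> \<sigma> permutes {1..n}" for \<sigma>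
    using that by (simp only: irr_char_def restrict_to_sym_def if_False)
  fix \<sigma> \<tau> assume "\<sigma> permutes {1..n} \<and> \<tau> permutes {1..n}"
  then have st: "\<sigma> permutes {1..n}" "\<tau> permutes {1..n}" by simp_all
  have "\<tau> \<circ> \<sigma> \<circ> inv \<tau> permutes {1..n}"
    by (intro permutes_compose permutes_inv st)
  then show "irr_char n (two_rows (n - b) b) (\<tau> \<circ> \<sigma> \<circ> inv \<tau>) = irr_char n (two_rows (n - b) b) \<sigma>"
    by (simp only: irr_char_two_rows[OF assms] st fixed_subset_poly_conj)
qed

text \<open>The differences X^i - X^(n+1-i) with \<open>2 * i \<le> n\<close> form a basis of the
  antisymmetric polynomials. A middle coefficient, at \<open>2 * j = n + 1\<close>, equals its own
  negative and vanishes.\<close>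

lemma antisym_poly_expand:
  fixes D :: "complex poly"
  assumes "\<And>j. j \<le> n + 1 \<Longrightarrow> coeff D (n + 1 - j) = - coeff D j" "\<And>j. j > n + 1 \<Longrightarrow> coeff D j = 0"
  shows "D = (\<Sum>i | 2 * i \<le> n. smult (coeff D i) (monom 1 i - monom 1 (n + 1 - i)))"
proof (rule poly_eqI)
  fix j
  let ?I = "{i. 2 * i \<le> n}"
  have fin: "finite ?I" by (rule finite_subset[of _ "{..n}"]) auto
  have "coeff (\<Sum>i\<in>?I. smult (coeff D i) (monom 1 i - monom 1 (n + 1 - i))) j =
      (\<Sum>i\<in>?I. (if i = j then coeff D i else 0) - (if n + 1 - i = j then coeff D i else 0))"
    unfolding coeff_sum by (rule sum.cong) auto
  also have "\<dots> = (\<Sum>i\<in>?I. if i = j then coeff D i else 0) - (\<Sum>i\<in>?I. if n + 1 - i = j then coeff D i else 0)"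
    by (rule sum_subtractf)
  also have "(\<Sum>i\<in>?I. if i = j then coeff D i else 0) = (if 2 * j \<le> n then coeff D j else 0)"
    using fin by (simp add: sum.delta)
  also have "(\<Sum>i\<in>?I. if n + 1 - i = j then coeff D i else 0) =
      (\<Sum>i\<in>?I. if i = n + 1 - j then (if j \<le> n + 1 then coeff D i else 0) else 0)"
    by (rule sum.cong) auto
  also have "\<dots> = (if 2 * (n + 1 - j) \<le> n then (if j \<le> n + 1 then coeff D (n + 1 - j) else 0) else 0)"
    using fin by (simp add: sum.delta)
  also have "(if 2 * j \<le> n then coeff D j else 0) - \<dots> = coeff D j"
  proof -
    consider "j > n + 1" | "2 * j \<le> n" | "2 * j = n + 1" | "2 * (n + 1 - j) \<le> n" "j \<le> n + 1" "2 * j > n + 1" by linarith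
    then show ?thesis
    proof cases
      case 1 then show ?thesis using assms(2)[of j] by simp
    next
      case 2
      then have "\<not> 2 * (n + 1 - j) \<le> n" by linarith
      then show ?thesis using 2 by simp
    next
      case 3
      then have "n + 1 - j = j" by simp
      then have "coeff D j = 0" using assms(1)[of j] 3 eq_uminus_self[of "coeff D j"] by simp
      then show ?thesis using \<open>n + 1 - j = j\<close> by simp
    next
      case 4
      then have "\<not> 2 * j \<le> n" by linarith
      then show ?thesis using 4 assms(1)[of j] by (simp only: if_True if_False) simp
    qed
  qed
  finally show "coeff D j = coeff (\<Sum>i\<in>?I. smult (coeff D i) (monom 1 i - monom 1 (n + 1 - i))) j" by simp
qed

text \<open>What \<open>chord_sum (n - 1)\<close> contributes, after multiplication by (1 +
  X)^(n-2), when the product of 1 - X with the polynomial is replaced by the basis element X^i -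
  X^(n+1-i). It becomes the coefficient of the shape \<open>two_rows (n - i) i\<close> on both
  sides.\<close>

definition chord_weight :: "nat \<Rightarrow> nat \<Rightarrow> complex"
  where "chord_weight n i = (\<Sum>r\<le>n - 1. of_nat (no_short_chord_count r) *
    coeff ((monom 1 i - monom 1 (n + 1 - i)) * [:1, 1:] ^ (n - 2)) (n - 1 - r))"

text \<open>This leaves only the coefficients of index at most n / 2, which
  \<open>schur_two_rows_coeff\<close> and \<open>irr_char_two_rows\<close> identify with Schur
  coefficients and with character values.\<close>

lemma chord_sum_palindromic:
  assumes "palindromic n p"
  shows "chord_sum (n - 1) (p * [:1, 1:] ^ (n - 2)) =
    (\<Sum>i | 2 * i \<le> n. chord_weight n i * coeff ([:1, -1:] * p) i)"
proof -
  let ?D = "[:1, -1:] * p" and ?Q = "[:1, 1:] ^ (n - 2) :: complex poly" and ?I = "{i. 2 * i \<le> n}"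
  have D: "?D = (\<Sum>i\<in>?I. smult (coeff ?D i) (monom 1 i - monom 1 (n + 1 - i)))"
    by (rule antisym_poly_expand) (rule palindromic_antisym[OF assms], assumption)+
  have c: "coeff (?D * ?Q) k = (\<Sum>i\<in>?I. coeff ?D i * coeff ((monom 1 i - monom 1 (n + 1 - i)) * ?Q) k)" for k
    by (subst D) (simp only: sum_distrib_right coeff_sum mult_smult_left coeff_smult)
  have "chord_sum (n - 1) (p * ?Q) = (\<Sum>r\<le>n - 1. of_nat (no_short_chord_count r) * coeff (?D * ?Q) (n - 1 - r))"
    by (simp only: chord_sum_def mult.assoc)
  also have "\<dots> = (\<Sum>i\<in>?I. chord_weight n i * coeff ?D i)"
    unfolding c sum_distrib_left chord_weight_def sum_distrib_right
    by (subst sum.swap) (simp only: mult.commute mult.left_commute)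
  finally show ?thesis .
qed

lemma restricted_character_eq:
  assumes "n > 1"
  shows "restrict_to_sym n (\<Sum>r = 0..n - 1. cscale (of_nat (no_short_chord_count r))
      (irr_char (2 * n - 2) (two_rows (n - 1 + r) (n - 1 - r)))) =
    (\<Sum>i | 2 * i \<le> n. cscale (chord_weight n i) (irr_char n (two_rows (n - i) i)))"
proof
  fix \<sigma>
  show "restrict_to_sym n (\<Sum>r = 0..n - 1. cscale (of_nat (no_short_chord_count r))
      (irr_char (2 * n - 2) (two_rows (n - 1 + r) (n - 1 - r)))) \<sigma> =
    (\<Sum>i | 2 * i \<le> n. cscale (chord_weight n i) (irr_char n (two_rows (n - i) i))) \<sigma>"
  proof (cases "\<sigma> permutes {1..n}")
    case False
    then show ?thesis by (simp add: restrict_to_sym_def sum_fun_apply cscale_apply irr_char_def)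
  next
    case True
    \<comment> \<open>\<open>\<sigma>\<close> fixes the additional \<open>n - 2\<close> points,
      which produces the same factor (1 + X)^(n-2) as the blocks of length one in the matching
      count.\<close>
    have n: "2 * n - 2 = n + (n - 2)" using assms by simp
    have s: "\<sigma> permutes {1..2 * n - 2}" by (rule permutes_subset[OF True]) (use assms in auto)
    have "restrict_to_sym n (\<Sum>r = 0..n - 1. cscale (of_nat (no_short_chord_count r))
        (irr_char (2 * n - 2) (two_rows (n - 1 + r) (n - 1 - r)))) \<sigma> =
      (\<Sum>r\<le>n - 1. of_nat (no_short_chord_count r) * irr_char (2 * n - 2) (two_rows (n - 1 + r) (n - 1 - r)) \<sigma>)"
      using True by (simp only: restrict_to_sym_def if_True sum_fun_apply cscale_apply atLeast0AtMost)
    also have "\<dots> = chord_sum (n - 1) (fixed_subset_poly (2 * n - 2) \<sigma>)"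
      unfolding chord_sum_def
    proof (rule sum.cong[OF refl])
      fix r assume "r \<in> {..n - 1}"
      then have r: "n - 1 + r = (2 * n - 2) - (n - 1 - r)" "2 * (n - 1 - r) \<le> 2 * n - 2"
        using assms by auto
      show "of_nat (no_short_chord_count r) * irr_char (2 * n - 2) (two_rows (n - 1 + r) (n - 1 - r)) \<sigma> =
          of_nat (no_short_chord_count r) * coeff ([:1, -1:] * fixed_subset_poly (2 * n - 2) \<sigma>) (n - 1 - r)"
        by (simp only: r(1) irr_char_two_rows[OF r(2) s])
    qed
    also have "fixed_subset_poly (2 * n - 2) \<sigma> = fixed_subset_poly n \<sigma> * [:1, 1:] ^ (n - 2)"
      unfolding n by (rule fixed_subset_poly_extend[OF True])
    also have "chord_sum (n - 1) \<dots> = (\<Sum>i | 2 * i \<le> n. chord_weight n i * coeff ([:1, -1:] * fixed_subset_poly n \<sigma>) i)"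
      by (rule chord_sum_palindromic[OF palindromic_fixed_subset_poly[OF True]])
    also have "\<dots> = (\<Sum>i | 2 * i \<le> n. cscale (chord_weight n i) (irr_char n (two_rows (n - i) i))) \<sigma>"
      unfolding sum_fun_apply cscale_apply
      by (rule sum.cong[OF refl]) (simp only: irr_char_two_rows True mem_Collect_eq)
    finally show ?thesis .
  qed
qed

theorem theorem1p25:
  fixes n :: nat
  assumes "n > 1"
  shows "gallai_qsym n (n - 1) =
    frobenius_ch n (restrict_to_sym n
      (\<Sum>r = 0..n - 1. cscale (of_nat (no_short_chord_count r))
         (irr_char (2 * n - 2) (two_rows (n - 1 + r) (n - 1 - r)))))"
proof
  fix m
  let ?I = "{i. 2 * i \<le> n}"
  have "finite ?I" by (rule finite_subset[of _ "{..n}"]) auto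
  then have "frobenius_ch n (\<Sum>i\<in>?I. cscale (chord_weight n i) (irr_char n (two_rows (n - i) i))) =
      (\<Sum>i\<in>?I. cscale (chord_weight n i) (schur (two_rows (n - i) i)))"
    by (rule frobenius_ch_combination) (simp_all only: mem_Collect_eq two_rows_partition irr_char_two_rows_class_function)
  then have ch: "frobenius_ch n (\<Sum>i\<in>?I. cscale (chord_weight n i) (irr_char n (two_rows (n - i) i))) m =
      (\<Sum>i\<in>?I. chord_weight n i * schur (two_rows (n - i) i) m)"
    by (simp only: sum_fun_apply cscale_apply)
  have "gallai_qsym n (n - 1) m = (\<Sum>i\<in>?I. chord_weight n i * schur (two_rows (n - i) i) m)"
  proof (cases "size m = n")
    case True
    have "gallai_qsym n (n - 1) m = chord_sum (n - 1) (multiset_poly m * [:1, 1:] ^ (n - 2))"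
      using gallai_qsym_coeff[OF assms] True by simp
    also have "\<dots> = (\<Sum>i\<in>?I. chord_weight n i * coeff ([:1, -1:] * multiset_poly m) i)"
      using palindromic_multiset_poly[of m] True by (intro chord_sum_palindromic) simp
    also have "\<dots> = (\<Sum>i\<in>?I. chord_weight n i * schur (two_rows (n - i) i) m)"
      by (rule sum.cong[OF refl]) (simp only: schur_two_rows_coeff[OF True] mem_Collect_eq)
    finally show ?thesis .
  next
    case False
    have "schur (two_rows (n - i) i) m = 0" if "i \<in> ?I" for i
      by (rule schur_two_rows_size_neq) (use False that in auto)
    then have "(\<Sum>i\<in>?I. chord_weight n i * schur (two_rows (n - i) i) m) = 0"
      by (intro sum.neutral) simp
    then show ?thesis using gallai_qsym_coeff[OF assms] False by simp
  qed
  then show "gallai_qsym n (n - 1) m = frobenius_ch n (restrict_to_sym n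
      (\<Sum>r = 0..n - 1. cscale (of_nat (no_short_chord_count r))
         (irr_char (2 * n - 2) (two_rows (n - 1 + r) (n - 1 - r))))) m"
    unfolding restricted_character_eq[OF assms] ch .
qed

end
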